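(* Let $G$ be a simple graph with vertex set $[\ell]=\{1,\dots,\ell\}$. Then $$\mathrm{Hilb}\big(H^i_{\mathfrak{m}_S}(\Omega^1(\mathcal{A}_G)),t\big)=\sum_{\varnothing\ne W\subset[\ell]}\Big(\dim_{\mathbb{K}}H_{\ell-i}\big(\Delta(G[W])\big)\Big)\frac{t^{-(2\ell-\#W)}}{(1-t^{-1})^{\ell-\#W+1}}$$ for all $i$.
   Context: Let $\mathbb{K}$ be a field, $V=\mathbb{K}^\ell$ and $S=\mathbb{K}[x_1,\dots,x_\ell]$ with $\deg x_i=1$, where $x_1,\dots,x_\ell$ are the coordinate functions; $\mathfrak{m}_S=(x_1,\dots,x_\ell)$ and $H^i_{\mathfrak{m}_S}(-)$ is local cohomology, with its natural grading. For a simple graph $G$ with vertex set $[\ell]$ and edge set $E(G)$, the graphic arrangement is $\mathcal{A}_G=\{\{x_u=x_v\}\mid\{u,v\}\in E(G)\}$. For $W\subset[\ell]$, $G[W]$ is the induced subgraph on $W$. $\Delta(\Gamma)$ is the clique complex of a graph $\Gamma$, i.e. the simplicial complex of all sets of pairwise adjacent vertices of $\Gamma$. $H_k(\Delta)$ denotes ordinary (unreduced) simplicial homology with coefficients in $\mathbb{K}$ (zero for $k<0$). For a finite set $\mathcal{A}$ of linear hyperplanes in $V$, $\alpha_H\in V^*$ denotes a defining linear form of $H\in\mathcal{A}$ and $Q(\mathcal{A})=\prod_{H\in\mathcal{A}}\alpha_H$. Let $\Omega_V^1=\bigoplus_i S\,dx_i$, $\Omega_V^2=\bigwedge^2\Omega_V^1$,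 and for $\alpha=\sum c_ix_i$ let $d\alpha=\sum c_i\,dx_i$. Define $$\Omega^1(\mathcal{A})=\{\omega\in \tfrac{1}{Q(\mathcal{A})}\Omega^1_V \mid Q(\mathcal{A})\,\omega\wedge d\alpha_H\in\alpha_H\Omega_V^2\ \text{for all } H\in\mathcal{A}\},$$ graded by $\deg(dx_i)=0$. For a graded module $M=\bigoplus_{i\in\mathbb{Z}}M_i$, $\mathrm{Hilb}(M,t)=\sum_{i\in\mathbb{Z}}(\dim_{\mathbb{K}}M_i)t^i$; the right-hand side is expanded as a power series in $t^{-1}$. *)

theory Defs
  imports
    "HOL-Library.Poly_Mapping"
    "HOL-Library.Function_Algebras"
    "HOL-Computational_Algebra.Polynomial_Factorial"
    "HOL-Computational_Algebra.Formal_Laurent_Series"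
begin

subsection \<open>The polynomial ring and its field of fractions\<close>

text \<open>Polynomials have variables indexed by all natural numbers; \<open>S = K[x_1, ..., x_l]\<close> is the
  subring \<open>poly_ring l\<close> of polynomials in the variables with index in \<open>{1..l}\<close>. All modules below
  are \<open>S\<close>-submodules of vector spaces over rational functions.\<close>

type_synonym 'k mpoly = "(nat \<Rightarrow>\<^sub>0 nat) \<Rightarrow>\<^sub>0 'k"
type_synonym 'k ratfun = "'k mpoly fract"

definition const :: "'k::field \<Rightarrow> 'k ratfun" where
  "const c = to_fract (Poly_Mapping.single 0 c)"

definition var :: "nat \<Rightarrow> 'k::field ratfun" where
  "var i = to_fract (Poly_Mapping.single (Poly_Mapping.single i 1) 1)"

definition mpolys :: "nat \<Rightarrow> 'k::field mpoly set" where
  "mpolys l = {p. \<forall>m \<in> Poly_Mapping.keys p. Poly_Mapping.keys m \<subseteq> {1..l}}"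

definition poly_ring :: "nat \<Rightarrow> 'k::field ratfun set" where
  "poly_ring l = to_fract ` mpolys l"

definition mdeg :: "(nat \<Rightarrow>\<^sub>0 nat) \<Rightarrow> nat" where
  "mdeg m = (\<Sum>i \<in> Poly_Mapping.keys m. Poly_Mapping.lookup m i)"

definition homogeneous :: "nat \<Rightarrow> 'k::field mpoly \<Rightarrow> bool" where
  "homogeneous a p \<longleftrightarrow> (\<forall>m \<in> Poly_Mapping.keys p. mdeg m = a)"

definition rat_homogeneous :: "nat \<Rightarrow> int \<Rightarrow> 'k::field ratfun set" where
  "rat_homogeneous l d =
     insert 0 {Fract p q | p q. p \<in> mpolys l \<and> q \<in> mpolys l \<and> q \<noteq> 0 \<and>
        (\<exists>a b. homogeneous a p \<and> homogeneous b q \<and> int a - int b = d)}"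

subsection \<open>Hyperplane arrangements and logarithmic 1-forms\<close>

definition space :: "nat \<Rightarrow> (nat \<Rightarrow> 'k::field) set" where
  "space l = {v. \<forall>i. i \<notin> {1..l} \<longrightarrow> v i = 0}"

text \<open>A linear form \<open>c_1 x_1 + ... + c_l x_l\<close> is given by its coefficient vector \<open>c\<close>.\<close>

definition is_defining_form :: "nat \<Rightarrow> (nat \<Rightarrow> 'k::field) set \<Rightarrow> (nat \<Rightarrow> 'k) \<Rightarrow> bool" where
  "is_defining_form l H c \<longleftrightarrow>
     c \<in> space l \<and> c \<noteq> 0 \<and> H = {v \<in> space l. (\<Sum>i = 1..l. c i * v i) = 0}"

text \<open>Defining forms are unique up to a nonzero scalar, on which \<open>Omega1\<close> below does not depend.\<close>

definition alpha :: "nat \<Rightarrow> (nat \<Rightarrow> 'k::field) set \<Rightarrow> (nat \<Rightarrow> 'k)" where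
  "alpha l H = (SOME c. is_defining_form l H c)"

definition form_poly :: "nat \<Rightarrow> (nat \<Rightarrow> 'k::field) \<Rightarrow> 'k ratfun" where
  "form_poly l c = (\<Sum>i = 1..l. const (c i) * var i)"

definition Q :: "nat \<Rightarrow> (nat \<Rightarrow> 'k::field) set set \<Rightarrow> 'k ratfun" where
  "Q l \<A> = (\<Prod>H \<in> \<A>. form_poly l (alpha l H))"

text \<open>A rational 1-form is the function of its coefficients: \<open>\<omega> i\<close> is the coefficient of \<open>dx_i\<close>.
  A rational 2-form is a function on pairs, its value at \<open>(i, j)\<close> being the coefficient of
  \<open>dx_i \<and> dx_j\<close> for \<open>i < j\<close>, and zero at the other pairs.\<close>

type_synonym 'k form1 = "nat \<Rightarrow> 'k ratfun"
type_synonym 'k form2 = "nat \<times> nat \<Rightarrow> 'k ratfun"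

definition Omega1_V :: "nat \<Rightarrow> 'k::field form1 set" where
  "Omega1_V l = {\<omega>. \<forall>i. \<omega> i \<in> poly_ring l \<and> (i \<notin> {1..l} \<longrightarrow> \<omega> i = 0)}"

definition Omega2_V :: "nat \<Rightarrow> 'k::field form2 set" where
  "Omega2_V l = {\<eta>. \<forall>i j. \<eta> (i, j) \<in> poly_ring l \<and>
                     (\<not> (1 \<le> i \<and> i < j \<and> j \<le> l) \<longrightarrow> \<eta> (i, j) = 0)}"

definition d_form :: "(nat \<Rightarrow> 'k::field) \<Rightarrow> 'k form1" where
  "d_form c = (\<lambda>i. const (c i))"

definition wedge :: "'k::field form1 \<Rightarrow> 'k form1 \<Rightarrow> 'k form2" where
  "wedge \<omega> \<theta> = (\<lambda>(i, j). if i < j then \<omega> i * \<theta> j - \<omega> j * \<theta> i else 0)"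

definition fmult :: "'k::field ratfun \<Rightarrow> ('a \<Rightarrow> 'k ratfun) \<Rightarrow> 'a \<Rightarrow> 'k ratfun" where
  "fmult f \<omega> = (\<lambda>a. f * \<omega> a)"

definition Omega1 :: "nat \<Rightarrow> (nat \<Rightarrow> 'k::field) set set \<Rightarrow> 'k form1 set" where
  "Omega1 l \<A> = {\<omega> \<in> fmult (1 / Q l \<A>) ` Omega1_V l.
     \<forall>H \<in> \<A>. wedge (fmult (Q l \<A>) \<omega>) (d_form (alpha l H))
               \<in> fmult (form_poly l (alpha l H)) ` Omega2_V l}"

subsection \<open>Graphs, clique complexes and the graphic arrangement\<close>

definition simple_graph :: "'a set \<Rightarrow> 'a set set \<Rightarrow> bool" where
  "simple_graph V E \<longleftrightarrow> (\<forall>e \<in> E. e \<subseteq> V \<and> card e = 2)"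

definition induced_edges :: "'a set set \<Rightarrow> 'a set \<Rightarrow> 'a set set" where
  "induced_edges E W = {e \<in> E. e \<subseteq> W}"

definition clique_complex :: "'a set \<Rightarrow> 'a set set \<Rightarrow> 'a set set" where
  "clique_complex V E =
     {\<sigma>. finite \<sigma> \<and> \<sigma> \<subseteq> V \<and> (\<forall>u \<in> \<sigma>. \<forall>v \<in> \<sigma>. u \<noteq> v \<longrightarrow> {u, v} \<in> E)}"

definition graphic_arrangement :: "nat \<Rightarrow> nat set set \<Rightarrow> (nat \<Rightarrow> 'k::field) set set" where
  "graphic_arrangement l E = {{x \<in> space l. x u = x v} | u v. {u, v} \<in> E}"

subsection \<open>Dimension of a quotient vector space\<close>

text \<open>\<open>X\<close> is a set of vectors of \<open>Z\<close> whose classes are pairwise distinct and form a basis of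
  \<open>Z / B\<close>, where \<open>s\<close> is the scalar multiplication.\<close>

definition quotient_basis ::
  "('k::field \<Rightarrow> 'v \<Rightarrow> 'v::ab_group_add) \<Rightarrow> 'v set \<Rightarrow> 'v set \<Rightarrow> 'v set \<Rightarrow> bool" where
  "quotient_basis s Z B X \<longleftrightarrow> X \<subseteq> Z \<and>
     (\<forall>Y c. finite Y \<and> Y \<subseteq> X \<and> (\<Sum>x\<in>Y. s (c x) x) \<in> B \<longrightarrow> (\<forall>x\<in>Y. c x = 0)) \<and>
     (\<forall>z\<in>Z. \<exists>Y c. finite Y \<and> Y \<subseteq> X \<and> z - (\<Sum>x\<in>Y. s (c x) x) \<in> B)"

definition finite_dim_quotient ::
  "('k::field \<Rightarrow> 'v \<Rightarrow> 'v::ab_group_add) \<Rightarrow> 'v set \<Rightarrow> 'v set \<Rightarrow> bool" where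
  "finite_dim_quotient s Z B \<longleftrightarrow> (\<exists>X. finite X \<and> quotient_basis s Z B X)"

definition dim_quotient ::
  "('k::field \<Rightarrow> 'v \<Rightarrow> 'v::ab_group_add) \<Rightarrow> 'v set \<Rightarrow> 'v set \<Rightarrow> nat" where
  "dim_quotient s Z B = (THE n. \<exists>X. finite X \<and> quotient_basis s Z B X \<and> card X = n)"

subsection \<open>Simplicial homology\<close>

text \<open>Unreduced oriented simplicial chains with coefficients in \<open>'k\<close>. A face \<open>\<sigma>\<close> stands for the
  oriented simplex listing its vertices in increasing order, so that in the boundary of \<open>insert v \<tau>\<close>
  the face \<open>\<tau>\<close> has sign \<open>(-1)^j\<close> with \<open>j\<close> the position of \<open>v\<close>. The empty face is not a generator.\<close>

definition position :: "nat \<Rightarrow> nat set \<Rightarrow> nat" where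
  "position v \<tau> = card {u \<in> \<tau>. u < v}"

definition chains :: "nat set set \<Rightarrow> int \<Rightarrow> (nat set \<Rightarrow> 'k::field) set" where
  "chains \<Delta> k = {c. finite {\<sigma>. c \<sigma> \<noteq> 0} \<and>
     (\<forall>\<sigma>. c \<sigma> \<noteq> 0 \<longrightarrow> \<sigma> \<in> \<Delta> \<and> \<sigma> \<noteq> {} \<and> int (card \<sigma>) = k + 1)}"

definition boundary :: "(nat set \<Rightarrow> 'k::field) \<Rightarrow> (nat set \<Rightarrow> 'k)" where
  "boundary c = (\<lambda>\<tau>. if \<tau> = {} then 0
     else \<Sum>v | v \<notin> \<tau> \<and> c (insert v \<tau>) \<noteq> 0. (-1) ^ position v \<tau> * c (insert v \<tau>))"

definition homology_dim :: "'k::field itself \<Rightarrow> int \<Rightarrow> nat set set \<Rightarrow> nat" where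
  "homology_dim _ k \<Delta> = dim_quotient (\<lambda>a c \<sigma>. a * c \<sigma> :: 'k)
     {c \<in> chains \<Delta> k. boundary c = 0} (boundary ` chains \<Delta> (k + 1))"

subsection \<open>Local cohomology\<close>

text \<open>Local cohomology with support in \<open>(x_1, ..., x_l)\<close> is the cohomology of the (extended) Cech
  complex \<open>0 \<rightarrow> M \<rightarrow> \<Oplus>_i M[1/x_i] \<rightarrow> \<Oplus>_(i<j) M[1/(x_i x_j)] \<rightarrow> ... \<rightarrow> M[1/(x_1 ... x_l)] \<rightarrow> 0\<close>, with
  \<open>M\<close> in degree 0. Here \<open>M\<close> is an \<open>S\<close>-submodule of \<open>Frac(S)^l\<close>, and its localization at \<open>f\<close> is
  realized inside that vector space. Cochains are families indexed by subsets \<open>F\<close> of \<open>{1..l}\<close>.\<close>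

definition localize :: "'k::field form1 set \<Rightarrow> 'k ratfun \<Rightarrow> 'k form1 set" where
  "localize M f = {fmult (1 / f ^ n) m | m n. m \<in> M}"

type_synonym 'k cochain = "nat set \<Rightarrow> 'k form1"

definition cech_cochains :: "nat \<Rightarrow> 'k::field form1 set \<Rightarrow> int \<Rightarrow> 'k cochain set" where
  "cech_cochains l M p = {c. \<forall>F.
     if F \<subseteq> {1..l} \<and> int (card F) = p then c F \<in> localize M (\<Prod>i\<in>F. var i) else c F = 0}"

definition cech_diff :: "nat \<Rightarrow> 'k::field cochain \<Rightarrow> 'k cochain" where
  "cech_diff l c = (\<lambda>F. if F \<subseteq> {1..l}
     then \<Sum>v\<in>F. fmult ((-1) ^ position v F) (c (F - {v})) else 0)"

definition cochain_scale :: "'k::field \<Rightarrow> 'k cochain \<Rightarrow> 'k cochain" where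
  "cochain_scale a c = (\<lambda>F. fmult (const a) (c F))"

text \<open>The grading of the Cech complex is induced by \<open>deg x_i = 1\<close> and \<open>deg dx_i = 0\<close>.\<close>

definition cochain_degree :: "nat \<Rightarrow> int \<Rightarrow> 'k::field cochain set" where
  "cochain_degree l d = {c. \<forall>F i. c F i \<in> rat_homogeneous l d}"

text \<open>The degree \<open>d\<close> part of local cohomology is
  \<open>local_cocycles l M p d / local_coboundaries l M p d\<close>.\<close>

definition local_cocycles :: "nat \<Rightarrow> 'k::field form1 set \<Rightarrow> int \<Rightarrow> int \<Rightarrow> 'k cochain set" where
  "local_cocycles l M p d = {c \<in> cech_cochains l M p. cech_diff l c = 0} \<inter> cochain_degree l d"

definition local_coboundaries :: "nat \<Rightarrow> 'k::field form1 set \<Rightarrow> int \<Rightarrow> int \<Rightarrow> 'k cochain set" where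
  "local_coboundaries l M p d = cech_diff l ` cech_cochains l M (p - 1) \<inter> cochain_degree l d"

text \<open>\<open>Hilb(H^p(M), t) = f\<close>, where the series is a formal Laurent series in the variable \<open>t^-1\<close>:
  its \<open>n\<close>-th coefficient belongs to the degree \<open>-n\<close>. All graded pieces are required to be
  finite-dimensional.\<close>

definition local_cohomology_has_Hilb ::
  "nat \<Rightarrow> 'k::field form1 set \<Rightarrow> int \<Rightarrow> rat fls \<Rightarrow> bool" where
  "local_cohomology_has_Hilb l M p f \<longleftrightarrow> (\<forall>d.
     finite_dim_quotient cochain_scale (local_cocycles l M p d) (local_coboundaries l M p d) \<and>
     of_nat (dim_quotient cochain_scale (local_cocycles l M p d) (local_coboundaries l M p d))
       = fls_nth f (- d))"

end

theory Submission
  imports Defs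
begin

text \<open>Let \<open>z\<close> act on rational 1-forms by \<open>z dx_i = x_i dx_i\<close>, and put \<open>y_j = x_j - z\<close>. Both preserve
  \<open>\<Omega>^1(\<A>_G)\<close>, which has a \<open>K\<close>-basis of Laurent monomials in \<open>z, y_1, ..., y_l\<close> with \<open>z\<close> in nonnegative
  and the \<open>y_j\<close> in exponents at least \<open>-1\<close>, where those with exponent \<open>-1\<close> form a nonempty clique of \<open>G\<close>
  and \<open>dx_i\<close> corresponds to \<open>1 / y_i\<close>. On this module the product of all
  \<open>z - x_i = - y_i\<close> vanishes, so \<open>z\<close> and the \<open>y_j\<close> are in the radical of the ideal of the \<open>x_i\<close> and vice
  versa, and the Cech complex on \<open>x_1, ..., x_l\<close> may be replaced by the \<open>\<int>^(l+1)\<close>-graded one on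
  \<open>z, y_1, ..., y_l\<close>. A multidegree with a nonnegative entry contributes nothing, and one with all
  entries negative contributes the simplicial chain complex of \<open>\<Delta>(G[W])\<close>, where \<open>W\<close> is the set of \<open>j\<close> at
  which \<open>y_j\<close> has exponent \<open>-1\<close>. Counting the multidegrees with given \<open>W\<close> and given total degree yields
  the rational functions in the formula.\<close>

section \<open>Dimensions of quotients\<close>

text \<open>The operators \<open>z\<close> and \<open>y_j\<close> act differently on the different
  components, and \<open>y_i\<close> kills the component at \<open>dx_i\<close>, so zero divisors
  have to be inverted. This is why the Cech complex is set up for diagonal operators on a product of
  fields: localizing at \<open>h\<close> discards the components where \<open>h\<close> vanishes,
  and pseudo-inverses and idempotents express this by formulas. The monomials come from residues. A
  logarithmic form has at most simple poles along \<open>x_u = x_v\<close>, only in its components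
  \<open>u\<close> and \<open>v\<close>, and the two residues cancel; a product over a clique has
  this symmetry. Conversely, clear the denominators of the last nonzero component, at
  \<open>n\<close> say: the result vanishes where \<open>x_n\<close> coincides with
  \<open>x_j\<close> and \<open>x_k\<close> for nonadjacent neighbours \<open>j\<close>,
  \<open>k\<close> of \<open>n\<close>, and this excludes exactly the monomials that do not belong
  to cliques. Subtracting the others lowers \<open>n\<close>. The \<open>x_i\<close> are not
  homogeneous for the fine grading, so the change of generators keeps only the total degree. There
  \<open>1 / y_i\<close> has degree -1 but \<open>dx_i\<close> has degree 0, whence a shift by one
  throughout.\<close>

definition has_qdim :: "('k::field \<Rightarrow> 'v \<Rightarrow> 'v::ab_group_add) \<Rightarrow> 'v set \<Rightarrow> 'v set \<Rightarrow> nat \<Rightarrow> bool" where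
  "has_qdim s Z B n \<longleftrightarrow> (\<exists>X. finite X \<and> quotient_basis s Z B X \<and> card X = n)"

text \<open>Indexed families instead of sets of representatives: images and expansions can be formed
  without first checking that the representatives stay distinct, which \<open>qindep_inj\<close>
  supplies afterwards.\<close>

definition qindep :: "('k::field \<Rightarrow> 'v \<Rightarrow> 'v::ab_group_add) \<Rightarrow> 'v set \<Rightarrow> 'a set \<Rightarrow> ('a \<Rightarrow> 'v) \<Rightarrow> bool" where
  "qindep s B A f \<longleftrightarrow> (\<forall>c. (\<Sum>a\<in>A. s (c a) (f a)) \<in> B \<longrightarrow> (\<forall>a\<in>A. c a = 0))"

definition qspan :: "('k::field \<Rightarrow> 'v \<Rightarrow> 'v::ab_group_add) \<Rightarrow> 'v set \<Rightarrow> 'v set \<Rightarrow> 'a set \<Rightarrow> ('a \<Rightarrow> 'v) \<Rightarrow> bool" where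
  "qspan s Z B A f \<longleftrightarrow> (\<forall>z\<in>Z. \<exists>c. z - (\<Sum>a\<in>A. s (c a) (f a)) \<in> B)"

lemma qindepD:
  "qindep s B A f \<Longrightarrow> (\<Sum>a\<in>A. s (c a) (f a)) \<in> B \<Longrightarrow> a \<in> A \<Longrightarrow> c a = 0"
  by (auto simp: qindep_def)

lemma qindepI:
  assumes "\<And>c a. (\<Sum>a\<in>A. s (c a) (f a)) \<in> B \<Longrightarrow> a \<in> A \<Longrightarrow> c a = 0"
  shows "qindep s B A f"
  using assms by (auto simp: qindep_def)

lemma qindep_inj:
  assumes "vector_space s" "0 \<in> B" "finite A" "qindep s B A f"
  shows "inj_on f A"
proof (rule inj_onI, rule ccontr)
  interpret vector_space s by fact
  fix x y assume xy: "x \<in> A" "y \<in> A" "f x = f y" "x \<noteq> y"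
  let ?c = "(\<lambda>a. if a = x then 1 else if a = y then -1 else 0) :: _ \<Rightarrow> 'a"
  have "(\<Sum>a\<in>A. s (?c a) (f a)) = (\<Sum>a\<in>{x,y}. s (?c a) (f a))"
    by (rule sum.mono_neutral_right) (use xy assms in auto)
  also have "\<dots> = 0" using xy by simp
  finally have "(\<Sum>a\<in>A. s (?c a) (f a)) \<in> B" using assms(2) by simp
  from qindepD[OF assms(4) this xy(1)] show False by simp
qed

lemma has_qdimI:
  assumes vs: "vector_space s" and B0: "0 \<in> B"
    and fin: "finite A" "card A = n" and fZ: "\<And>a. a \<in> A \<Longrightarrow> f a \<in> Z"
    and ind: "qindep s B A f" and sp: "qspan s Z B A f"
  shows "has_qdim s Z B n"
proof -
  interpret vector_space s by fact
  have inj: "inj_on f A" by (rule qindep_inj[OF vs B0 fin(1) ind])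
  have "quotient_basis s Z B (f ` A)"
    unfolding quotient_basis_def
  proof (intro conjI allI impI ballI)
    show "f ` A \<subseteq> Z" using fZ by auto
  next
    fix Y c x assume Y: "finite Y \<and> Y \<subseteq> f ` A \<and> (\<Sum>x\<in>Y. s (c x) x) \<in> B" and x: "x \<in> Y"
    define d where "d a = (if f a \<in> Y then c (f a) else 0)" for a
    have "(\<Sum>a\<in>A. s (d a) (f a)) = (\<Sum>x\<in>f ` A. s (if x \<in> Y then c x else 0) x)"
      by (subst sum.reindex[OF inj]) (simp add: d_def)
    also have "\<dots> = (\<Sum>x\<in>Y. s (c x) x)"
      using Y fin by (intro sum.mono_neutral_cong_right) auto
    finally have dB: "(\<Sum>a\<in>A. s (d a) (f a)) \<in> B" using Y by simp
    obtain a where a: "a \<in> A" "x = f a" using Y x by auto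
    from qindepD[OF ind dB a(1)] show "c x = 0" using a x by (simp add: d_def)
  next
    fix z assume "z \<in> Z"
    then obtain c where c: "z - (\<Sum>a\<in>A. s (c a) (f a)) \<in> B" using sp unfolding qspan_def by blast
    have "(\<Sum>x\<in>f ` A. s (c (the_inv_into A f x)) x) = (\<Sum>a\<in>A. s (c a) (f a))"
      by (subst sum.reindex[OF inj]) (simp add: the_inv_into_f_f[OF inj])
    then show "\<exists>Y c. finite Y \<and> Y \<subseteq> f ` A \<and> z - (\<Sum>x\<in>Y. s (c x) x) \<in> B"
      using c fin by (metis finite_imageI order_refl)
  qed
  then show ?thesis unfolding has_qdim_def using fin card_image[OF inj] by blast
qed

lemma has_qdimE:
  assumes vs: "vector_space s" and "has_qdim s Z B n"
  obtains X where "finite X" "card X = n" "X \<subseteq> Z" "qindep s B X id" "qspan s Z B X id"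
proof -
  interpret vector_space s by fact
  obtain X where X: "finite X" "quotient_basis s Z B X" "card X = n"
    using assms unfolding has_qdim_def by blast
  have XZ: "X \<subseteq> Z" and Xsp: "\<forall>z\<in>Z. \<exists>Y c. finite Y \<and> Y \<subseteq> X \<and> z - (\<Sum>x\<in>Y. s (c x) x) \<in> B"
    using conjunct1[OF X(2)[unfolded quotient_basis_def]]
      conjunct2[OF conjunct2[OF X(2)[unfolded quotient_basis_def]]] by simp_all
  have "qindep s B X id"
  proof (rule qindepI)
    fix c a assume "(\<Sum>a\<in>X. s (c a) (id a)) \<in> B" and a: "a \<in> X"
    then have "finite X \<and> X \<subseteq> X \<and> (\<Sum>x\<in>X. s (c x) x) \<in> B" using X(1) by simp
    from conjunct1[OF conjunct2[OF X(2)[unfolded quotient_basis_def]], rule_format, OF this a]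
    show "c a = 0" .
  qed
  moreover have "qspan s Z B X id"
    unfolding qspan_def
  proof
    fix z assume "z \<in> Z"
    then obtain Y c where Y: "finite Y" "Y \<subseteq> X" "z - (\<Sum>x\<in>Y. s (c x) x) \<in> B"
      using Xsp by blast
    have "(\<Sum>x\<in>X. s (if x \<in> Y then c x else 0) (id x)) = (\<Sum>x\<in>Y. s (c x) x)"
      using Y X by (intro sum.mono_neutral_cong_right) auto
    with Y show "\<exists>c. z - (\<Sum>a\<in>X. s (c a) (id a)) \<in> B" by metis
  qed
  ultimately show ?thesis using X XZ that by blast
qed

lemma vector_space_fun: "vector_space (\<lambda>(a::'k::field) f (x::'a). a * f x)"
  by unfold_locales (auto simp: fun_eq_iff algebra_simps)

lemma sum_fun_apply: "(\<Sum>a\<in>A. f a) x = (\<Sum>a\<in>A. f a x)"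
  by (induction A rule: infinite_finite_induct) auto

text \<open>Steinitz bound modulo \<open>B\<close>: expanding each \<open>f a\<close> in the
  \<open>f' b\<close> modulo \<open>B\<close> gives coefficient vectors \<open>K a\<close> that
  inherit independence, and these live in a space spanned by at most \<open>card A'\<close> unit
  vectors. The quotient space itself is never formed.\<close>

lemma qindep_card_le:
  fixes s :: "'k::field \<Rightarrow> 'v \<Rightarrow> 'v::ab_group_add"
  assumes vs: "vector_space s" and B: "module.subspace s B"
    and fin: "finite A" "finite A'"
    and ind: "qindep s B A f" and sp: "qspan s Z B A' f'" and fZ: "f ` A \<subseteq> Z"
  shows "card A \<le> card A'"
proof -
  interpret V: vector_space s by fact
  interpret F: vector_space "(\<lambda>(a::'k) f x. a * f x) :: 'k \<Rightarrow> ('b \<Rightarrow> 'k) \<Rightarrow> _" by (rule vector_space_fun)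
  have "\<forall>a\<in>A. \<exists>c. f a - (\<Sum>b\<in>A'. s (c b) (f' b)) \<in> B"
    using sp fZ unfolding qspan_def by blast
  then obtain K0 where K0: "\<And>a. a \<in> A \<Longrightarrow> f a - (\<Sum>b\<in>A'. s (K0 a b) (f' b)) \<in> B" by metis
  \<comment> \<open>Cut off outside \<open>A'\<close>, so that \<open>K a\<close> is a combination
    of the unit vectors indexed by \<open>A'\<close>.\<close>
  define K where "K a b = (if b \<in> A' then K0 a b else 0)" for a b
  have K: "f a - (\<Sum>b\<in>A'. s (K a b) (f' b)) \<in> B" if "a \<in> A" for a
    using K0[OF that] by (simp add: K_def)
  have indK: "\<forall>a\<in>A. c a = 0" if "(\<Sum>a\<in>A. (\<lambda>b. c a * K a b)) = 0" for c
  proof -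
    have 0: "(\<Sum>a\<in>A. c a * K a b) = 0" for b
      using fun_cong[OF that, of b] by (simp add: sum_fun_apply)
    have "(\<Sum>a\<in>A. s (c a) (f a - (\<Sum>b\<in>A'. s (K a b) (f' b)))) \<in> B"
      using K B by (intro V.subspace_sum V.subspace_scale)
    also have "(\<Sum>a\<in>A. s (c a) (f a - (\<Sum>b\<in>A'. s (K a b) (f' b)))) =
        (\<Sum>a\<in>A. s (c a) (f a)) - (\<Sum>a\<in>A. \<Sum>b\<in>A'. s (c a * K a b) (f' b))"
      by (simp add: V.scale_right_diff_distrib sum_subtractf V.scale_sum_right)
    also have "(\<Sum>a\<in>A. \<Sum>b\<in>A'. s (c a * K a b) (f' b)) = (\<Sum>b\<in>A'. s (\<Sum>a\<in>A. c a * K a b) (f' b))"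
      by (subst sum.swap) (simp add: V.scale_sum_left)
    finally have "(\<Sum>a\<in>A. s (c a) (f a)) \<in> B" by (simp add: 0)
    from qindepD[OF ind this] show ?thesis by blast
  qed
  have inj: "inj_on K A"
  proof (rule qindep_inj[OF vector_space_fun _ fin(1)])
    show "(0::'b \<Rightarrow> 'k) \<in> {0}" by simp
    show "qindep (\<lambda>a f x. a * f x) {0} A K" by (rule qindepI) (use indK in auto)
  qed
  have "F.independent (K ` A)"
  proof (rule F.independent_if_scalars_zero)
    show "finite (K ` A)" using fin by simp
    fix u x assume "(\<Sum>x\<in>K ` A. (\<lambda>xa. u x * x xa)) = 0" and x: "x \<in> K ` A"
    then have "(\<Sum>a\<in>A. (\<lambda>b. u (K a) * K a b)) = 0"
      by (subst (asm) sum.reindex[OF inj]) simp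
    from indK[OF this] x show "u x = 0" by auto
  qed
  moreover have "K ` A \<subseteq> F.span ((\<lambda>b. (\<lambda>x. if x = b then 1 else 0)) ` A')"
  proof
    fix h assume "h \<in> K ` A"
    then have h: "h b = 0" if "b \<notin> A'" for b using that by (auto simp: K_def)
    have "h = (\<Sum>b\<in>A'. (\<lambda>x. h b * (if x = b then 1 else 0)))"
      using fin h by (simp add: fun_eq_iff sum_fun_apply if_distrib sum.delta cong: if_cong)
    also have "\<dots> \<in> F.span ((\<lambda>b. (\<lambda>x. if x = b then 1 else 0)) ` A')"
      by (intro F.span_sum F.span_scale[of "\<lambda>x. if x = _ then 1 else 0", simplified] F.span_base) auto
    finally show "h \<in> F.span ((\<lambda>b. (\<lambda>x. if x = b then 1 else 0)) ` A')" .
  qed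
  ultimately have "card (K ` A) \<le> card ((\<lambda>b. (\<lambda>x::'b. if x = b then (1::'k) else 0)) ` A')"
    using F.independent_span_bound[of "(\<lambda>b. (\<lambda>x. if x = b then 1 else 0)) ` A'" "K ` A"] fin by simp
  also have "\<dots> \<le> card A'" by (rule card_image_le[OF fin(2)])
  finally show ?thesis using card_image[OF inj] by simp
qed

lemma has_qdim_unique:
  assumes vs: "vector_space s" and B: "module.subspace s B"
    and "has_qdim s Z B n" "has_qdim s Z B n'"
  shows "n = n'"
proof -
  obtain X where X: "finite X" "card X = n" "X \<subseteq> Z" "qindep s B X id" "qspan s Z B X id"
    by (rule has_qdimE[OF vs assms(3)])
  obtain Y where Y: "finite Y" "card Y = n'" "Y \<subseteq> Z" "qindep s B Y id" "qspan s Z B Y id"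
    by (rule has_qdimE[OF vs assms(4)])
  have "card X \<le> card Y"
    by (rule qindep_card_le[OF vs B, where f = id and f' = id and Z = Z]) (use X Y in auto)
  moreover have "card Y \<le> card X"
    by (rule qindep_card_le[OF vs B, where f = id and f' = id and Z = Z]) (use X Y in auto)
  ultimately show ?thesis using X Y by simp
qed

lemma dim_quotient_eq:
  assumes vs: "vector_space s" and B: "module.subspace s B" and n: "has_qdim s Z B n"
  shows "dim_quotient s Z B = n" "finite_dim_quotient s Z B"
proof -
  have "(THE n. has_qdim s Z B n) = n"
    by (rule the_equality[of "has_qdim s Z B", OF n]) (rule has_qdim_unique[OF vs B _ n])
  then show "dim_quotient s Z B = n" by (simp add: dim_quotient_def has_qdim_def)
  show "finite_dim_quotient s Z B"
    using n by (auto simp: finite_dim_quotient_def has_qdim_def)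
qed

text \<open>A linear relation, total on both sides and matching \<open>B\<close> with
  \<open>B'\<close>, induces an isomorphism of the quotients. A relation can be read in both
  directions, and it covers a restriction map as well as two different images of a common
  parameter.\<close>

lemma has_qdim_rel:
  assumes vs: "vector_space s" "vector_space s'"
    and R: "\<And>z z'. R z z' \<Longrightarrow> z \<in> Z \<and> z' \<in> Z'"
    and tot: "\<And>z. z \<in> Z \<Longrightarrow> \<exists>z'. R z z'" and sur: "\<And>z'. z' \<in> Z' \<Longrightarrow> \<exists>z. R z z'"
    and R0: "R 0 0" and Rdiff: "\<And>z w z' w'. R z z' \<Longrightarrow> R w w' \<Longrightarrow> R (z - w) (z' - w')"
    and Rsc: "\<And>a z z'. R z z' \<Longrightarrow> R (s a z) (s' a z')"
    and RB: "\<And>z z'. R z z' \<Longrightarrow> z \<in> B \<longleftrightarrow> z' \<in> B'"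
    and B0: "0 \<in> B'"
    and n: "has_qdim s Z B n"
  shows "has_qdim s' Z' B' n"
proof -
  interpret V: vector_space s by fact
  interpret V': vector_space s' by fact
  obtain X where X: "finite X" "card X = n" "X \<subseteq> Z" "qindep s B X id" "qspan s Z B X id"
    by (rule has_qdimE[OF vs(1) n])
  have "\<forall>x\<in>X. \<exists>z'. R x z'" using tot X by blast
  then obtain f where f: "\<And>x. x \<in> X \<Longrightarrow> R x (f x)" by metis
  have Radd: "R (z + w) (z' + w')" if "R z z'" "R w w'" for z w z' w'
    using Rdiff[OF that(1) Rdiff[OF R0 that(2)]] by simp
  have RS: "R (\<Sum>x\<in>Y. s (c x) x) (\<Sum>x\<in>Y. s' (c x) (f x))" if "Y \<subseteq> X" for Y c
    using finite_subset[OF that X(1)] that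
    by (induction Y rule: finite_induct) (auto intro!: R0 Radd Rsc f)
  show ?thesis
  proof (rule has_qdimI[OF vs(2) B0 X(1,2)])
    show "f a \<in> Z'" if "a \<in> X" for a using R f that by blast
    show "qindep s' B' X f"
    proof (rule qindepI)
      fix c a assume "(\<Sum>a\<in>X. s' (c a) (f a)) \<in> B'" and a: "a \<in> X"
      then have "(\<Sum>a\<in>X. s (c a) (id a)) \<in> B" using RB[OF RS[of X c]] by simp
      from qindepD[OF X(4) this a] show "c a = 0" .
    qed
    show "qspan s' Z' B' X f"
      unfolding qspan_def
    proof
      fix z' assume "z' \<in> Z'"
      then obtain z where z: "R z z'" using sur by blast
      then obtain c where "z - (\<Sum>x\<in>X. s (c x) x) \<in> B"
        using X(5) R unfolding qspan_def id_apply by blast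
      then have "z' - (\<Sum>a\<in>X. s' (c a) (f a)) \<in> B'"
        using RB[OF Rdiff[OF z RS[of X c]]] by simp
      then show "\<exists>c. z' - (\<Sum>a\<in>X. s' (c a) (f a)) \<in> B'" by blast
    qed
  qed
qed

text \<open>Basis vectors of the summands are placed at their own index and padded with 0. It serves
  to add up the homology of one clique complex per multidegree.\<close>

lemma has_qdim_sum:
  fixes s :: "'k::field \<Rightarrow> 'v \<Rightarrow> 'v::ab_group_add" and Z B :: "'m \<Rightarrow> 'v set"
  assumes vs: "vector_space s" and T: "finite T"
    and B: "\<And>t. t \<in> T \<Longrightarrow> 0 \<in> B t" and Z: "\<And>t. t \<in> T \<Longrightarrow> 0 \<in> Z t"
    and n: "\<And>t. t \<in> T \<Longrightarrow> has_qdim s (Z t) (B t) (n t)"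
  shows "has_qdim (\<lambda>a c t. s a (c t)) {c. \<forall>t. if t \<in> T then c t \<in> Z t else c t = 0}
           {c. \<forall>t. if t \<in> T then c t \<in> B t else c t = 0} (\<Sum>t\<in>T. n t)"
proof -
  interpret V: vector_space s by fact
  have vs': "vector_space (\<lambda>a (c::'m \<Rightarrow> 'v) t. s a (c t))"
    by unfold_locales (auto simp: fun_eq_iff V.scale_right_distrib V.scale_left_distrib)
  have "\<forall>t\<in>T. \<exists>X. finite X \<and> card X = n t \<and> X \<subseteq> Z t \<and> qindep s (B t) X id \<and> qspan s (Z t) (B t) X id"
    by (intro ballI) (rule has_qdimE[OF vs n], assumption, blast)
  then obtain X where X: "\<And>t. t \<in> T \<Longrightarrow> finite (X t) \<and> card (X t) = n t \<and> X t \<subseteq> Z t \<and>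
      qindep s (B t) (X t) id \<and> qspan s (Z t) (B t) (X t) id" by metis
  define f :: "'m \<times> 'v \<Rightarrow> 'm \<Rightarrow> 'v" where "f = (\<lambda>(t, x) u. if u = t then x else 0 :: 'v)"
  have S: "(\<Sum>p\<in>Sigma T X. (\<lambda>t. s (c p) (f p t))) u = (if u \<in> T then \<Sum>x\<in>X u. s (c (u, x)) x else 0)"
    for c u
  proof -
    have "(\<Sum>p\<in>Sigma T X. (\<lambda>t. s (c p) (f p t))) u = (\<Sum>t\<in>T. \<Sum>x\<in>X t. s (c (t, x)) (f (t, x) u))"
      using T X by (subst sum_fun_apply, subst sum.Sigma) auto
    also have "\<dots> = (\<Sum>t\<in>T. if t = u then \<Sum>x\<in>X u. s (c (u, x)) x else 0)"
      by (intro sum.cong refl) (auto simp: f_def intro!: sum.neutral)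
    finally show ?thesis using T by simp
  qed
  show ?thesis
  proof (rule has_qdimI[OF vs'])
    show "0 \<in> {c. \<forall>t. if t \<in> T then c t \<in> B t else c t = 0}" using B by auto
    show "finite (Sigma T X)" using T X by auto
    show "card (Sigma T X) = (\<Sum>t\<in>T. n t)" using T X by (simp add: card_SigmaI)
    show "f p \<in> {c. \<forall>t. if t \<in> T then c t \<in> Z t else c t = 0}" if "p \<in> Sigma T X" for p
      using that X Z by (force simp: f_def)
    show "qindep (\<lambda>a c t. s a (c t)) {c. \<forall>t. if t \<in> T then c t \<in> B t else c t = 0} (Sigma T X) f"
    proof (rule qindepI)
      fix c p assume p: "p \<in> Sigma T X" and S0: "(\<Sum>a\<in>Sigma T X. (\<lambda>t. s (c a) (f a t))) \<in> {c. \<forall>t. if t \<in> T then c t \<in> B t else c t = 0}"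
      note mem = CollectD[OF S0]
      have "(\<Sum>x\<in>X u. s (c (u, x)) x) \<in> B u" if "u \<in> T" for u
        using spec[OF mem, of u] unfolding S if_P[OF that] .
      then have "c (u, x) = 0" if "u \<in> T" "x \<in> X u" for u x
        using qindepD[of s "B u" "X u" id "\<lambda>x. c (u, x)" x] X[OF that(1)] that by auto
      then show "c p = 0" using p by auto
    qed
    show "qspan (\<lambda>a c t. s a (c t)) {c. \<forall>t. if t \<in> T then c t \<in> Z t else c t = 0}
        {c. \<forall>t. if t \<in> T then c t \<in> B t else c t = 0} (Sigma T X) f"
      unfolding qspan_def
    proof
      fix z assume z: "z \<in> {c. \<forall>t. if t \<in> T then c t \<in> Z t else c t = 0}"
      then have "\<forall>t\<in>T. \<exists>c. z t - (\<Sum>x\<in>X t. s (c x) x) \<in> B t"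
        using X unfolding qspan_def id_apply by fastforce
      then obtain c where c: "\<And>t. t \<in> T \<Longrightarrow> z t - (\<Sum>x\<in>X t. s (c t x) x) \<in> B t" by metis
      show "\<exists>c. z - (\<Sum>a\<in>Sigma T X. (\<lambda>t. s (c a) (f a t))) \<in> {c. \<forall>t. if t \<in> T then c t \<in> B t else c t = 0}"
        using c z by (intro exI[of _ "\<lambda>(t, x). c t x"]) (auto simp: S split: if_splits)
    qed
  qed
qed

text \<open>\<open>qindep_card_le\<close> bounds independent sets by \<open>card A\<close>, so a
  largest one exists, and a vector outside its span modulo \<open>B\<close> could be adjoined to it.
  This is for simplicial homology, where only finiteness is known in advance.\<close>

lemma has_qdim_exists:
  assumes vs: "vector_space s" and B: "module.subspace s B" and Z: "module.subspace s Z"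
    and sp: "finite A" "qspan s Z B A g"
  shows "\<exists>n. has_qdim s Z B n"
proof -
  interpret V: vector_space s by fact
  define P where "P X \<longleftrightarrow> finite X \<and> X \<subseteq> Z \<and> qindep s B X id" for X
  have "P {}" by (simp add: P_def qindep_def)
  moreover have "\<forall>X. P X \<longrightarrow> card X \<le> card A"
    by (intro allI impI qindep_card_le[OF vs B _ sp(1) _ sp(2), where f = id]) (auto simp: P_def)
  ultimately obtain X where X: "P X" and max: "\<And>Y. P Y \<Longrightarrow> card Y \<le> card X"
    using ex_has_greatest_nat[of P "{}" card "card A + 1"] by (metis less_Suc_eq_le Suc_eq_plus1)
  have "qspan s Z B X id"
    unfolding qspan_def id_apply
  proof (rule ballI, rule ccontr)
    fix z assume z: "z \<in> Z" and no: "\<nexists>c. z - (\<Sum>x\<in>X. s (c x) x) \<in> B"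
    have zX: "z \<notin> X"
    proof
      assume "z \<in> X"
      have "(\<Sum>x\<in>X. s (if x = z then 1 else 0) x) = (\<Sum>x\<in>X. if x = z then z else 0)"
        by (intro sum.cong) auto
      also have "\<dots> = z" using X \<open>z \<in> X\<close> by (simp add: P_def)
      finally have "z - (\<Sum>x\<in>X. s (if x = z then 1 else 0) x) \<in> B"
        using B V.subspace_0 by simp
      with no show False by (metis (no_types))
    qed
    have "qindep s B (insert z X) id"
    proof (rule qindepI)
      fix c a assume a: "a \<in> insert z X" and "(\<Sum>a\<in>insert z X. s (c a) (id a)) \<in> B"
      then have c: "s (c z) z + (\<Sum>a\<in>X. s (c a) a) \<in> B" using X zX by (simp add: P_def)
      have cz: "c z = 0"
      proof (rule ccontr)
        assume cz: "c z \<noteq> 0"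
        have "s (inverse (c z)) (s (c z) z + (\<Sum>a\<in>X. s (c a) a)) \<in> B"
          using V.subspace_scale[OF B c] .
        also have "s (inverse (c z)) (s (c z) z + (\<Sum>a\<in>X. s (c a) a)) =
            z - (\<Sum>a\<in>X. s (- inverse (c z) * c a) a)"
          using cz by (simp add: V.scale_right_distrib V.scale_sum_right sum_negf)
        finally show False
          using spec[OF no[unfolded not_ex], of "\<lambda>a. - inverse (c z) * c a"] by blast
      qed
      with c have "(\<Sum>a\<in>X. s (c a) (id a)) \<in> B" by simp
      then show "c a = 0" using qindepD[of s B X id c a] X cz a by (auto simp: P_def)
    qed
    then have "P (insert z X)" using X z by (auto simp: P_def)
    from max[OF this] show False using X zX by (simp add: P_def)
  qed
  then have "has_qdim s Z B (card X)"
    using X by (intro has_qdimI[OF vs _ _ _ _ , where f = id]) (auto simp: P_def V.subspace_0[OF B])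
  then show ?thesis by blast
qed

section \<open>Cech complexes in a product of fields\<close>

lemma power_fun_apply: "(f ^ n) x = f x ^ n"
  by (induction n) auto

lemma prod_fun_apply: "(\<Prod>a\<in>A. f a) x = (\<Prod>a\<in>A. f a x)"
  by (induction A rule: infinite_finite_induct) auto

text \<open>As \<open>inverse 0 = 0\<close>, this inverts \<open>h\<close> where it is nonzero and
  is 0 at the other components.\<close>

definition pinv :: "('a \<Rightarrow> 'f::field) \<Rightarrow> 'a \<Rightarrow> 'f" where
  "pinv h = (\<lambda>i. inverse (h i))"

definition idem :: "('a \<Rightarrow> 'f::field) \<Rightarrow> 'a \<Rightarrow> 'f" where
  "idem h = h * pinv h"

lemma idem_apply: "idem h i = (if h i = 0 then 0 else 1)"
  by (simp add: idem_def pinv_def)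

text \<open>The localization \<open>M[1/h]\<close> inside the product of fields. Components at which
  \<open>h\<close> vanishes must die, hence the exponent \<open>Suc n\<close>: the power
  \<open>pinv h ^ 0\<close> would let them survive.\<close>

definition loc :: "('a \<Rightarrow> 'f::field) set \<Rightarrow> ('a \<Rightarrow> 'f) \<Rightarrow> ('a \<Rightarrow> 'f) set" where
  "loc M h = {m * pinv h ^ Suc n | m n. m \<in> M}"

definition cochains ::
  "(nat \<Rightarrow> 'a \<Rightarrow> 'f::field) \<Rightarrow> ('a \<Rightarrow> 'f) set \<Rightarrow> nat set \<Rightarrow> int \<Rightarrow> (nat set \<Rightarrow> 'a \<Rightarrow> 'f) set" where
  "cochains g M J p = {c. \<forall>F.
     if F \<subseteq> J \<and> int (card F) = p then c F \<in> loc M (\<Prod>v\<in>F. g v) else c F = 0}"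

lemma cochainsD: "c \<in> cochains g M J p \<Longrightarrow> F \<subseteq> J \<Longrightarrow> int (card F) = p \<Longrightarrow> c F \<in> loc M (\<Prod>v\<in>F. g v)"
  and cochains_eq_0: "c \<in> cochains g M J p \<Longrightarrow> \<not> (F \<subseteq> J \<and> int (card F) = p) \<Longrightarrow> c F = 0"
  by (auto simp: cochains_def)

lemma cochainsI:
  assumes "\<And>F. F \<subseteq> J \<Longrightarrow> int (card F) = p \<Longrightarrow> c F \<in> loc M (\<Prod>v\<in>F. g v)"
    and "\<And>F. \<not> (F \<subseteq> J \<and> int (card F) = p) \<Longrightarrow> c F = 0"
  shows "c \<in> cochains g M J p"
  using assms by (auto simp: cochains_def)

text \<open>The map from \<open>M[1/f]\<close> to \<open>M[1/(f * g v)]\<close> is not an inclusion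
  when \<open>g v\<close> has zero components: it is multiplication by
  \<open>idem (g v)\<close>.\<close>

definition cdiff ::
  "(nat \<Rightarrow> 'a \<Rightarrow> 'f::field) \<Rightarrow> nat set \<Rightarrow> (nat set \<Rightarrow> 'a \<Rightarrow> 'f) \<Rightarrow> nat set \<Rightarrow> 'a \<Rightarrow> 'f" where
  "cdiff g J c = (\<lambda>F. if F \<subseteq> J
     then \<Sum>v\<in>F. (-1) ^ position v F * (idem (g v) * c (F - {v})) else 0)"

lemma position_minus_self [simp]: "position v (F - {v}) = position v F"
  and position_insert_self [simp]: "position v (insert v F) = position v F"
  unfolding position_def by (rule arg_cong[where f = card], auto)+

lemma position_minus:
  assumes "finite F" "v \<in> F" "v < w"
  shows "position w F = Suc (position w (F - {v}))" "position v (F - {w}) = position v F"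
proof -
  have "{u \<in> F. u < w} = insert v {u \<in> F - {v}. u < w}" using assms by auto
  then show "position w F = Suc (position w (F - {v}))"
    unfolding position_def using assms by simp
  show "position v (F - {w}) = position v F"
    unfolding position_def using assms by (intro arg_cong[where f = card]) auto
qed

lemma sign_swap:
  assumes "finite F" "v \<in> F" "w \<in> F" "v \<noteq> w"
  shows "(-1) ^ position v F * (-1) ^ position w (F - {v}) =
     - ((-1) ^ position w F * (-1) ^ position v (F - {w}) :: 'b::comm_ring_1)"
proof (cases "v < w")
  case True
  show ?thesis
    unfolding position_minus(1)[OF assms(1,2) True] position_minus(2)[OF assms(1,2) True]
    by (simp add: mult.commute)
next
  case False
  then have less: "w < v" using assms(4) by simp
  show ?thesis
    unfolding position_minus(1)[OF assms(1,3) less] position_minus(2)[OF assms(1,3) less]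
    by (simp add: mult.commute)
qed

lemma sign_insert:
  assumes "finite F" "u \<notin> F" "v \<in> F"
  shows "(-1) ^ position v F * (-1) ^ position u (F - {v}) =
     - ((-1) ^ position u F * (-1) ^ position v (insert u F) :: 'b::comm_ring_1)"
proof -
  have *: "(-1) ^ position u F * (-1) ^ position v F =
      - ((-1) ^ position v (insert u F) * (-1) ^ position u (F - {v}) :: 'b)"
    using sign_swap[of "insert u F" u v, where 'b = 'b] assms
    by (auto simp: insert_Diff_if)
  have "(-1) ^ position v F * (-1) ^ position u (F - {v}) =
      (-1) ^ position u F * ((-1) ^ position u F * (-1) ^ position v F) * (-1) ^ position u (F - {v} :: nat set) * (1 :: 'b)"
    by simp
  also have "\<dots> = - ((-1) ^ position u F * (-1) ^ position v (insert u F) *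
      ((-1) ^ position u (F - {v}) * (-1) ^ position u (F - {v})))"
    unfolding * by (simp add: mult.assoc)
  finally show ?thesis by simp
qed

text \<open>Antisymmetry alone says only that twice the sum is zero. Splitting at the order of the
  indices pairs off the terms and so covers characteristic two.\<close>

lemma antisym_sum:
  fixes a :: "nat \<Rightarrow> nat \<Rightarrow> 'b::ab_group_add"
  assumes "finite F" and anti: "\<And>v w. v \<in> F \<Longrightarrow> w \<in> F \<Longrightarrow> v \<noteq> w \<Longrightarrow> a v w = - a w v"
  shows "(\<Sum>v\<in>F. \<Sum>w\<in>F - {v}. a v w) = 0"
proof -
  have "(\<Sum>w\<in>F - {v}. a v w) = (\<Sum>w | w \<in> F \<and> w < v. a v w) + (\<Sum>w | w \<in> F \<and> v < w. a v w)" for v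
    using assms(1) by (subst sum.union_disjoint[symmetric]) (auto intro!: sum.cong)
  then have "(\<Sum>v\<in>F. \<Sum>w\<in>F - {v}. a v w) =
      (\<Sum>v\<in>F. \<Sum>w | w \<in> F \<and> w < v. a v w) + (\<Sum>v\<in>F. \<Sum>w | w \<in> F \<and> v < w. a v w)"
    by (simp add: sum.distrib)
  also have "(\<Sum>v\<in>F. \<Sum>w | w \<in> F \<and> w < v. a v w) = (\<Sum>w\<in>F. \<Sum>v | v \<in> F \<and> w < v. a v w)"
    by (rule sum.swap_restrict[OF assms(1) assms(1)])
  also have "\<dots> = (\<Sum>w\<in>F. \<Sum>v | v \<in> F \<and> w < v. - a w v)"
    by (intro sum.cong refl, rule anti) auto
  finally show ?thesis by (simp add: sum_negf)
qed

lemma cdiff_cdiff: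
  assumes "finite J"
  shows "cdiff g J (cdiff g J c) = 0"
proof
  fix F
  show "cdiff g J (cdiff g J c) F = 0 F"
  proof (cases "F \<subseteq> J")
    case True
    then have fin: "finite F" using assms finite_subset by blast
    define a where "a v w = (-1) ^ position v F * (-1) ^ position w (F - {v}) *
       (idem (g v) * idem (g w) * c (F - {v} - {w}))" for v w
    have "cdiff g J (cdiff g J c) F = (\<Sum>v\<in>F. (-1) ^ position v F * (idem (g v) *
        (\<Sum>w\<in>F - {v}. (-1) ^ position w (F - {v}) * (idem (g w) * c (F - {v} - {w})))))"
      unfolding cdiff_def using True by (auto intro!: sum.cong)
    also have "\<dots> = (\<Sum>v\<in>F. \<Sum>w\<in>F - {v}. a v w)"
      by (simp add: a_def sum_distrib_left mult_ac)
    also have "\<dots> = 0"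
    proof (rule antisym_sum[OF fin])
      fix v w assume vw: "v \<in> F" "w \<in> F" "v \<noteq> w"
      have "F - {v} - {w} = F - {w} - {v}" by auto
      then show "a v w = - a w v"
        unfolding a_def sign_swap[OF fin vw] by (simp add: mult_ac)
    qed
    finally show ?thesis by simp
  qed (simp add: cdiff_def)
qed

lemma cdiff_mult: "cdiff g J (\<lambda>F. r * c F) = (\<lambda>F. r * cdiff g J c F)"
  by (auto simp: cdiff_def sum_distrib_left mult_ac fun_eq_iff sum_fun_apply intro!: sum.cong)

lemma cdiff_sum: "cdiff g J (\<lambda>F. \<Sum>a\<in>A. c a F) = (\<lambda>F. \<Sum>a\<in>A. cdiff g J (c a) F)"
proof
  fix F show "cdiff g J (\<lambda>F. \<Sum>a\<in>A. c a F) F = (\<Sum>a\<in>A. cdiff g J (c a) F)"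
    by (cases "F \<subseteq> J") (simp_all add: cdiff_def sum_distrib_left sum.swap[of _ A])
qed

lemma cdiff_diff: "cdiff g J (c - c') = cdiff g J c - cdiff g J c'"
  by (auto simp: cdiff_def algebra_simps sum_subtractf fun_eq_iff)

lemma cdiff_add: "cdiff g J (c + c') = cdiff g J c + cdiff g J c'"
  by (auto simp: cdiff_def algebra_simps sum.distrib fun_eq_iff)

text \<open>Contraction along the index \<open>u\<close>: it would be a null homotopy of the Cech complex if its values
  did not lie in too large a localization.\<close>

definition contract :: "nat set \<Rightarrow> nat \<Rightarrow> (nat set \<Rightarrow> 'b::comm_ring_1) \<Rightarrow> nat set \<Rightarrow> 'b" where
  "contract J u c = (\<lambda>F. if F \<subseteq> J \<and> u \<notin> F then (-1) ^ position u F * c (insert u F) else 0)"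

text \<open>If \<open>u \<in> F\<close>, only the term \<open>v = u\<close> of the differential
  survives contraction. Otherwise the terms with \<open>v \<in> F\<close> of the two summands cancel
  by \<open>sign_insert\<close>, and again \<open>v = u\<close> remains, with its factor
  \<open>idem (g u)\<close>.\<close>

lemma cdiff_contract:
  assumes J: "finite J" "u \<in> J" and F: "F \<subseteq> J"
  shows "cdiff g J (contract J u c) F + contract J u (cdiff g J c) F = idem (g u) * c F"
proof (cases "u \<in> F")
  case True
  have fin: "finite F" using F J finite_subset by blast
  have "cdiff g J (contract J u c) F =
      (\<Sum>v\<in>F. (-1) ^ position v F * (idem (g v) * contract J u c (F - {v})))"
    using F by (simp add: cdiff_def)
  also have "\<dots> = (\<Sum>v\<in>{u}. (-1) ^ position v F * (idem (g v) * contract J u c (F - {v})))"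
    using True fin by (intro sum.mono_neutral_right) (auto simp: contract_def)
  also have "\<dots> = idem (g u) * c F"
    using True F by (auto simp: contract_def insert_absorb mult.left_commute)
  finally show ?thesis using True by (simp add: contract_def)
next
  case False
  have fin: "finite F" using F J finite_subset by blast
  have 1: "cdiff g J (contract J u c) F =
      (\<Sum>v\<in>F. ((-1) ^ position v F * (-1) ^ position u (F - {v})) * (idem (g v) * c (insert u (F - {v}))))"
    unfolding cdiff_def contract_def using F False by (auto simp: mult_ac intro!: sum.cong)
  have "contract J u (cdiff g J c) F = (-1) ^ position u F *
      (\<Sum>v\<in>insert u F. (-1) ^ position v (insert u F) * (idem (g v) * c (insert u F - {v})))"
    unfolding cdiff_def contract_def using F False J by simp
  also have "\<dots> = idem (g u) * c F +
      (\<Sum>v\<in>F. ((-1) ^ position u F * (-1) ^ position v (insert u F)) * (idem (g v) * c (insert u F - {v})))"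
    using False fin by (simp add: distrib_left sum_distrib_left mult_ac)
  also have "(\<Sum>v\<in>F. ((-1) ^ position u F * (-1) ^ position v (insert u F)) * (idem (g v) * c (insert u F - {v})))
     = - cdiff g J (contract J u c) F"
    unfolding 1 sum_negf[symmetric]
  proof (intro sum.cong refl)
    fix v assume v: "v \<in> F"
    then have "insert u F - {v} = insert u (F - {v})" using False by auto
    then show "((-1) ^ position u F * (-1) ^ position v (insert u F)) * (idem (g v) * c (insert u F - {v})) =
      - (((-1) ^ position v F * (-1) ^ position u (F - {v})) * (idem (g v) * c (insert u (F - {v}))))"
      unfolding sign_insert[OF fin False v] by simp
  qed
  finally show ?thesis by (simp add: fun_eq_iff)
qed

lemma cdiff_contract_cocycle:
  assumes J: "finite J" "u \<in> J" and c: "cdiff g J c = 0" "\<And>F. \<not> F \<subseteq> J \<Longrightarrow> c F = 0"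
  shows "cdiff g J (contract J u c) = (\<lambda>F. idem (g u) * c F)"
proof
  fix F show "cdiff g J (contract J u c) F = idem (g u) * c F"
  proof (cases "F \<subseteq> J")
    case True
    have "contract J u (cdiff g J c) F = 0" by (simp add: contract_def c(1))
    with cdiff_contract[OF J True, of g c] show ?thesis by simp
  next
    case False
    then show ?thesis using c(2)[OF False] by (simp add: cdiff_def)
  qed
qed

section \<open>Modules over diagonal operators, their localizations and their cochains\<close>

locale cech_module =
  fixes g :: "nat \<Rightarrow> 'a \<Rightarrow> 'f::field" and M :: "('a \<Rightarrow> 'f) set"
  assumes zero_mem: "0 \<in> M"
    and diff_mem: "m \<in> M \<Longrightarrow> m' \<in> M \<Longrightarrow> m - m' \<in> M"
    and gen_mem: "m \<in> M \<Longrightarrow> g u * m \<in> M"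
begin

text \<open>The ring over which \<open>M\<close> is regarded as a module. Admitting every operator
  that preserves \<open>M\<close> allows coefficients that involve both the variables and the
  operators \<open>z\<close> and \<open>y_j\<close>.\<close>

definition multipliers :: "('a \<Rightarrow> 'f) set" where
  "multipliers = {r. \<forall>m\<in>M. r * m \<in> M}"

lemma multipliersI: "(\<And>m. m \<in> M \<Longrightarrow> r * m \<in> M) \<Longrightarrow> r \<in> multipliers"
  and multipliersD: "r \<in> multipliers \<Longrightarrow> m \<in> M \<Longrightarrow> r * m \<in> M"
  by (auto simp: multipliers_def)

lemma uminus_mem: "m \<in> M \<Longrightarrow> - m \<in> M"
  using diff_mem[OF zero_mem, of m] by (simp only: diff_0)

lemma add_mem: "m \<in> M \<Longrightarrow> m' \<in> M \<Longrightarrow> m + m' \<in> M"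
  using diff_mem[of m "- m'"] uminus_mem[of m'] by simp

lemma mult_multipliers: "r \<in> multipliers \<Longrightarrow> r' \<in> multipliers \<Longrightarrow> r * r' \<in> multipliers"
  by (auto simp: multipliers_def mult.assoc)

lemma one_multipliers: "1 \<in> multipliers"
  by (auto simp: multipliers_def)

lemma zero_multipliers: "0 \<in> multipliers"
  using zero_mem by (auto simp: multipliers_def)

lemma uminus_multipliers: "r \<in> multipliers \<Longrightarrow> - r \<in> multipliers"
proof (rule multipliersI)
  fix m assume "r \<in> multipliers" "m \<in> M"
  then have "- (r * m) \<in> M" by (intro uminus_mem multipliersD)
  then show "- r * m \<in> M" by (simp only: mult_minus_left)
qed

lemma add_multipliers: "r \<in> multipliers \<Longrightarrow> r' \<in> multipliers \<Longrightarrow> r + r' \<in> multipliers"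
  by (rule multipliersI) (simp only: distrib_right add_mem multipliersD)

lemma gen_multipliers: "g u \<in> multipliers"
  by (simp add: multipliers_def gen_mem)

lemma power_multipliers: "r \<in> multipliers \<Longrightarrow> r ^ n \<in> multipliers"
  by (induction n) (simp_all only: power_0 power_Suc one_multipliers mult_multipliers)

lemma prod_multipliers: "(\<Prod>v\<in>F. g v) \<in> multipliers"
proof (induction F rule: infinite_finite_induct)
  case (insert v F)
  show ?case unfolding prod.insert[OF insert(1,2)] by (rule mult_multipliers[OF gen_multipliers insert(3)])
qed (simp_all only: prod.infinite prod.empty one_multipliers not_False_eq_True)

lemma sign_multipliers: "(-1) ^ n \<in> multipliers"
  by (intro power_multipliers uminus_multipliers one_multipliers)

lemma zero_loc: "0 \<in> loc M h"
  unfolding loc_def using zero_mem by (auto intro!: exI[of _ 0])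

lemma locI: "m \<in> M \<Longrightarrow> x = m * pinv h ^ Suc n \<Longrightarrow> x \<in> loc M h"
  by (auto simp: loc_def)

lemma diff_loc:
  assumes h: "h \<in> multipliers" and x: "x \<in> loc M h" and y: "y \<in> loc M h"
  shows "x - y \<in> loc M h"
proof -
  obtain m n where m: "m \<in> M" "x = m * pinv h ^ Suc n" using x by (auto simp: loc_def)
  obtain m' n' where m': "m' \<in> M" "y = m' * pinv h ^ Suc n'" using y by (auto simp: loc_def)
  have "x - y = (h ^ Suc n' * m - h ^ Suc n * m') * pinv h ^ Suc (n + n' + 1)"
  proof
    fix i show "(x - y) i = ((h ^ Suc n' * m - h ^ Suc n * m') * pinv h ^ Suc (n + n' + 1)) i"
      unfolding m m' by (cases "h i = 0")
        (simp_all add: power_fun_apply pinv_def field_simps power_add)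
  qed
  then show ?thesis
    by (intro locI[OF diff_mem]) (auto intro!: multipliersD m m' power_multipliers h simp del: power_Suc)
qed

lemma mult_loc: "r \<in> multipliers \<Longrightarrow> x \<in> loc M h \<Longrightarrow> r * x \<in> loc M h"
  by (auto simp: loc_def mult.assoc[symmetric] multipliersD simp del: power_Suc)
    (metis multipliersD)

lemma add_loc:
  assumes "h \<in> multipliers" "x \<in> loc M h" "y \<in> loc M h" shows "x + y \<in> loc M h"
  using diff_loc[OF assms(1,2) diff_loc[OF assms(1) zero_loc assms(3)]] by simp

lemma sum_loc:
  assumes "h \<in> multipliers" "\<And>a. a \<in> A \<Longrightarrow> x a \<in> loc M h" shows "(\<Sum>a\<in>A. x a) \<in> loc M h"
  using assms(2)
proof (induction A rule: infinite_finite_induct)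
  case (insert a A)
  show ?case unfolding sum.insert[OF insert(1,2)] by (rule add_loc[OF assms(1)]) (use insert in auto)
qed (simp_all only: sum.infinite sum.empty zero_loc not_False_eq_True)

lemma idem_loc:
  assumes "x \<in> loc M h" "v \<in> F" "h = (\<Prod>u\<in>F - {v}. g u)" "finite F"
  shows "idem (g v) * x \<in> loc M (\<Prod>u\<in>F. g u)"
proof -
  obtain m n where m: "m \<in> M" "x = m * pinv h ^ Suc n" using assms(1) by (auto simp: loc_def)
  have F: "(\<Prod>u\<in>F. g u) = g v * h" using assms by (simp add: prod.remove)
  have "idem (g v) * x = (g v ^ Suc n * m) * pinv (\<Prod>u\<in>F. g u) ^ Suc n"
  proof
    fix i show "(idem (g v) * x) i = ((g v ^ Suc n * m) * pinv (\<Prod>u\<in>F. g u) ^ Suc n) i"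
      unfolding m F by (cases "g v i = 0"; cases "h i = 0")
        (simp_all add: power_fun_apply pinv_def idem_apply field_simps)
  qed
  then show ?thesis by (intro locI) (auto intro!: multipliersD m power_multipliers gen_multipliers simp del: power_Suc)
qed

lemma loc_clear:
  assumes "x \<in> loc M (\<Prod>v\<in>insert u F. g v)" "u \<notin> F" "finite F"
  shows "\<exists>N. \<forall>k\<ge>N. g u ^ k * x \<in> loc M (\<Prod>v\<in>F. g v)"
proof -
  let ?h = "\<Prod>v\<in>F. g v"
  obtain m n where m: "m \<in> M" "x = m * pinv (g u * ?h) ^ Suc n" using assms by (auto simp: loc_def)
  show ?thesis
  \<comment> \<open>The denominator uses up \<open>n + 1\<close> factors \<open>g u\<close>. One
    more has to remain in the numerator, because the product vanishes where \<open>g u\<close> does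
    while \<open>m\<close> need not.\<close>
  proof (intro exI[of _ "n + 2"] allI impI)
    fix k assume k: "k \<ge> n + 2"
    then obtain j where j: "k = Suc j + Suc n" by (metis add_2_eq_Suc' add_Suc_shift le_Suc_ex add.commute add_Suc)
    have "g u ^ k * x = (g u ^ Suc j * m) * pinv ?h ^ Suc n"
    proof
      fix i show "(g u ^ k * x) i = ((g u ^ Suc j * m) * pinv ?h ^ Suc n) i"
        unfolding m j by (cases "g u i = 0"; cases "?h i = 0")
          (simp_all add: power_fun_apply pinv_def field_simps power_add)
    qed
    then show "g u ^ k * x \<in> loc M ?h"
      by (intro locI) (auto intro!: multipliersD m power_multipliers gen_multipliers simp del: power_Suc)
  qed
qed

text \<open>Dividing by \<open>g v\<close> amounts to raising the power of the full denominator and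
  multiplying the numerator by the other factors \<open>?h\<close>; the multipliers need not contain
  an inverse of \<open>g v\<close>.\<close>

lemma loc_divide:
  assumes "x \<in> loc M (\<Prod>u\<in>F. g u)" "v \<in> F" "finite F"
  shows "pinv (g v) ^ k * x \<in> loc M (\<Prod>u\<in>F. g u)"
proof -
  let ?h = "\<Prod>u\<in>F - {v}. g u"
  have F: "(\<Prod>u\<in>F. g u) = g v * ?h" using assms by (simp add: prod.remove)
  obtain m n where m: "m \<in> M" "x = m * pinv (\<Prod>u\<in>F. g u) ^ Suc n" using assms(1) by (auto simp: loc_def)
  have "pinv (g v) ^ k * x = (?h ^ k * m) * pinv (\<Prod>u\<in>F. g u) ^ Suc (n + k)"
  proof
    fix i show "(pinv (g v) ^ k * x) i = ((?h ^ k * m) * pinv (\<Prod>u\<in>F. g u) ^ Suc (n + k)) i"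
      unfolding m F by (cases "g v i = 0"; cases "?h i = 0")
        (simp_all add: power_fun_apply pinv_def field_simps power_add)
  qed
  then show ?thesis
    by (intro locI) (auto intro!: multipliersD m power_multipliers prod_multipliers simp del: power_Suc)
qed

lemma loc_idem:
  assumes "x \<in> loc M (\<Prod>u\<in>F. g u)" "v \<in> F" "finite F"
  shows "idem (g v) * x = x"
proof -
  have F: "(\<Prod>u\<in>F. g u) = g v * (\<Prod>u\<in>F - {v}. g u)" using assms by (simp add: prod.remove)
  obtain m n where m: "m \<in> M" "x = m * pinv (\<Prod>u\<in>F. g u) ^ Suc n" using assms(1) by (auto simp: loc_def)
  show ?thesis
    unfolding m F by (auto simp: fun_eq_iff power_fun_apply pinv_def idem_apply)
qed

lemma zero_cochains: "0 \<in> cochains g M J p"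
  by (auto simp: cochains_def zero_loc)

lemma diff_cochains: "c \<in> cochains g M J p \<Longrightarrow> c' \<in> cochains g M J p \<Longrightarrow> c - c' \<in> cochains g M J p"
  by (auto simp: cochains_def prod_multipliers diff_loc)

lemma add_cochains: "c \<in> cochains g M J p \<Longrightarrow> c' \<in> cochains g M J p \<Longrightarrow> c + c' \<in> cochains g M J p"
  by (auto simp: cochains_def prod_multipliers add_loc)

lemma mult_cochains: "r \<in> multipliers \<Longrightarrow> c \<in> cochains g M J p \<Longrightarrow> (\<lambda>F. r * c F) \<in> cochains g M J p"
  by (auto simp: cochains_def mult_loc)

lemma sum_cochains:
  assumes "\<And>a. a \<in> A \<Longrightarrow> c a \<in> cochains g M J p"
  shows "(\<lambda>F. \<Sum>a\<in>A. c a F) \<in> cochains g M J p"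
  using assms unfolding cochains_def
  by (auto intro!: sum_loc prod_multipliers sum.neutral)

lemma cochains_mono: "c \<in> cochains g M I p \<Longrightarrow> I \<subseteq> J \<Longrightarrow> c \<in> cochains g M J p"
  unfolding cochains_def by (auto split: if_splits simp: zero_loc)

lemma cdiff_cochains:
  assumes J: "finite J" and c: "c \<in> cochains g M J (p - 1)"
  shows "cdiff g J c \<in> cochains g M J p"
  unfolding cochains_def
proof (intro CollectI allI)
  fix F
  show "if F \<subseteq> J \<and> int (card F) = p then cdiff g J c F \<in> loc M (\<Prod>v\<in>F. g v) else cdiff g J c F = 0"
  proof (cases "F \<subseteq> J")
    case True
    then have fin: "finite F" using J finite_subset by blast
    show ?thesis
    proof (cases "int (card F) = p")
      case True
      have "idem (g v) * c (F - {v}) \<in> loc M (\<Prod>v\<in>F. g v)" if "v \<in> F" for v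
      proof (rule idem_loc[OF _ that refl fin])
        have "card F = Suc (card (F - {v}))" by (rule card.remove[OF fin that])
        then have "int (card (F - {v})) = p - 1" using True by simp
        then show "c (F - {v}) \<in> loc M (prod g (F - {v}))"
          using \<open>F \<subseteq> J\<close> by (intro cochainsD[OF c]) auto
      qed
      then show ?thesis
        using True \<open>F \<subseteq> J\<close> by (auto simp: cdiff_def intro!: sum_loc prod_multipliers mult_loc[OF sign_multipliers])
    next
      case False
      have "c (F - {v}) = 0" if "v \<in> F" for v
      proof -
        have "card F = Suc (card (F - {v}))" by (rule card.remove[OF fin that])
        then have "int (card (F - {v})) \<noteq> p - 1" using False by simp
        then show ?thesis using cochains_eq_0[OF c] by blast
      qed
      then show ?thesis using False by (auto simp: cdiff_def)
    qed
  qed (simp add: cdiff_def)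
qed

text \<open>The value of the contraction at \<open>F\<close> still has \<open>u\<close> inverted. A
  high power of \<open>g u\<close> clears this by \<open>loc_clear\<close>, and since
  \<open>J\<close> has finitely many subsets one exponent serves for all of them.\<close>

lemma contract_cochains:
  assumes J: "finite J" "u \<in> J" and c: "c \<in> cochains g M J p"
  shows "\<exists>N. \<forall>k\<ge>N. (\<lambda>F. g u ^ k * contract J u c F) \<in> cochains g M J (p - 1)"
proof -
  have "\<exists>N. \<forall>k\<ge>N. g u ^ k * c (insert u F) \<in> loc M (\<Prod>v\<in>F. g v)" if "F \<subseteq> J" "u \<notin> F" for F
  proof (cases "int (card (insert u F)) = p")
    case True
    show ?thesis
      by (rule loc_clear) (use c that J True finite_subset in \<open>auto simp: cochains_def split: if_splits\<close>)
  next
    case False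
    then have "c (insert u F) = 0" using c by (auto simp: cochains_def split: if_splits)
    then show ?thesis by (auto simp: zero_loc)
  qed
  then obtain N where N: "\<And>F k. F \<subseteq> J \<Longrightarrow> u \<notin> F \<Longrightarrow> k \<ge> N F \<Longrightarrow> g u ^ k * c (insert u F) \<in> loc M (\<Prod>v\<in>F. g v)"
    by metis
  show ?thesis
  proof (intro exI[of _ "\<Sum>F\<in>Pow J. N F"] allI impI)
    fix k assume k: "k \<ge> (\<Sum>F\<in>Pow J. N F)"
    show "(\<lambda>F. g u ^ k * contract J u c F) \<in> cochains g M J (p - 1)"
      unfolding cochains_def
    proof (intro CollectI allI)
      fix F
      show "if F \<subseteq> J \<and> int (card F) = p - 1 then g u ^ k * contract J u c F \<in> loc M (\<Prod>v\<in>F. g v)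
          else g u ^ k * contract J u c F = 0"
      proof (cases "F \<subseteq> J \<and> u \<notin> F")
        case True
        then have fin: "finite F" using J finite_subset by blast
        have "N F \<le> k" using True J k by (meson Pow_iff finite_Pow_iff member_le_sum order_trans zero_le)
        then have mem: "(-1) ^ position u F * (g u ^ k * c (insert u F)) \<in> loc M (\<Prod>v\<in>F. g v)"
          using True by (intro mult_loc sign_multipliers N) auto
        have "c (insert u F) = 0" if "int (card F) \<noteq> p - 1"
          using c that True fin by (auto simp: cochains_def split: if_splits)
        with mem True show ?thesis by (auto simp: contract_def mult.left_commute)
      qed (auto simp: contract_def zero_loc)
    qed
  qed
qed

end

section \<open>Graded Cech cohomology and the removal of generators lying in the radical of the
  others\<close>

definition cscale :: "('k \<Rightarrow> 'f::field) \<Rightarrow> 'k \<Rightarrow> (nat set \<Rightarrow> 'a \<Rightarrow> 'f) \<Rightarrow> nat set \<Rightarrow> 'a \<Rightarrow> 'f" where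
  "cscale K a c = (\<lambda>F. (\<lambda>_. K a) * c F)"

definition cocycles ::
  "(nat \<Rightarrow> 'a \<Rightarrow> 'f::field) \<Rightarrow> ('a \<Rightarrow> 'f) set \<Rightarrow> (int \<Rightarrow> ('a \<Rightarrow> 'f) set) \<Rightarrow> nat set \<Rightarrow> int \<Rightarrow> int \<Rightarrow> (nat set \<Rightarrow> 'a \<Rightarrow> 'f) set" where
  "cocycles g M D J p d = {c \<in> cochains g M J p. cdiff g J c = 0 \<and> (\<forall>F. c F \<in> D d)}"

definition coboundaries ::
  "(nat \<Rightarrow> 'a \<Rightarrow> 'f::field) \<Rightarrow> ('a \<Rightarrow> 'f) set \<Rightarrow> (int \<Rightarrow> ('a \<Rightarrow> 'f) set) \<Rightarrow> nat set \<Rightarrow> int \<Rightarrow> int \<Rightarrow> (nat set \<Rightarrow> 'a \<Rightarrow> 'f) set" where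
  "coboundaries g M D J p d = {c \<in> cdiff g J ` cochains g M J (p - 1). \<forall>F. c F \<in> D d}"

text \<open>Homogeneous elements are described by closure properties alone, without a decomposition
  into degrees. So the constant family \<open>UNIV\<close> is an instance too, and a statement
  proved once holds with and without grading.\<close>

locale graded_cech = cech_module g M
  for g :: "nat \<Rightarrow> 'a \<Rightarrow> 'f::field" and M +
  fixes D :: "int \<Rightarrow> ('a \<Rightarrow> 'f) set"
  assumes D_zero: "0 \<in> D n"
    and D_diff: "x \<in> D n \<Longrightarrow> y \<in> D n \<Longrightarrow> x - y \<in> D n"
    and D_mult: "x \<in> D n \<Longrightarrow> y \<in> D n' \<Longrightarrow> x * y \<in> D (n + n')"
    and D_one: "1 \<in> D 0"
    and D_gen: "g u \<in> D 1"
    and D_pinv: "pinv (g u) \<in> D (-1)"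
begin

lemma D_uminus: "x \<in> D n \<Longrightarrow> - x \<in> D n"
  using D_diff[OF D_zero, of x n] by (simp only: diff_0)

lemma D_add: "x \<in> D n \<Longrightarrow> y \<in> D n \<Longrightarrow> x + y \<in> D n"
  using D_diff[OF _ D_uminus, of x n y] by (simp only: diff_minus_eq_add)

lemma D_sum:
  assumes "\<And>a. a \<in> A \<Longrightarrow> x a \<in> D n" shows "(\<Sum>a\<in>A. x a) \<in> D n"
  using assms
proof (induction A rule: infinite_finite_induct)
  case (insert a A)
  show ?case unfolding sum.insert[OF insert(1,2)] by (rule D_add) (use insert in auto)
qed (simp_all only: sum.infinite sum.empty D_zero not_False_eq_True)

lemma D_power: "x \<in> D n \<Longrightarrow> x ^ k \<in> D (int k * n)"
proof (induction k)
  case 0 show ?case using D_one by (simp only: power_0 of_nat_0 mult_zero_left)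
next
  case (Suc k)
  have "x ^ Suc k \<in> D (n + int k * n)" unfolding power_Suc by (rule D_mult) (use Suc in auto)
  then show ?case by (simp add: algebra_simps del: power_Suc)
qed

lemma D_sign: "(-1) ^ k \<in> D 0"
  using D_power[OF D_uminus[OF D_one], of k] by simp

lemma D_mult_0: "x \<in> D 0 \<Longrightarrow> y \<in> D n \<Longrightarrow> x * y \<in> D n"
  using D_mult[of x 0 y n] by simp

lemma D_idem: "idem (g u) \<in> D 0"
  using D_mult[OF D_gen D_pinv, of u u] by (simp add: idem_def)

lemma D_cdiff: "(\<And>F. c F \<in> D n) \<Longrightarrow> cdiff g J c F \<in> D n"
  unfolding cdiff_def using D_zero by (auto intro!: D_sum D_mult_0 D_sign D_idem)

lemma D_contract: "(\<And>F. c F \<in> D n) \<Longrightarrow> contract J u c F \<in> D n"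
  unfolding contract_def using D_zero by (auto intro!: D_mult_0 D_sign)

text \<open>All \<open>N\<close> are quantified over because \<open>contract_cochains\<close>
  demands a high power of every generator. The coefficients are homogeneous so that the bounding
  cochains built from them keep their degree.\<close>

definition in_radical :: "nat set \<Rightarrow> nat \<Rightarrow> bool" where
  "in_radical I v \<longleftrightarrow> (\<forall>N. \<exists>k a. (\<forall>u\<in>I. a u \<in> multipliers \<and> a u \<in> D (int k - int N)) \<and>
     g v ^ k = (\<Sum>u\<in>I. a u * g u ^ N))"

lemma in_radical_mono:
  assumes "in_radical I v" "I \<subseteq> J" "finite J" shows "in_radical J v"
  unfolding in_radical_def
proof
  fix N
  obtain k a where a: "\<forall>u\<in>I. a u \<in> multipliers \<and> a u \<in> D (int k - int N)" "g v ^ k = (\<Sum>u\<in>I. a u * g u ^ N)"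
    using assms(1) unfolding in_radical_def by meson
  have "(\<Sum>u\<in>J. (if u \<in> I then a u else 0) * g u ^ N) = (\<Sum>u\<in>I. a u * g u ^ N)"
    using assms by (intro sum.mono_neutral_cong_right) auto
  with a show "\<exists>k a. (\<forall>u\<in>J. a u \<in> multipliers \<and> a u \<in> D (int k - int N)) \<and> g v ^ k = (\<Sum>u\<in>J. a u * g u ^ N)"
    by (intro exI[of _ k] exI[of _ "\<lambda>u. if u \<in> I then a u else 0"]) (auto simp: zero_multipliers D_zero)
qed

text \<open>Cochains supported on index sets containing \<open>v\<close> form, up to a shift, the
  Cech complex of \<open>M[1/g v]\<close> on \<open>J - {v}\<close>. There \<open>g v\<close> is
  invertible, so the relation from \<open>in_radical\<close> becomes a partition of unity, and
  weighting the contractions by it gives a genuine null homotopy.\<close>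

lemma acyclic_part:
  assumes J: "finite J" "v \<in> J" and rad: "in_radical (J - {v}) v"
    and c: "c \<in> cochains g M J p" "\<And>F. v \<notin> F \<Longrightarrow> c F = 0" "cdiff g J c = 0" "\<And>F. c F \<in> D d"
  obtains b where "b \<in> cochains g M J (p - 1)" "\<And>F. v \<notin> F \<Longrightarrow> b F = 0" "cdiff g J b = c" "\<And>F. b F \<in> D d"
proof -
  have "\<exists>N. \<forall>u\<in>J. \<forall>k\<ge>N. (\<lambda>F. g u ^ k * contract J u c F) \<in> cochains g M J (p - 1)"
  proof -
    have "\<forall>u\<in>J. \<exists>N. \<forall>k\<ge>N. (\<lambda>F. g u ^ k * contract J u c F) \<in> cochains g M J (p - 1)"
      using contract_cochains[OF J(1) _ c(1)] by blast
    then obtain N where N: "\<And>u k. u \<in> J \<Longrightarrow> k \<ge> N u \<Longrightarrow> (\<lambda>F. g u ^ k * contract J u c F) \<in> cochains g M J (p - 1)"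
      by metis
    show ?thesis
    proof (intro exI[of _ "\<Sum>u\<in>J. N u"] ballI allI impI)
      fix u k assume u: "u \<in> J" and k: "k \<ge> (\<Sum>u\<in>J. N u)"
      have "N u \<le> (\<Sum>u\<in>J. N u)" by (rule member_le_sum[OF u _ J(1)]) simp
      then show "(\<lambda>F. g u ^ k * contract J u c F) \<in> cochains g M J (p - 1)" using N[OF u] k by simp
    qed
  qed
  then obtain N0 where N0: "\<And>u k. u \<in> J \<Longrightarrow> k \<ge> N0 \<Longrightarrow> (\<lambda>F. g u ^ k * contract J u c F) \<in> cochains g M J (p - 1)"
    by blast
  \<comment> \<open>At least 1, so that \<open>g u ^ N\<close> absorbs the factor
    \<open>idem (g u)\<close> produced by the contraction.\<close>
  define N where "N = Suc N0"
  obtain k a where a: "\<And>u. u \<in> J - {v} \<Longrightarrow> a u \<in> multipliers \<and> a u \<in> D (int k - int N)"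
    and ga: "g v ^ k = (\<Sum>u\<in>J - {v}. a u * g u ^ N)"
    using rad unfolding in_radical_def by meson
  \<comment> \<open>By \<open>ga\<close> the coboundary of this weighted sum of contractions is
    \<open>g v ^ k\<close> times \<open>c\<close>; \<open>b\<close> then divides by that power,
    which is possible on sets containing \<open>v\<close>.\<close>
  define b0 where "b0 F = (\<Sum>u\<in>J - {v}. a u * (g u ^ N * contract J u c F))" for F
  define b where "b F = pinv (g v) ^ k * b0 F" for F
  have cJ: "c F = 0" if "\<not> F \<subseteq> J" for F using cochains_eq_0[OF c(1)] that by blast
  have b0: "b0 \<in> cochains g M J (p - 1)"
    unfolding b0_def by (intro sum_cochains mult_cochains N0) (use a in \<open>auto simp: N_def\<close>)
  have b0v: "b0 F = 0" if "v \<notin> F" for F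
    unfolding b0_def using that c(2) by (intro sum.neutral) (auto simp: contract_def)
  show ?thesis
  proof
    show bv: "b F = 0" if "v \<notin> F" for F using b0v[OF that] by (simp add: b_def)
    show "b \<in> cochains g M J (p - 1)"
    proof (rule cochainsI)
      fix F assume F: "F \<subseteq> J" "int (card F) = p - 1"
      have fin: "finite F" using J F finite_subset by blast
      show "b F \<in> loc M (prod g F)"
      proof (cases "v \<in> F")
        case True
        then show ?thesis unfolding b_def by (intro loc_divide cochainsD[OF b0 F] fin)
      qed (simp add: bv zero_loc)
    next
      fix F assume "\<not> (F \<subseteq> J \<and> int (card F) = p - 1)"
      then show "b F = 0" unfolding b_def using cochains_eq_0[OF b0, of F] by simp
    qed
    have "cdiff g J b0 F = g v ^ k * c F" for F
    proof -
      have "cdiff g J b0 = (\<lambda>F. \<Sum>u\<in>J - {v}. (a u * g u ^ N) * cdiff g J (contract J u c) F)"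
        unfolding b0_def cdiff_sum by (simp only: cdiff_mult mult.assoc)
      also have "\<dots> = (\<lambda>F. \<Sum>u\<in>J - {v}. (a u * g u ^ N) * c F)"
      proof (rule ext, rule sum.cong[OF refl])
        fix F u assume "u \<in> J - {v}"
        then have 1: "cdiff g J (contract J u c) F = idem (g u) * c F"
          using cdiff_contract_cocycle[OF J(1) _ c(3) cJ] by (metis DiffD1)
        have "g u ^ N * idem (g u) = g u ^ N"
          by (auto simp: fun_eq_iff power_fun_apply idem_apply N_def)
        then show "(a u * g u ^ N) * cdiff g J (contract J u c) F = (a u * g u ^ N) * c F"
          unfolding 1 by (metis mult.assoc)
      qed
      finally show ?thesis unfolding ga by (simp only: sum_distrib_right)
    qed
    note db0 = this
    show "cdiff g J b = c"
    proof
      fix F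
      have 1: "cdiff g J b F = pinv (g v) ^ k * (g v ^ k * c F)"
        unfolding b_def cdiff_mult db0 ..
      show "cdiff g J b F = c F"
      proof (cases "v \<in> F \<and> F \<subseteq> J \<and> int (card F) = p")
        case True
        \<comment> \<open>\<open>c F\<close> is supported where \<open>g v\<close> is nonzero, so
          the pseudo-inverse really undoes the multiplication by \<open>g v ^ k\<close>.\<close>
        then have "idem (g v) * c F = c F"
          using J finite_subset by (intro loc_idem[OF cochainsD[OF c(1)]]) auto
        then have *: "idem (g v) i * c F i = c F i" for i by (metis times_fun_apply)
        show ?thesis unfolding 1
        proof
          fix i show "(pinv (g v) ^ k * (g v ^ k * c F)) i = c F i"
            using *[of i] by (cases "g v i = 0") (auto simp: power_fun_apply idem_apply pinv_def field_simps)
        qed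
      next
        case False
        then have "c F = 0" using c(2) cochains_eq_0[OF c(1)] by blast
        then show ?thesis unfolding 1 by simp
      qed
    qed
    show "b F \<in> D d" for F
    proof -
      have "g u ^ N * contract J u c F \<in> D (int N + d)" for u
        using D_mult[OF D_power[OF D_gen, of u N], of "contract J u c F" d] D_contract c(4) by simp
      from D_mult[OF _ this]
      have "a u * (g u ^ N * contract J u c F) \<in> D (int k - int N + (int N + d))" if "u \<in> J - {v}" for u
        using a that by blast
      then have "b0 F \<in> D (int k + d)" unfolding b0_def by (intro D_sum) simp
      from D_mult[OF D_power[OF D_pinv] this, of v k] show ?thesis by (simp add: b_def)
    qed
  qed
qed

end

locale scaled_cech = graded_cech g M D for g :: "nat \<Rightarrow> 'a \<Rightarrow> 'f::field" and M D +
  fixes K :: "'k::field \<Rightarrow> 'f"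
  assumes K_hom: "K (a + b) = K a + K b" "K (a * b) = K a * K b" "K 1 = 1"
    and K_D: "(\<lambda>_. K a) \<in> D 0"
    and K_mem: "m \<in> M \<Longrightarrow> (\<lambda>_. K a) * m \<in> M"
begin

sublocale triv: graded_cech g M "\<lambda>_. UNIV"
  by unfold_locales auto

lemma vector_space_cscale: "vector_space (cscale K)"
  by unfold_locales (auto simp: cscale_def fun_eq_iff K_hom algebra_simps)

lemma triv_in_radical: "in_radical I v \<Longrightarrow> triv.in_radical I v"
  unfolding in_radical_def triv.in_radical_def by blast

lemma K_multipliers: "(\<lambda>_. K a) \<in> multipliers"
  using K_mem by (rule multipliersI)

lemma subspace_coboundaries:
  "module.subspace (cscale K) (coboundaries g M D J p d)"
proof -
  interpret vector_space "cscale K" by (rule vector_space_cscale)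
  show ?thesis
  proof (rule subspaceI)
    have "0 = cdiff g J 0" by (simp add: cdiff_def fun_eq_iff sum_fun_apply)
    then show "0 \<in> coboundaries g M D J p d"
      unfolding coboundaries_def using zero_cochains D_zero by (auto intro!: image_eqI)
  next
    fix x y assume "x \<in> coboundaries g M D J p d" "y \<in> coboundaries g M D J p d"
    then obtain b b' where b: "x = cdiff g J b" "y = cdiff g J b'" "b \<in> cochains g M J (p - 1)" "b' \<in> cochains g M J (p - 1)"
      "\<And>F. x F \<in> D d" "\<And>F. y F \<in> D d" unfolding coboundaries_def by auto
    have "b + b' \<in> cochains g M J (p - 1)"
      using b(3,4) by (rule add_cochains)
    moreover have "x + y = cdiff g J (b + b')" unfolding b(1,2) by (rule cdiff_add[symmetric])
    moreover have "(x + y) F \<in> D d" for F using b(5,6)[of F] D_add by (simp add: plus_fun_apply)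
    ultimately show "x + y \<in> coboundaries g M D J p d" unfolding coboundaries_def by blast
  next
    fix a x assume "x \<in> coboundaries g M D J p d"
    then obtain b where b: "x = cdiff g J b" "b \<in> cochains g M J (p - 1)" "\<And>F. x F \<in> D d"
      unfolding coboundaries_def by auto
    have "cscale K a x = cdiff g J (cscale K a b)" unfolding cscale_def b cdiff_mult ..
    moreover have "cscale K a b \<in> cochains g M J (p - 1)"
      unfolding cscale_def by (rule mult_cochains[OF K_multipliers b(2)])
    moreover have "cscale K a x F \<in> D d" for F unfolding cscale_def by (rule D_mult_0[OF K_D b(3)])
    ultimately show "cscale K a x \<in> coboundaries g M D J p d" unfolding coboundaries_def by blast
  qed
qed

text \<open>Restricting cochains to the index sets avoiding \<open>v\<close> is a quasi-isomorphism. Coboundaries bound cochains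
  of any degree, so acyclicity is needed for the given grading and for the trivial one.\<close>

lemma cocycles_cong_dim:
  assumes J: "finite J" "v \<in> J" and rad: "in_radical (J - {v}) v"
  shows "has_qdim (cscale K) (cocycles g M D J p d) (coboundaries g M D J p d) n \<longleftrightarrow>
    has_qdim (cscale K) (cocycles g M D (J - {v}) p d) (coboundaries g M D (J - {v}) p d) n"
proof -
  define I where "I = J - {v}"
  define rest :: "(nat set \<Rightarrow> 'a \<Rightarrow> 'f) \<Rightarrow> nat set \<Rightarrow> 'a \<Rightarrow> 'f" where "rest c F = (if v \<in> F then 0 else c F)" for c F
  define R where "R c c' \<longleftrightarrow> c \<in> cocycles g M D J p d \<and> c' = rest c" for c c'
  have I: "finite I" "I \<subseteq> J" "\<And>F. F \<subseteq> I \<longleftrightarrow> F \<subseteq> J \<and> v \<notin> F" using J by (auto simp: I_def)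
  have rest_c: "rest c \<in> cochains g M I q" if "c \<in> cochains g M J q" for c q
  proof (rule cochainsI)
    fix F assume "F \<subseteq> I" "int (card F) = q"
    then show "rest c F \<in> loc M (prod g F)" by (simp add: rest_def I(3) cochainsD[OF that])
  next
    fix F assume "\<not> (F \<subseteq> I \<and> int (card F) = q)"
    then show "rest c F = 0" using cochains_eq_0[OF that, of F] by (auto simp: rest_def I(3))
  qed
  have rest_d: "cdiff g I (rest c) = rest (cdiff g J c)" for c
    by (auto simp: fun_eq_iff cdiff_def rest_def I(3) intro!: sum.cong)
  have rest_id: "rest c = c" if "c \<in> cochains g M I q" for c q
    using cochains_eq_0[OF that] by (auto simp: fun_eq_iff rest_def I(3))
  have rest_diff: "rest (c - c') = rest c - rest c'" for c c'
    by (auto simp: fun_eq_iff rest_def)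
  have D_rest: "rest c F \<in> D d" if "\<And>F. c F \<in> D d" for c F using that D_zero by (auto simp: rest_def)
  have rest0: "c F = 0" if "rest c = 0" "v \<notin> F" for c F
    using fun_cong[OF that(1), of F] that(2) by (simp add: rest_def)
  have 1: "c' \<in> cocycles g M D I p d" if "R c c'" for c c'
    using that rest_c D_rest unfolding R_def cocycles_def by (auto simp: rest_d) (auto simp: rest_def fun_eq_iff)
  have 2: "\<exists>c. R c c'" if "c' \<in> cocycles g M D I p d" for c'
  proof -
    have c': "c' \<in> cochains g M I p" "cdiff g I c' = 0" "\<And>F. c' F \<in> D d" using that by (auto simp: cocycles_def)
    have c'J: "c' \<in> cochains g M J p" using c' I cochains_mono by blast
    have "rest (cdiff g J c') = 0" using rest_d[of c'] rest_id[OF c'(1)] c'(2) by simp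
    then have s0: "\<And>F. v \<notin> F \<Longrightarrow> cdiff g J c' F = 0" using rest0 by blast
    have dc: "cdiff g J c' \<in> cochains g M J (p + 1)" using cdiff_cochains[OF J(1), of c' "p + 1"] c'J by simp
    \<comment> \<open>Extending \<open>c'\<close> by zero leaves a coboundary that lives only on
      sets containing \<open>v\<close>. The acyclic part bounds it there, and the correction
      \<open>b\<close> does not change the restriction.\<close>
    obtain b where b: "b \<in> cochains g M J p" "\<And>F. v \<notin> F \<Longrightarrow> b F = 0" "cdiff g J b = cdiff g J c'" "\<And>F. b F \<in> D d"
      using acyclic_part[OF J rad dc s0 cdiff_cdiff[OF J(1)] D_cdiff[OF c'(3)]] by auto
    have "c' - b \<in> cocycles g M D J p d"
      unfolding cocycles_def using diff_cochains[OF c'J b(1)] b(3,4) c'(3) D_diff by (auto simp: cdiff_diff)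
    moreover have "rest (c' - b) = c'" unfolding rest_diff rest_id[OF c'(1)] using b(2) by (auto simp: fun_eq_iff rest_def)
    ultimately show ?thesis unfolding R_def by metis
  qed
  have 3: "c \<in> coboundaries g M D J p d \<longleftrightarrow> c' \<in> coboundaries g M D I p d" if "R c c'" for c c'
  proof
    assume "c \<in> coboundaries g M D J p d"
    then obtain b where b: "b \<in> cochains g M J (p - 1)" "c = cdiff g J b" unfolding coboundaries_def by auto
    have c': "c' = cdiff g I (rest b)" using that b rest_d unfolding R_def by simp
    moreover have "c' F \<in> D d" for F using 1[OF that] by (auto simp: cocycles_def)
    ultimately show "c' \<in> coboundaries g M D I p d" unfolding coboundaries_def using rest_c[OF b(1)] by blast
  next
    assume "c' \<in> coboundaries g M D I p d"
    then obtain b where b: "b \<in> cochains g M I (p - 1)" "c' = cdiff g I b" unfolding coboundaries_def by auto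
    have bJ: "b \<in> cochains g M J (p - 1)" using b I cochains_mono by blast
    have c: "c \<in> cochains g M J p" "cdiff g J c = 0" "\<And>F. c F \<in> D d" "c' = rest c" using that by (auto simp: R_def cocycles_def)
    let ?e = "c - cdiff g J b"
    have e: "?e \<in> cochains g M J p" by (intro diff_cochains c cdiff_cochains J bJ)
    have de: "cdiff g J ?e = 0" by (simp add: cdiff_diff c cdiff_cdiff[OF J(1)])
    have "rest ?e = 0" unfolding rest_diff using rest_d[of b] rest_id[OF b(1)] b(2) c(4) by simp
    then have e0: "\<And>F. v \<notin> F \<Longrightarrow> ?e F = 0" using rest0 by blast
    obtain b' where b': "b' \<in> cochains g M J (p - 1)" "cdiff g J b' = ?e"
      using triv.acyclic_part[OF J triv_in_radical[OF rad] e e0 de] by auto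
    have "c = cdiff g J (b' + b)" by (simp add: cdiff_add b'(2))
    moreover have "b' + b \<in> cochains g M J (p - 1)" by (rule add_cochains[OF b'(1) bJ])
    ultimately show "c \<in> coboundaries g M D J p d" using c(3) unfolding coboundaries_def by blast
  qed
  have cocyc_diff: "c - c' \<in> cocycles g M D J p d" if "c \<in> cocycles g M D J p d" "c' \<in> cocycles g M D J p d" for c c'
    using that diff_cochains D_diff by (auto simp: cocycles_def cdiff_diff)
  have cocyc_scale: "cscale K a c \<in> cocycles g M D J p d" if "c \<in> cocycles g M D J p d" for a c
    using that mult_cochains[OF K_multipliers] D_mult_0[OF K_D]
    unfolding cocycles_def cscale_def by (auto simp: cdiff_mult fun_eq_iff)
  have R0: "R 0 0"
    by (auto simp: R_def cocycles_def zero_cochains D_zero cdiff_def rest_def fun_eq_iff sum_fun_apply)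
  have Rdiff: "R (z - w) (z' - w')" if "R z z'" "R w w'" for z z' w w'
    using that cocyc_diff rest_diff by (auto simp: R_def)
  have Rscale: "R (cscale K a z) (cscale K a z')" if "R z z'" for a z z'
    using that cocyc_scale by (auto simp: R_def rest_def cscale_def fun_eq_iff)
  have B0: "0 \<in> coboundaries g M D J' p d" for J'
  proof -
    interpret vector_space "cscale K" by (rule vector_space_cscale)
    show ?thesis by (rule subspace_0[OF subspace_coboundaries])
  qed
  have 4: "c \<in> cocycles g M D J p d \<and> c' \<in> cocycles g M D I p d" if "R c c'" for c c'
    using 1[OF that] that by (simp add: R_def)
  have 5: "\<exists>c'. R c c'" if "c \<in> cocycles g M D J p d" for c
    using that by (simp add: R_def)
  note vs = vector_space_cscale
  show ?thesis
    unfolding I_def[symmetric]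
  proof
    assume n: "has_qdim (cscale K) (cocycles g M D J p d) (coboundaries g M D J p d) n"
    show "has_qdim (cscale K) (cocycles g M D I p d) (coboundaries g M D I p d) n"
    proof (rule has_qdim_rel[where R = R, OF vs vs _ _ _ R0 Rdiff Rscale _ B0 n])
    qed (use 2 4 5 3 in blast)+
  next
    assume n: "has_qdim (cscale K) (cocycles g M D I p d) (coboundaries g M D I p d) n"
    show "has_qdim (cscale K) (cocycles g M D J p d) (coboundaries g M D J p d) n"
    proof (rule has_qdim_rel[where R = "\<lambda>x y. R y x", OF vs vs _ _ _ R0 Rdiff Rscale _ B0 n])
    qed (use 2 4 5 3 in blast)+
  qed
qed

lemma cocycles_cong_dims:
  assumes J: "finite J" "I \<subseteq> J" and rad: "\<And>v. v \<in> J - I \<Longrightarrow> in_radical I v"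
  shows "has_qdim (cscale K) (cocycles g M D J p d) (coboundaries g M D J p d) n \<longleftrightarrow>
    has_qdim (cscale K) (cocycles g M D I p d) (coboundaries g M D I p d) n"
proof -
  have "has_qdim (cscale K) (cocycles g M D (I \<union> T) p d) (coboundaries g M D (I \<union> T) p d) n \<longleftrightarrow>
    has_qdim (cscale K) (cocycles g M D I p d) (coboundaries g M D I p d) n"
    if "finite T" "T \<subseteq> J - I" for T
    using that
  proof (induction T rule: finite_induct)
    case (insert v T)
    have fin: "finite (I \<union> insert v T)" using J insert finite_subset by blast
    have eq: "I \<union> insert v T - {v} = I \<union> T" using insert by auto
    have "in_radical (I \<union> insert v T - {v}) v"
      by (rule in_radical_mono[OF rad]) (use insert fin in auto)
    from cocycles_cong_dim[OF fin _ this, of p d n] show ?case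
      using insert unfolding eq by auto
  qed simp
  from this[of "J - I"] J show ?thesis by (simp add: Un_absorb1)
qed

end

section \<open>Polynomials inside the field of rational functions\<close>

lemma const_hom [simp]:
  "const (a + b) = const a + const b" "const (a * b) = const a * const b"
  "const 0 = 0" "const 1 = 1" "const (a - b) = const a - const b" "const (- a) = - const a"
  by (simp_all add: const_def single_add mult_single single_diff single_uminus
      flip: to_fract_add to_fract_mult to_fract_diff to_fract_uminus)
    (simp add: single_one[symmetric] del: single_one)?

lemma const_eq_0_iff [simp]: "const c = 0 \<longleftrightarrow> c = 0"
  by (simp add: const_def) (metis lookup_single_eq lookup_zero single_zero)

definition monom_eval :: "(nat \<Rightarrow> 'b::comm_monoid_mult) \<Rightarrow> (nat \<Rightarrow>\<^sub>0 nat) \<Rightarrow> 'b" where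
  "monom_eval \<theta> m = (\<Prod>j\<in>Poly_Mapping.keys m. \<theta> j ^ Poly_Mapping.lookup m j)"

definition eval_mpoly :: "(nat \<Rightarrow> 'k::field ratfun) \<Rightarrow> 'k mpoly \<Rightarrow> 'k ratfun" where
  "eval_mpoly \<theta> p = (\<Sum>m\<in>Poly_Mapping.keys p. const (Poly_Mapping.lookup p m) * monom_eval \<theta> m)"

lemma monom_eval_superset:
  "finite A \<Longrightarrow> Poly_Mapping.keys m \<subseteq> A \<Longrightarrow> monom_eval \<theta> m = (\<Prod>j\<in>A. \<theta> j ^ Poly_Mapping.lookup m j)"
  unfolding monom_eval_def by (rule prod.mono_neutral_left) (auto simp: in_keys_iff)

lemma monom_eval_add: "monom_eval \<theta> (m + n) = monom_eval \<theta> m * monom_eval \<theta> n"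
proof -
  let ?A = "Poly_Mapping.keys m \<union> Poly_Mapping.keys n"
  have "monom_eval \<theta> (m + n) = (\<Prod>j\<in>?A. \<theta> j ^ Poly_Mapping.lookup (m + n) j)"
    by (rule monom_eval_superset) (use keys_add[of m n] in auto)
  also have "\<dots> = (\<Prod>j\<in>?A. \<theta> j ^ Poly_Mapping.lookup m j) * (\<Prod>j\<in>?A. \<theta> j ^ Poly_Mapping.lookup n j)"
    by (simp add: lookup_add power_add prod.distrib)
  also have "\<dots> = monom_eval \<theta> m * monom_eval \<theta> n"
    by (subst (1 2) monom_eval_superset[of ?A]) auto
  finally show ?thesis .
qed

lemma monom_eval_0 [simp]: "monom_eval \<theta> 0 = 1"
  and monom_eval_single [simp]: "monom_eval \<theta> (Poly_Mapping.single j k) = \<theta> j ^ k"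
  by (auto simp: monom_eval_def)

lemma eval_mpoly_superset:
  "finite A \<Longrightarrow> Poly_Mapping.keys p \<subseteq> A \<Longrightarrow>
    eval_mpoly \<theta> p = (\<Sum>m\<in>A. const (Poly_Mapping.lookup p m) * monom_eval \<theta> m)"
  unfolding eval_mpoly_def by (rule sum.mono_neutral_left) (auto simp: in_keys_iff)

lemma eval_mpoly_0 [simp]: "eval_mpoly \<theta> 0 = 0"
  by (simp add: eval_mpoly_def)

lemma eval_mpoly_add: "eval_mpoly \<theta> (p + q) = eval_mpoly \<theta> p + eval_mpoly \<theta> q"
proof -
  let ?A = "Poly_Mapping.keys p \<union> Poly_Mapping.keys q"
  have "eval_mpoly \<theta> (p + q) = (\<Sum>m\<in>?A. const (Poly_Mapping.lookup (p + q) m) * monom_eval \<theta> m)"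
    by (rule eval_mpoly_superset) (use keys_add[of p q] in auto)
  also have "\<dots> = (\<Sum>m\<in>?A. const (Poly_Mapping.lookup p m) * monom_eval \<theta> m) +
      (\<Sum>m\<in>?A. const (Poly_Mapping.lookup q m) * monom_eval \<theta> m)"
    by (simp add: lookup_add distrib_right sum.distrib)
  also have "\<dots> = eval_mpoly \<theta> p + eval_mpoly \<theta> q"
    by (subst (1 2) eval_mpoly_superset[of ?A]) auto
  finally show ?thesis .
qed

lemma eval_mpoly_sum: "eval_mpoly \<theta> (\<Sum>a\<in>A. p a) = (\<Sum>a\<in>A. eval_mpoly \<theta> (p a))"
  by (induction A rule: infinite_finite_induct) (auto simp: eval_mpoly_add)

lemma eval_mpoly_single [simp]: "eval_mpoly \<theta> (Poly_Mapping.single m c) = const c * monom_eval \<theta> m"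
  by (auto simp: eval_mpoly_def)

lemma mpoly_expansion: "p = (\<Sum>m\<in>Poly_Mapping.keys p. Poly_Mapping.single m (Poly_Mapping.lookup p m))"
proof (rule poly_mapping_eqI)
  fix k
  show "Poly_Mapping.lookup p k =
      Poly_Mapping.lookup (\<Sum>m\<in>Poly_Mapping.keys p. Poly_Mapping.single m (Poly_Mapping.lookup p m)) k"
    by (auto simp: lookup_sum lookup_single when_def in_keys_iff)
qed

lemma eval_mpoly_mult: "eval_mpoly \<theta> (p * q) = eval_mpoly \<theta> p * eval_mpoly \<theta> q"
proof -
  have "p * q = (\<Sum>m\<in>Poly_Mapping.keys p. Poly_Mapping.single m (Poly_Mapping.lookup p m)) *
      (\<Sum>n\<in>Poly_Mapping.keys q. Poly_Mapping.single n (Poly_Mapping.lookup q n))"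
    by (simp flip: mpoly_expansion)
  also have "eval_mpoly \<theta> \<dots> = (\<Sum>m\<in>Poly_Mapping.keys p. \<Sum>n\<in>Poly_Mapping.keys q.
      (const (Poly_Mapping.lookup p m) * monom_eval \<theta> m) * (const (Poly_Mapping.lookup q n) * monom_eval \<theta> n))"
    by (simp add: sum_product mult_single eval_mpoly_sum monom_eval_add mult_ac)
  also have "\<dots> = eval_mpoly \<theta> p * eval_mpoly \<theta> q"
    by (simp add: eval_mpoly_def sum_product)
  finally show ?thesis .
qed

lemma to_fract_single: "to_fract (Poly_Mapping.single m c) = const c * monom_eval var m"
proof -
  have pow: "to_fract (Poly_Mapping.single (Poly_Mapping.single j k) 1) = (var j :: 'a ratfun) ^ k" for j k
  proof (induction k)
    case (Suc k)
    have "Poly_Mapping.single (Poly_Mapping.single j (Suc k)) (1::'a) =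
        Poly_Mapping.single (Poly_Mapping.single j 1) 1 * Poly_Mapping.single (Poly_Mapping.single j k) 1"
      by (simp add: mult_single flip: single_add)
    then show ?case by (simp only: to_fract_mult Suc power_Suc) (simp add: var_def)
  qed simp
  have 1: "to_fract (Poly_Mapping.single (\<Sum>j\<in>A. Poly_Mapping.single j (e j)) 1) = (\<Prod>j\<in>A. (var j :: 'a ratfun) ^ e j)"
    if "finite A" for A e using that
  proof (induction A rule: finite_induct)
    case (insert j A)
    have "Poly_Mapping.single (\<Sum>j\<in>insert j A. Poly_Mapping.single j (e j)) (1::'a) =
        Poly_Mapping.single (Poly_Mapping.single j (e j)) 1 * Poly_Mapping.single (\<Sum>j\<in>A. Poly_Mapping.single j (e j)) 1"
      using insert by (simp add: mult_single)
    then show ?case using insert by (simp only: to_fract_mult pow) simp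
  qed simp
  have 2: "to_fract (Poly_Mapping.single m 1) = (monom_eval var m :: 'a ratfun)"
    using 1[of "Poly_Mapping.keys m" "Poly_Mapping.lookup m"] by (simp add: monom_eval_def flip: mpoly_expansion)
  have "to_fract (Poly_Mapping.single m c) = to_fract (Poly_Mapping.single 0 c * Poly_Mapping.single m 1)"
    by (simp add: mult_single)
  then show ?thesis by (simp only: to_fract_mult 2 const_def)
qed

lemma to_fract_eval: "to_fract p = eval_mpoly var p"
proof -
  have "to_fract p = to_fract (\<Sum>m\<in>Poly_Mapping.keys p. Poly_Mapping.single m (Poly_Mapping.lookup p m))"
    by (simp flip: mpoly_expansion)
  then show ?thesis by (simp add: to_fract_single eval_mpoly_def)
qed

section \<open>Substitution into polynomials, and the polynomial ring as a subring\<close>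

definition polys :: "'k::field ratfun set" where
  "polys = range to_fract"

text \<open>A junk value outside \<open>polys\<close>, the range of \<open>to_fract\<close>.\<close>

definition subst :: "(nat \<Rightarrow> 'k::field ratfun) \<Rightarrow> 'k ratfun \<Rightarrow> 'k ratfun" where
  "subst \<theta> f = eval_mpoly \<theta> (inv to_fract f)"

lemma inj_to_fract: "inj to_fract"
  by (auto intro: injI)

lemma subst_to_fract: "subst \<theta> (to_fract p) = eval_mpoly \<theta> p"
  by (simp add: subst_def inv_f_f[OF inj_to_fract])

lemma const_polys: "const c \<in> polys"
  and var_polys: "var j \<in> polys"
  by (auto simp: polys_def const_def var_def)

lemma polys_ring:
  assumes "f \<in> polys" "g \<in> polys"
  shows "f + g \<in> polys" "f * g \<in> polys" "f - g \<in> polys"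
  using assms by (auto simp: polys_def simp flip: to_fract_add to_fract_mult to_fract_diff)

lemma polys_power: "f \<in> polys \<Longrightarrow> f ^ n \<in> polys"
  using const_polys[of 1] by (induction n) (auto intro: polys_ring)

lemma polys_prod: "(\<And>a. a \<in> A \<Longrightarrow> f a \<in> polys) \<Longrightarrow> (\<Prod>a\<in>A. f a) \<in> polys"
  using const_polys[of 1] by (induction A rule: infinite_finite_induct) (auto intro: polys_ring)

lemma polys_sum: "(\<And>a. a \<in> A \<Longrightarrow> f a \<in> polys) \<Longrightarrow> (\<Sum>a\<in>A. f a) \<in> polys"
  using const_polys[of 0] by (induction A rule: infinite_finite_induct) (auto intro: polys_ring)

lemma subst_const [simp]: "subst \<theta> (const c) = const c"
  and subst_var [simp]: "subst \<theta> (var j) = \<theta> j"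
  by (simp_all add: const_def var_def subst_to_fract)

lemma subst_0 [simp]: "subst \<theta> 0 = 0" and subst_1 [simp]: "subst \<theta> 1 = 1"
  using subst_const[of \<theta> 0] subst_const[of \<theta> 1] by (simp_all del: subst_const)

lemma subst_add: "f \<in> polys \<Longrightarrow> g \<in> polys \<Longrightarrow> subst \<theta> (f + g) = subst \<theta> f + subst \<theta> g"
  and subst_mult: "f \<in> polys \<Longrightarrow> g \<in> polys \<Longrightarrow> subst \<theta> (f * g) = subst \<theta> f * subst \<theta> g"
  by (auto simp: polys_def subst_to_fract eval_mpoly_add eval_mpoly_mult simp flip: to_fract_add to_fract_mult)

lemma subst_diff: "f \<in> polys \<Longrightarrow> g \<in> polys \<Longrightarrow> subst \<theta> (f - g) = subst \<theta> f - subst \<theta> g"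
  using subst_add[of "f - g" g \<theta>] by (simp add: polys_ring)

lemma subst_power: "f \<in> polys \<Longrightarrow> subst \<theta> (f ^ n) = subst \<theta> f ^ n"
  by (induction n) (auto simp: subst_mult polys_power)

lemma subst_prod: "(\<And>a. a \<in> A \<Longrightarrow> f a \<in> polys) \<Longrightarrow> subst \<theta> (\<Prod>a\<in>A. f a) = (\<Prod>a\<in>A. subst \<theta> (f a))"
  by (induction A rule: infinite_finite_induct) (auto simp: subst_mult polys_prod)

lemma subst_sum: "(\<And>a. a \<in> A \<Longrightarrow> f a \<in> polys) \<Longrightarrow> subst \<theta> (\<Sum>a\<in>A. f a) = (\<Sum>a\<in>A. subst \<theta> (f a))"
  by (induction A rule: infinite_finite_induct) (auto simp: subst_add polys_sum)

lemma var_inj: "var i = (var j :: 'k::field ratfun) \<longleftrightarrow> i = j"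
proof
  assume "var i = (var j :: 'k ratfun)"
  from arg_cong[OF this, of "subst (\<lambda>k. if k = i then 1 else 0)"] show "i = j"
    by (auto split: if_splits)
qed simp

lemma var_nonzero [simp]: "var i \<noteq> 0"
proof
  assume "var i = (0 :: 'a ratfun)"
  from arg_cong[OF this, of "subst (\<lambda>_. 1)"] show False by simp
qed

lemma poly_ring_polys: "f \<in> poly_ring l \<Longrightarrow> f \<in> polys"
  by (auto simp: poly_ring_def polys_def)

lemma mpolys_ring:
  assumes "p \<in> mpolys l" "q \<in> mpolys l"
  shows "p + q \<in> mpolys l" "p * q \<in> mpolys l" "p - q \<in> mpolys l"
proof -
  show "p + q \<in> mpolys l" using assms keys_add[of p q] unfolding mpolys_def by blast
  show "p - q \<in> mpolys l" using assms keys_diff[of p q] unfolding mpolys_def by blast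
  show "p * q \<in> mpolys l"
    unfolding mpolys_def
  proof (intro CollectI ballI)
    fix m assume "m \<in> Poly_Mapping.keys (p * q)"
    then obtain a b where "a \<in> Poly_Mapping.keys p" "b \<in> Poly_Mapping.keys q" "m = a + b"
      using keys_mult[of p q] by blast
    then show "Poly_Mapping.keys m \<subseteq> {1..l}" using assms keys_add[of a b] unfolding mpolys_def by blast
  qed
qed

lemma poly_ring_closed:
  assumes "f \<in> poly_ring l" "g \<in> poly_ring l"
  shows "f + g \<in> poly_ring l" "f * g \<in> poly_ring l" "f - g \<in> poly_ring l"
  using assms unfolding poly_ring_def
  by (auto intro!: imageI mpolys_ring simp flip: to_fract_add to_fract_mult to_fract_diff)

lemma const_poly_ring: "const c \<in> poly_ring l"
  and var_poly_ring: "i \<in> {1..l} \<Longrightarrow> var i \<in> poly_ring l"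
  by (auto simp: poly_ring_def const_def var_def mpolys_def intro!: imageI)

lemma zero_poly_ring: "0 \<in> poly_ring l" and one_poly_ring: "1 \<in> poly_ring l"
  using const_poly_ring[of 0] const_poly_ring[of 1] by auto

lemma poly_ring_uminus: "f \<in> poly_ring l \<Longrightarrow> - f \<in> poly_ring l"
  using poly_ring_closed(3)[OF zero_poly_ring, of f] by simp

lemma poly_ring_power: "f \<in> poly_ring l \<Longrightarrow> f ^ n \<in> poly_ring l"
  by (induction n) (auto intro: poly_ring_closed one_poly_ring)

lemma poly_ring_prod: "(\<And>a. a \<in> A \<Longrightarrow> f a \<in> poly_ring l) \<Longrightarrow> (\<Prod>a\<in>A. f a) \<in> poly_ring l"
  by (induction A rule: infinite_finite_induct) (auto intro: poly_ring_closed one_poly_ring)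

lemma poly_ring_induct [consumes 1, case_names const var add mult]:
  fixes P :: "'k::field ratfun \<Rightarrow> bool"
  assumes f: "f \<in> poly_ring l"
    and const: "\<And>c. P (const c)" and var: "\<And>i. i \<in> {1..l} \<Longrightarrow> P (var i)"
    and add: "\<And>f g. f \<in> poly_ring l \<Longrightarrow> g \<in> poly_ring l \<Longrightarrow> P f \<Longrightarrow> P g \<Longrightarrow> P (f + g)"
    and mult: "\<And>f g. f \<in> poly_ring l \<Longrightarrow> g \<in> poly_ring l \<Longrightarrow> P f \<Longrightarrow> P g \<Longrightarrow> P (f * g)"
  shows "P f"
proof -
  obtain p where p: "p \<in> mpolys l" "f = to_fract p" using f by (auto simp: poly_ring_def)
  have P1: "P 1" and P0: "P 0" using const[of 1] const[of 0] by auto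
  have pow: "P (var i ^ k) \<and> (var i :: 'k ratfun) ^ k \<in> poly_ring l" if "i \<in> {1..l}" for i k
  proof (induction k)
    case (Suc k)
    then show ?case
      using mult[of "var i" "var i ^ k"] var[OF that] that by (simp add: poly_ring_closed var_poly_ring)
  qed (simp add: P1 one_poly_ring)
  have mon: "P (monom_eval var m) \<and> (monom_eval var m :: 'k ratfun) \<in> poly_ring l" if "Poly_Mapping.keys m \<subseteq> {1..l}" for m
  proof -
    have "P (\<Prod>j\<in>A. var j ^ Poly_Mapping.lookup m j) \<and>
        (\<Prod>j\<in>A. (var j :: 'k ratfun) ^ Poly_Mapping.lookup m j) \<in> poly_ring l"
      if "finite A" "A \<subseteq> {1..l}" for A using that
      by (induction A rule: finite_induct) (use P1 pow in \<open>auto intro: poly_ring_closed one_poly_ring mult\<close>)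
    then show ?thesis using that unfolding monom_eval_def by auto
  qed
  have "P (\<Sum>m\<in>A. const (Poly_Mapping.lookup p m) * monom_eval var m) \<and>
      (\<Sum>m\<in>A. const (Poly_Mapping.lookup p m) * monom_eval var m) \<in> poly_ring l"
    if "finite A" "A \<subseteq> Poly_Mapping.keys p" for A using that
    by (induction A rule: finite_induct)
      (use P0 mon p in \<open>auto simp: mpolys_def intro!: poly_ring_closed zero_poly_ring const_poly_ring mult const add\<close>)
  from this[of "Poly_Mapping.keys p"] show ?thesis unfolding p to_fract_eval eval_mpoly_def by auto
qed

subsection \<open>Homogeneous rational functions\<close>

lemma mdeg_add: "mdeg (m + n) = mdeg m + mdeg n"
proof -
  have sup: "mdeg k = (\<Sum>i\<in>A. Poly_Mapping.lookup k i)" if "finite A" "Poly_Mapping.keys k \<subseteq> A" for k A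
    unfolding mdeg_def by (rule sum.mono_neutral_left) (use that in \<open>auto simp: in_keys_iff\<close>)
  let ?A = "Poly_Mapping.keys m \<union> Poly_Mapping.keys n"
  show ?thesis
    using keys_add[of m n] by (subst (1 2 3) sup[of ?A]) (auto simp: lookup_add sum.distrib)
qed

lemma homogeneous_closed:
  "homogeneous a p \<Longrightarrow> homogeneous a q \<Longrightarrow> homogeneous a (p - q)"
  "homogeneous a p \<Longrightarrow> homogeneous b q \<Longrightarrow> homogeneous (a + b) (p * q)"
proof -
  show "homogeneous a p \<Longrightarrow> homogeneous a q \<Longrightarrow> homogeneous a (p - q)"
    using keys_diff[of p q] unfolding homogeneous_def by blast
  show "homogeneous (a + b) (p * q)" if "homogeneous a p" "homogeneous b q"
    unfolding homogeneous_def
  proof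
    fix m assume "m \<in> Poly_Mapping.keys (p * q)"
    then obtain u v where "u \<in> Poly_Mapping.keys p" "v \<in> Poly_Mapping.keys q" "m = u + v"
      using keys_mult[of p q] by blast
    then show "mdeg m = a + b" using that mdeg_add by (simp add: homogeneous_def)
  qed
qed

lemma rat_homogeneousI:
  assumes "p \<in> mpolys l" "q \<in> mpolys l" "q \<noteq> 0" "homogeneous a p" "homogeneous b q" "int a - int b = d"
  shows "to_fract p / to_fract q \<in> rat_homogeneous l d"
  unfolding rat_homogeneous_def Fract_conv_to_fract[symmetric] using assms by blast

lemma rat_homogeneousE:
  assumes "f \<in> rat_homogeneous l d"
  obtains p q a b where "p \<in> mpolys l" "q \<in> mpolys l" "q \<noteq> 0" "homogeneous a p" "homogeneous b q"
    "int a - int b = d" "f = to_fract p / to_fract q" | "f = 0"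
  using assms unfolding rat_homogeneous_def Fract_conv_to_fract by blast

lemma rat_homogeneous_zero: "0 \<in> rat_homogeneous l d"
  by (simp add: rat_homogeneous_def)

lemma rat_homogeneous_uminus:
  assumes "f \<in> rat_homogeneous l d" shows "- f \<in> rat_homogeneous l d"
  using assms
proof (cases rule: rat_homogeneousE)
  case (1 p q a b)
  have "0 - p \<in> mpolys l" using 1 by (intro mpolys_ring) (auto simp: mpolys_def)
  moreover have "homogeneous a (0 - p)" using 1 by (intro homogeneous_closed) (auto simp: homogeneous_def)
  ultimately have "to_fract (0 - p) / to_fract q \<in> rat_homogeneous l d"
    using 1 by (intro rat_homogeneousI)
  then show ?thesis using 1 by simp
qed (simp add: rat_homogeneous_zero)

lemma rat_homogeneous_diff:
  assumes f: "f \<in> rat_homogeneous l d" and g: "g \<in> rat_homogeneous l d"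
  shows "f - g \<in> rat_homogeneous l d"
  using f
proof (cases rule: rat_homogeneousE)
  case (1 p q a b)
  note P = this
  show ?thesis using g
  proof (cases rule: rat_homogeneousE)
    case (1 p' q' a' b')
    have eq: "f - g = to_fract (p * q' - p' * q) / to_fract (q * q')"
      unfolding P(7) 1(7) using P(3) 1(3) by (simp add: field_simps)
    have d: "a + b' = a' + b" using P 1 by linarith
    have h: "homogeneous (a + b') (p * q' - p' * q)"
      using homogeneous_closed(1)[OF homogeneous_closed(2)[OF P(4) 1(5)]
          homogeneous_closed(2)[OF 1(4) P(5), folded d]] .
    have h': "homogeneous (b + b') (q * q')"
      using homogeneous_closed(2)[OF P(5) 1(5)] .
    show ?thesis
      unfolding eq by (rule rat_homogeneousI[OF _ _ _ h h']) (use P 1 in \<open>auto intro!: mpolys_ring\<close>)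
  qed (use f in simp)
next
  case 2
  then show ?thesis using rat_homogeneous_uminus[OF g] by simp
qed

lemma rat_homogeneous_mult:
  assumes f: "f \<in> rat_homogeneous l d" and g: "g \<in> rat_homogeneous l d'"
  shows "f * g \<in> rat_homogeneous l (d + d')"
  using f
proof (cases rule: rat_homogeneousE)
  case (1 p q a b)
  note P = this
  show ?thesis using g
  proof (cases rule: rat_homogeneousE)
    case (1 p' q' a' b')
    have eq: "f * g = to_fract (p * p') / to_fract (q * q')"
      unfolding P(7) 1(7) by simp
    show ?thesis
      unfolding eq
      by (rule rat_homogeneousI[OF _ _ _ homogeneous_closed(2)[OF P(4) 1(4)] homogeneous_closed(2)[OF P(5) 1(5)]])
        (use P 1 in \<open>auto intro!: mpolys_ring\<close>)
  qed (simp add: rat_homogeneous_zero)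
qed (simp add: rat_homogeneous_zero)

lemma rat_homogeneous_inverse:
  assumes f: "f \<in> rat_homogeneous l d"
  shows "inverse f \<in> rat_homogeneous l (- d)"
proof (cases "f = 0")
  case False
  from f show ?thesis
  proof (cases rule: rat_homogeneousE)
    case (1 p q a b)
    then have "p \<noteq> 0" using False by auto
    then have "to_fract q / to_fract p \<in> rat_homogeneous l (- d)"
      using 1 by (intro rat_homogeneousI) auto
    then show ?thesis using 1 by simp
  qed (simp add: rat_homogeneous_zero)
qed (simp add: rat_homogeneous_zero)

lemma homogeneous_1: "homogeneous 0 1"
  by (simp add: homogeneous_def mdeg_def)

lemma one_mpolys: "1 \<in> mpolys l"
  by (simp add: mpolys_def)

lemma rat_homogeneous_const: "const c \<in> rat_homogeneous l 0"
proof -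
  have "to_fract (Poly_Mapping.single 0 c) / to_fract 1 \<in> rat_homogeneous l 0"
    by (rule rat_homogeneousI[OF _ one_mpolys _ _ homogeneous_1, of _ _ 0]) (auto simp: mpolys_def homogeneous_def mdeg_def)
  then show ?thesis by (simp add: const_def)
qed

lemma rat_homogeneous_var: assumes "i \<in> {1..l}" shows "var i \<in> rat_homogeneous l 1"
proof -
  have "to_fract (Poly_Mapping.single (Poly_Mapping.single i 1) 1) / to_fract 1 \<in> rat_homogeneous l 1"
    by (rule rat_homogeneousI[OF _ one_mpolys _ _ homogeneous_1, of _ _ 1]) (use assms in \<open>auto simp: mpolys_def homogeneous_def mdeg_def\<close>)
  then show ?thesis by (simp add: var_def)
qed

lemma rat_homogeneous_sum:
  "(\<And>a. a \<in> A \<Longrightarrow> f a \<in> rat_homogeneous l d) \<Longrightarrow> (\<Sum>a\<in>A. f a) \<in> rat_homogeneous l d"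
proof (induction A rule: infinite_finite_induct)
  case (insert a A)
  have "f a - (- (\<Sum>a\<in>A. f a)) \<in> rat_homogeneous l d"
    using insert by (intro rat_homogeneous_diff rat_homogeneous_uminus) auto
  then show ?case using insert by simp
qed (simp_all add: rat_homogeneous_zero)

lemma rat_homogeneous_prod:
  "(\<And>a. a \<in> A \<Longrightarrow> f a \<in> rat_homogeneous l (d a)) \<Longrightarrow> (\<Prod>a\<in>A. f a) \<in> rat_homogeneous l (\<Sum>a\<in>A. d a)"
  using rat_homogeneous_const[of 1 l]
  by (induction A rule: infinite_finite_induct) (auto intro: rat_homogeneous_mult)

lemma rat_homogeneous_power: "f \<in> rat_homogeneous l d \<Longrightarrow> f ^ n \<in> rat_homogeneous l (int n * d)"
  using rat_homogeneous_prod[of "{..<n}" "\<lambda>_. f" l "\<lambda>_. d"] by simp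

lemma rat_homogeneous_powi: "f \<in> rat_homogeneous l d \<Longrightarrow> f powi n \<in> rat_homogeneous l (n * d)"
  using rat_homogeneous_power[of f l d "nat n"] rat_homogeneous_inverse[OF rat_homogeneous_power[of f l d "nat (- n)"]]
  by (cases "n \<ge> 0") (simp_all add: power_int_def power_inverse)

text \<open>Over the common denominator the numerators become homogeneous polynomials
  \<open>r n\<close> of pairwise different degrees \<open>e n\<close>, whose monomials cannot
  cancel. This is what separates the homogeneous parts of an expansion.\<close>

lemma homogeneous_sum_eq_0:
  assumes "finite T" "\<And>n. n \<in> T \<Longrightarrow> f n \<in> rat_homogeneous l n" "(\<Sum>n\<in>T. f n) = 0" "n \<in> T"
  shows "f n = 0"
proof -
  have "\<forall>n\<in>T. \<exists>p q a b. q \<noteq> 0 \<and> homogeneous a p \<and> homogeneous b q \<and> int a - int b = n \<and>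
      f n = to_fract p / to_fract q"
  proof
    fix n assume "n \<in> T"
    then have "f n \<in> rat_homogeneous l n" using assms by blast
    then show "\<exists>p q a b. q \<noteq> 0 \<and> homogeneous a p \<and> homogeneous b q \<and> int a - int b = n \<and>
      f n = to_fract p / to_fract q"
    proof (cases rule: rat_homogeneousE)
      \<comment> \<open>Zero is also written as a fraction of degree \<open>n\<close>, over a
        monomial of degree \<open>nat (- n)\<close>, so that all summands have the same
        shape.\<close>
      case 2
      have "homogeneous (nat n) (0::'a mpoly)" by (simp add: homogeneous_def)
      moreover have "\<exists>m::nat \<Rightarrow>\<^sub>0 nat. mdeg m = nat (- n)"
        by (rule exI[of _ "Poly_Mapping.single 0 (nat (- n))"]) (simp add: mdeg_def)
      then obtain m :: "nat \<Rightarrow>\<^sub>0 nat" where "mdeg m = nat (- n)" by blast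
      then have "homogeneous (nat (- n)) (Poly_Mapping.single m (1::'a))" by (simp add: homogeneous_def)
      moreover have "Poly_Mapping.single m (1::'a) \<noteq> 0" by (metis lookup_single_eq lookup_zero zero_neq_one)
      ultimately show ?thesis using 2
        by (intro exI[of _ 0] exI[of _ "Poly_Mapping.single m (1::'a)"] exI[of _ "nat n"] exI[of _ "nat (- n)"]) auto
    qed blast
  qed
  then obtain p q a b where P: "\<And>n. n \<in> T \<Longrightarrow> q n \<noteq> 0 \<and> homogeneous (a n) (p n) \<and> homogeneous (b n) (q n) \<and>
      int (a n) - int (b n) = n \<and> f n = to_fract (p n) / to_fract (q n)"
    by metis
  define r where "r n = p n * (\<Prod>k\<in>T - {n}. q k)" for n
  \<comment> \<open>Differs from \<open>n\<close> by the total degree of all denominators, the same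
    for every \<open>n\<close>; hence distinct \<open>n\<close> give distinct degrees.\<close>
  define e where "e n = a n + (\<Sum>k\<in>T - {n}. b k)" for n
  have hom_prod: "homogeneous (\<Sum>k\<in>S. b k) (\<Prod>k\<in>S. q k)" if "finite S" "S \<subseteq> T" for S
    using that by (induction S rule: finite_induct) (auto simp: homogeneous_1 P intro!: homogeneous_closed)
  have rhom: "homogeneous (e n) (r n)" if "n \<in> T" for n
    unfolding e_def r_def using assms(1) P[OF that] by (intro homogeneous_closed hom_prod) auto
  have e: "int (e n) = n + int (\<Sum>k\<in>T. b k)" if "n \<in> T" for n
    using P[OF that] assms(1) that by (simp add: e_def sum.remove[OF assms(1) that, of b])
  have fr: "f n * (\<Prod>k\<in>T. to_fract (q k)) = to_fract (r n)" if "n \<in> T" for n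
  proof -
    have pr: "to_fract (\<Prod>k\<in>S. q k) = (\<Prod>k\<in>S. to_fract (q k))" for S
      by (induction S rule: infinite_finite_induct) auto
    show ?thesis unfolding r_def to_fract_mult pr prod.remove[OF assms(1) that, of "\<lambda>k. to_fract (q k)"]
      using P[OF that] by simp
  qed
  have "to_fract (\<Sum>n\<in>T. r n) = (\<Sum>n\<in>T. f n) * (\<Prod>k\<in>T. to_fract (q k))"
    by (simp add: sum_distrib_right fr)
  then have r0: "(\<Sum>n\<in>T. r n) = 0"
    unfolding assms(3) mult_zero_left to_fract_eq_0_iff .
  have "r n = 0"
  proof (rule poly_mapping_eqI)
    fix m
    show "Poly_Mapping.lookup (r n) m = Poly_Mapping.lookup 0 m"
    proof (cases "mdeg m = e n")
      case True
      have "Poly_Mapping.lookup (r k) m = 0" if "k \<in> T - {n}" for k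
      proof (rule ccontr)
        assume "Poly_Mapping.lookup (r k) m \<noteq> 0"
        then have "mdeg m = e k" using rhom[of k] that by (simp add: homogeneous_def in_keys_iff)
        then show False using e[of k] e[OF assms(4)] True that by simp
      qed
      then have "(\<Sum>k\<in>T. Poly_Mapping.lookup (r k) m) = Poly_Mapping.lookup (r n) m"
        using assms(1,4) by (subst sum.remove[of T n]) auto
      then show ?thesis using r0 by (metis lookup_sum lookup_zero)
    next
      case False
      then show ?thesis using rhom[OF assms(4)] by (auto simp: homogeneous_def in_keys_iff)
    qed
  qed
  then have "to_fract (p n) = 0" using P assms(1) by (auto simp: r_def)
  then show ?thesis using P[OF assms(4)] by simp
qed

section \<open>Logarithmic 1-forms of graphic arrangements\<close>

lemma (in vector_space) span_image_obtain:
  assumes "x \<in> span (f ` I)"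
  obtains T c where "finite T" "T \<subseteq> I" "x = (\<Sum>t\<in>T. scale (c t) (f t))"
proof -
  from assms obtain t r where t: "finite t" "t \<subseteq> f ` I" "x = (\<Sum>a\<in>t. scale (r a) a)"
    by (auto simp: span_explicit)
  from t(2) obtain T where T: "T \<subseteq> I" "inj_on f T" "t = f ` T" by (auto simp: subset_image_inj)
  show ?thesis
  proof
    show "finite T" using T t finite_image_iff by blast
    show "x = (\<Sum>t\<in>T. scale (r (f t)) (f t))" using T t by (simp add: sum.reindex)
  qed (use T in simp)
qed

global_interpretation rf: vector_space "\<lambda>(a::'k::field) (f::'k ratfun). const a * f"
  by unfold_locales (auto simp: algebra_simps)

text \<open>At component \<open>i\<close> the operator \<open>z\<close> is \<open>x_i\<close> and
  \<open>y_j\<close> is \<open>x_j - x_i\<close>. These are linear coordinates on the space; as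
  \<open>y_i\<close> is zero there, the slot \<open>e i\<close> is free to hold the exponent of
  \<open>z\<close>.\<close>

definition basis_monom :: "nat \<Rightarrow> nat \<Rightarrow> (nat \<Rightarrow> nat) \<Rightarrow> 'k::field ratfun" where
  "basis_monom l i e = var i ^ e i * (\<Prod>j\<in>{1..l} - {i}. (var j - var i) ^ e j)"

definition exponents :: "nat \<Rightarrow> (nat \<Rightarrow> nat) set" where
  "exponents l = {e. \<forall>j. j \<notin> {1..l} \<longrightarrow> e j = 0}"

lemma basis_monom_add: "basis_monom l i (e + e') = basis_monom l i e * basis_monom l i e'"
  by (simp add: basis_monom_def power_add prod.distrib mult_ac)

lemma basis_monom_span:
  fixes f :: "'k::field ratfun"
  assumes f: "f \<in> poly_ring l" and i: "i \<in> {1..l}"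
  shows "f \<in> rf.span (basis_monom l i ` exponents l)"
proof -
  let ?S = "rf.span (basis_monom l i ` exponents l) :: 'k ratfun set"
  have mult: "x * y \<in> ?S" if x: "x \<in> ?S" and y: "y \<in> ?S" for x y
  proof -
    have 1: "x * b \<in> ?S" if b: "b \<in> basis_monom l i ` exponents l" for b
      using x
    proof (induction rule: rf.span_induct_alt)
      case (step c a y)
      then obtain e e' where e: "a = basis_monom l i e" "e \<in> exponents l" "b = basis_monom l i e'" "e' \<in> exponents l"
        using b by blast
      have "a * b \<in> ?S"
        unfolding e basis_monom_add[symmetric] by (rule rf.span_base, rule imageI) (use e in \<open>auto simp: exponents_def\<close>)
      then have "const c * (a * b) + y * b \<in> ?S" by (intro rf.span_add rf.span_scale step)
      then show ?case by (simp add: algebra_simps)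
    qed (simp add: rf.span_zero)
    show ?thesis using y
    proof (induction rule: rf.span_induct_alt)
      case (step c b y)
      have "const c * (x * b) + x * y \<in> ?S" by (intro rf.span_add rf.span_scale 1 step)
      then show ?case by (simp add: algebra_simps)
    qed (simp add: rf.span_zero)
  qed
  have base: "basis_monom l i e \<in> ?S" if "e \<in> exponents l" for e
    using that by (intro rf.span_base imageI)
  have vi: "var i \<in> ?S"
  proof -
    have "basis_monom l i (\<lambda>j. if j = i then 1 else 0) = var i"
      by (simp add: basis_monom_def)
    moreover have "(\<lambda>j. if j = i then 1 else 0) \<in> exponents l" using i by (auto simp: exponents_def)
    ultimately show ?thesis using base by metis
  qed
  show ?thesis using f
  proof (induction rule: poly_ring_induct)
    case (const c)
    have "const c * basis_monom l i 0 \<in> ?S" by (intro rf.span_scale base) (auto simp: exponents_def)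
    then show ?case by (simp add: basis_monom_def)
  next
    case (var j)
    show ?case
    proof (cases "j = i")
      case False
      have "basis_monom l i (\<lambda>k. if k = j then 1 else 0) = (\<Prod>k\<in>{1..l} - {i}. if k = j then var k - var i else 1 :: 'k ratfun)"
        using False unfolding basis_monom_def by (simp add: if_distrib cong: if_cong)
      also have "\<dots> = var j - var i"
        using False var by (subst prod.delta) auto
      finally have eq: "basis_monom l i (\<lambda>k. if k = j then 1 else 0) = (var j - var i :: 'k ratfun)" .
      have "(\<lambda>k. if k = j then 1 else 0) \<in> exponents l" using var by (auto simp: exponents_def)
      from base[OF this] have "var j - var i \<in> ?S" unfolding eq .
      from rf.span_add[OF this vi] show ?thesis by simp
    qed (use vi in simp)
  qed (auto intro: rf.span_add mult)
qed

lemma basis_monom_indep: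
  assumes i: "i \<in> {1..l}" and T: "finite T" "T \<subseteq> exponents l"
    and 0: "(\<Sum>e\<in>T. const (c e) * basis_monom l i e) = (0 :: 'k::field ratfun)" and e0: "e0 \<in> T"
  shows "c e0 = 0"
proof -
  \<comment> \<open>The linear change of coordinates that sends \<open>x_j - x_i\<close> to
    \<open>x_j\<close> and fixes \<open>x_i\<close>, turning these products into ordinary
    monomials.\<close>
  define \<theta> :: "nat \<Rightarrow> 'k ratfun" where "\<theta> j = (if j = i then var i else var j + var i)" for j
  define ex :: "(nat \<Rightarrow> nat) \<Rightarrow> nat \<Rightarrow>\<^sub>0 nat" where "ex e = (\<Sum>j\<in>{1..l}. Poly_Mapping.single j (e j))" for e
  have bp: "basis_monom l i e \<in> polys" for e :: "nat \<Rightarrow> nat"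
    unfolding basis_monom_def by (intro polys_ring polys_power polys_prod var_polys)
  have lk: "Poly_Mapping.lookup (ex e) j = (if j \<in> {1..l} then e j else 0)" for e j
    by (simp add: ex_def lookup_sum lookup_single when_def)
  have s: "subst \<theta> (basis_monom l i e) = monom_eval var (ex e)" for e
  proof -
    have "subst \<theta> (basis_monom l i e) = var i ^ e i * (\<Prod>j\<in>{1..l} - {i}. var j ^ e j)"
      unfolding basis_monom_def
      by (subst subst_mult) (auto simp: subst_prod subst_power subst_diff polys_power polys_ring var_polys
          polys_prod \<theta>_def intro!: prod.cong)
    also have "\<dots> = (\<Prod>j\<in>{1..l}. var j ^ e j)" using prod.remove[OF _ i, of "\<lambda>j. var j ^ e j :: 'k ratfun"] by simp
    also have "\<dots> = monom_eval var (ex e)"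
      by (subst monom_eval_superset[of "{1..l}"]) (auto simp: lk in_keys_iff split: if_splits)
    finally show ?thesis .
  qed
  have "0 = subst \<theta> (\<Sum>e\<in>T. const (c e) * basis_monom l i e)" by (simp add: 0)
  also have "\<dots> = (\<Sum>e\<in>T. const (c e) * monom_eval var (ex e))"
    by (subst subst_sum) (auto simp: subst_mult const_polys bp s intro!: polys_ring)
  also have "\<dots> = to_fract (\<Sum>e\<in>T. Poly_Mapping.single (ex e) (c e))"
    by (simp add: to_fract_single)
  finally have z: "(\<Sum>e\<in>T. Poly_Mapping.single (ex e) (c e)) = 0" by (metis to_fract_eq_0_iff)
  have "ex e = ex e0 \<longleftrightarrow> e = e0" if "e \<in> T" for e
  proof
    assume eq: "ex e = ex e0"
    show "e = e0"
    proof
      fix j show "e j = e0 j"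
      proof (cases "j \<in> {1..l}")
        case True
        then show ?thesis using arg_cong[OF eq, of "\<lambda>p. Poly_Mapping.lookup p j"] by (simp add: lk)
      next
        case False
        have "e \<in> exponents l" "e0 \<in> exponents l" using T that e0 by auto
        then show ?thesis using False by (simp add: exponents_def)
      qed
    qed
  qed simp
  then have "Poly_Mapping.lookup (\<Sum>e\<in>T. Poly_Mapping.single (ex e) (c e)) (ex e0) = (\<Sum>e\<in>T. if e = e0 then c e else 0)"
    unfolding lookup_sum by (intro sum.cong) (auto simp: lookup_single when_def)
  then show ?thesis using z T e0 by simp
qed

text \<open>Component \<open>i\<close> of a Laurent monomial, in which the factor for
  \<open>y_i\<close> is left out: its exponent -1 stands for \<open>dx_i\<close> itself.\<close>

definition laurent_monom :: "nat \<Rightarrow> nat \<Rightarrow> (nat \<Rightarrow> int) \<Rightarrow> 'k::field ratfun" where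
  "laurent_monom l i m = var i powi m 0 * (\<Prod>j\<in>{1..l} - {i}. (var j - var i) powi m (l + j))"

text \<open>The indices of \<open>z\<close> and of the \<open>y_j\<close>. Those in
  \<open>{1..l}\<close> are reserved for the \<open>x_j\<close>, so that both sets of generators fit
  into one family.\<close>

definition yz :: "nat \<Rightarrow> nat set" where
  "yz l = insert 0 {l + 1..2 * l}"

lemma laurent_monom_add: "laurent_monom l i (m + m') = laurent_monom l i m * laurent_monom l i m'"
proof -
  have "(\<Prod>j\<in>{1..l} - {i}. (var j - var i :: 'a ratfun) powi (m (l + j) + m' (l + j))) =
     (\<Prod>j\<in>{1..l} - {i}. (var j - var i) powi m (l + j) * (var j - var i) powi m' (l + j))"
    by (intro prod.cong refl power_int_add) (simp add: var_inj)
  then show ?thesis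
    by (simp add: laurent_monom_def power_int_add prod.distrib mult_ac)
qed

text \<open>Multiplication by the monomial with all exponents equal to a large \<open>N\<close>
  reduces this to \<open>basis_monom_indep\<close>. The entry at \<open>l + i\<close> is invisible
  in \<open>laurent_monom l i\<close>, so the common value \<open>k\<close> is what keeps the
  multidegrees distinguishable.\<close>

lemma laurent_monom_indep:
  assumes i: "i \<in> {1..l}" and T: "finite T"
    and supp: "\<And>m u. m \<in> T \<Longrightarrow> u \<notin> yz l \<Longrightarrow> m u = 0" and mi: "\<And>m. m \<in> T \<Longrightarrow> m (l + i) = k"
    and 0: "(\<Sum>m\<in>T. const (c m) * laurent_monom l i m) = (0 :: 'k::field ratfun)" and m0: "m0 \<in> T"
  shows "c m0 = 0"
proof -
  define N where "N = (\<Sum>m\<in>T. \<Sum>u\<in>yz l. \<bar>m u\<bar>)"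
  have N: "m u + N \<ge> 0" if "m \<in> T" for m u
  proof (cases "u \<in> yz l")
    case True
    have "\<bar>m u\<bar> \<le> (\<Sum>u\<in>yz l. \<bar>m u\<bar>)" using True by (intro member_le_sum) (auto simp: yz_def)
    also have "\<dots> \<le> N" unfolding N_def using that T
      by (intro member_le_sum[of m T "\<lambda>m. \<Sum>u\<in>yz l. \<bar>m u\<bar>"]) (auto intro: sum_nonneg)
    finally show ?thesis by linarith
  next
    case False
    moreover have "N \<ge> 0" unfolding N_def by (intro sum_nonneg) auto
    ultimately show ?thesis using supp[OF that] by simp
  qed
  define ex where "ex m j = (if j \<in> {1..l} then nat ((if j = i then m 0 else m (l + j)) + N) else 0)"
    for m :: "nat \<Rightarrow> int" and j
  have inj: "inj_on ex T"
  proof (rule inj_onI, rule ext)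
    fix m m' u assume mm: "m \<in> T" "m' \<in> T" "ex m = ex m'"
    have eq: "(if j = i then m 0 else m (l + j)) = (if j = i then m' 0 else m' (l + j))" if "j \<in> {1..l}" for j
      using fun_cong[OF mm(3), of j] that N[OF mm(1), of 0] N[OF mm(1), of "l + j"] N[OF mm(2), of 0] N[OF mm(2), of "l + j"]
      by (auto simp: ex_def split: if_splits)
    consider "u = 0" | j where "j \<in> {1..l}" "u = l + j" | "u \<notin> yz l"
    proof (cases "u \<in> {l + 1..2 * l}")
      case True
      then show ?thesis using that(2)[of "u - l"] by auto
    qed (use that in \<open>auto simp: yz_def\<close>)
    then show "m u = m' u"
    proof cases
      case 1 then show ?thesis using eq[OF i] by simp
    next
      case (2 j) then show ?thesis using eq[of j] mi mm by (cases "j = i") auto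
    next
      case 3 then show ?thesis using supp[OF mm(1)] supp[OF mm(2)] by simp
    qed
  qed
  have lb: "laurent_monom l i (m + (\<lambda>_. N)) = (basis_monom l i (ex m) :: 'k ratfun)" if "m \<in> T" for m
  proof -
    have "(\<Prod>j\<in>{1..l} - {i}. (var j - var i :: 'k ratfun) powi (m (l + j) + N)) = (\<Prod>j\<in>{1..l} - {i}. (var j - var i) ^ ex m j)"
      using N[OF that] by (intro prod.cong) (auto simp: ex_def power_int_def)
    then show ?thesis using N[OF that, of 0] i
      unfolding laurent_monom_def basis_monom_def by (simp add: ex_def power_int_def)
  qed
  have "0 = (\<Sum>m\<in>T. const (c m) * laurent_monom l i m) * laurent_monom l i (\<lambda>_. N)" by (simp add: 0)
  also have "\<dots> = (\<Sum>m\<in>T. const (c m) * laurent_monom l i (m + (\<lambda>_. N)))"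
    by (simp only: sum_distrib_right laurent_monom_add mult.assoc)
  also have "\<dots> = (\<Sum>m\<in>T. const (c m) * basis_monom l i (ex m))" by (simp add: lb)
  also have "\<dots> = (\<Sum>e\<in>ex ` T. const (c (the_inv_into T ex e)) * basis_monom l i e)"
    by (simp add: sum.reindex[OF inj] the_inv_into_f_f[OF inj])
  finally have "c (the_inv_into T ex (ex m0)) = 0"
    by (intro basis_monom_indep[OF i, of "ex ` T" "\<lambda>e. c (the_inv_into T ex e)"])
      (use T m0 in \<open>auto simp: exponents_def ex_def\<close>)
  then show ?thesis by (simp add: the_inv_into_f_f[OF inj m0])
qed

subsection \<open>Prescribed poles\<close>

definition edge_form :: "nat \<times> nat \<Rightarrow> 'k::field ratfun" where
  "edge_form e = var (snd e) - var (fst e)"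

text \<open>As a substitution, this is restriction of polynomials to the hyperplane
  \<open>x_u = x_v\<close>.\<close>

definition identify :: "nat \<Rightarrow> nat \<Rightarrow> nat \<Rightarrow> 'k::field ratfun" where
  "identify u v = (\<lambda>j. if j = v then var u else var j)"

text \<open>The factor theorem for \<open>x_v - x_u\<close>. For a product,
  \<open>f * f' - s * s'\<close> splits as \<open>(f - s) * f' + s * (f' - s')\<close>, where
  \<open>s\<close>, \<open>s'\<close> are the restrictions, so the property passes through the ring
  operations.\<close>

lemma subst_identify_cong:
  assumes f: "f \<in> poly_ring l" and uv: "u \<in> {1..l}" "v \<in> {1..l}"
  shows "\<exists>g\<in>poly_ring l. f - subst (identify u v) f = (var v - var u) * g"
proof -
  have "subst (identify u v) f \<in> poly_ring l \<and> (\<exists>g\<in>poly_ring l. f - subst (identify u v) f = (var v - var u) * g)"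
    using f
  proof (induction rule: poly_ring_induct)
    case (const c)
    then show ?case using zero_poly_ring by (auto simp: const_poly_ring intro!: bexI[of _ 0])
  next
    case (var j)
    show ?case
    proof (cases "j = v")
      case True
      then show ?thesis using uv one_poly_ring by (auto simp: identify_def var_poly_ring intro!: bexI[of _ 1])
    next
      case False
      then show ?thesis using var zero_poly_ring by (auto simp: identify_def var_poly_ring intro!: bexI[of _ 0])
    qed
  next
    case (add f f')
    then obtain g g' where g: "g \<in> poly_ring l" "f - subst (identify u v) f = (var v - var u) * g"
      "g' \<in> poly_ring l" "f' - subst (identify u v) f' = (var v - var u) * g'" by blast
    have "f + f' - (subst (identify u v) f + subst (identify u v) f') =
        (f - subst (identify u v) f) + (f' - subst (identify u v) f')" by simp
    also have "\<dots> = (var v - var u) * (g + g')" unfolding g by (simp add: algebra_simps)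
    finally have "f + f' - (subst (identify u v) f + subst (identify u v) f') = (var v - var u) * (g + g')" .
    then show ?case using add g by (auto simp: subst_add poly_ring_polys poly_ring_closed intro!: bexI[of _ "g + g'"])
  next
    case (mult f f')
    then obtain g g' where g: "g \<in> poly_ring l" "f - subst (identify u v) f = (var v - var u) * g"
      "g' \<in> poly_ring l" "f' - subst (identify u v) f' = (var v - var u) * g'" by blast
    let ?h = "g * f' + subst (identify u v) f * g'"
    have "f * f' - subst (identify u v) f * subst (identify u v) f' =
        (f - subst (identify u v) f) * f' + subst (identify u v) f * (f' - subst (identify u v) f')"
      by (simp add: algebra_simps)
    also have "\<dots> = (var v - var u) * ?h" unfolding g by (simp add: algebra_simps)
    finally show ?case using mult g
      by (auto simp: subst_mult poly_ring_polys poly_ring_closed intro!: bexI[of _ ?h])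
  qed
  then show ?thesis by blast
qed

lemma subst_identify_eq_0:
  assumes "f \<in> poly_ring l" "u \<in> {1..l}" "v \<in> {1..l}" "subst (identify u v) f = 0"
  obtains g where "g \<in> poly_ring l" "f = (var v - var u) * g"
  using subst_identify_cong[OF assms(1-3)] assms(4) by auto

text \<open>Rational functions with at most simple poles along the hyperplanes in \<open>S\<close>
  and no other poles.\<close>

definition poles :: "nat \<Rightarrow> (nat \<times> nat) set \<Rightarrow> 'k::field ratfun set" where
  "poles l S = {f. f * (\<Prod>e\<in>S. edge_form e) \<in> poly_ring l}"

definition pairs :: "nat \<Rightarrow> (nat \<times> nat) set" where
  "pairs l = {(u, v). 1 \<le> u \<and> u < v \<and> v \<le> l}"

lemma finite_pairs: "finite (pairs l)"
  by (rule finite_subset[of _ "{1..l} \<times> {1..l}"]) (auto simp: pairs_def)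

lemma edge_form_poly_ring: "e \<in> pairs l \<Longrightarrow> edge_form e \<in> poly_ring l"
  by (auto simp: edge_form_def pairs_def intro!: poly_ring_closed var_poly_ring)

lemma edge_form_nonzero: "e \<in> pairs l \<Longrightarrow> edge_form e \<noteq> 0"
  by (auto simp: edge_form_def pairs_def var_inj)

lemma edge_forms_poly_ring: "S \<subseteq> pairs l \<Longrightarrow> (\<Prod>e\<in>S. edge_form e) \<in> poly_ring l"
  by (intro poly_ring_prod edge_form_poly_ring) auto

lemma edge_forms_nonzero: "S \<subseteq> pairs l \<Longrightarrow> (\<Prod>e\<in>S. edge_form e :: 'k::field ratfun) \<noteq> 0"
  by (subst prod_zero_iff) (use finite_subset[OF _ finite_pairs] in \<open>auto dest: edge_form_nonzero subsetD\<close>)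

lemma subst_identify_edge_forms:
  assumes S: "S \<subseteq> pairs l" "(u, v) \<notin> S" and uv: "(u, v) \<in> pairs l"
  shows "subst (identify u v) (\<Prod>e\<in>S. edge_form e :: 'k::field ratfun) \<noteq> 0"
proof -
  have "subst (identify u v) (\<Prod>e\<in>S. edge_form e :: 'k ratfun) = (\<Prod>e\<in>S. subst (identify u v) (edge_form e))"
    by (rule subst_prod) (use S in \<open>auto intro: poly_ring_polys edge_form_poly_ring\<close>)
  moreover have "subst (identify u v) (edge_form e :: 'k ratfun) \<noteq> 0" if "e \<in> S" for e
    using that assms by (cases e) (auto simp: edge_form_def subst_diff var_polys identify_def pairs_def var_inj)
  ultimately show ?thesis using finite_subset[OF S(1) finite_pairs] by simp
qed

lemma poles_mono:
  assumes "S \<subseteq> S'" "S' \<subseteq> pairs l" "f \<in> poles l S" shows "f \<in> poles l S'"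
proof -
  have fin: "finite S'" using assms finite_subset[OF _ finite_pairs] by blast
  have "(\<Prod>e\<in>S'. edge_form e :: 'a ratfun) = (\<Prod>e\<in>S' - S. edge_form e) * (\<Prod>e\<in>S. edge_form e)"
    by (rule prod.subset_diff[OF assms(1) fin])
  then have "f * (\<Prod>e\<in>S'. edge_form e) = (\<Prod>e\<in>S' - S. edge_form e) * (f * (\<Prod>e\<in>S. edge_form e))"
    by simp
  also have "\<dots> \<in> poly_ring l"
    by (rule poly_ring_closed(2)[OF edge_forms_poly_ring]) (use assms in \<open>auto simp: poles_def\<close>)
  finally show ?thesis by (simp add: poles_def)
qed

lemma poles_add: "f \<in> poles l S \<Longrightarrow> g \<in> poles l S \<Longrightarrow> f + g \<in> poles l S"
  and poles_mult: "h \<in> poly_ring l \<Longrightarrow> f \<in> poles l S \<Longrightarrow> h * f \<in> poles l S"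
  and poles_zero: "0 \<in> poles l S"
  by (auto simp: poles_def distrib_right mult.assoc poly_ring_closed zero_poly_ring)

text \<open>Unique factorization is replaced by restriction: the numerator \<open>f * ?P S\<close>
  vanishes on \<open>x_u = x_v\<close>, because its product with the remaining forms does and those
  forms restrict to nonzero polynomials. So \<open>x_v - x_u\<close> can be divided out.\<close>

lemma poles_remove:
  assumes e: "(u, v) \<in> S" and S: "S \<subseteq> E" "E \<subseteq> pairs l"
    and f: "f \<in> poles l S" "f \<in> poles l (E - {(u, v)})"
  shows "f \<in> poles l (S - {(u, v)})"
proof -
  let ?P = "\<lambda>S. (\<Prod>e\<in>S. edge_form e) :: 'a ratfun"
  have fin: "finite E" "finite S" using S finite_subset[OF _ finite_pairs] finite_subset by blast+
  have uv: "(u, v) \<in> pairs l" using e S by blast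
  have h: "f * ?P S \<in> poly_ring l" and h': "f * ?P (E - {(u, v)}) \<in> poly_ring l" using f by (auto simp: poles_def)
  have E: "?P E = ?P (E - S) * ?P S" by (rule prod.subset_diff[OF S(1) fin(1)])
  have E': "?P E = edge_form (u, v) * ?P (E - {(u, v)})" by (rule prod.remove) (use e S fin in auto)
  have ps: "?P (E - S) \<in> poly_ring l" using S by (intro edge_forms_poly_ring) auto
  \<comment> \<open>Both sides are \<open>f\<close> times the full product over \<open>E\<close>,
    once cleared by \<open>S\<close> and once by all pairs other than \<open>(u, v)\<close>.\<close>
  have "(f * ?P S) * ?P (E - S) = edge_form (u, v) * (f * ?P (E - {(u, v)}))"
    using E E' by (simp add: mult_ac)
  then have "subst (identify u v) ((f * ?P S) * ?P (E - S)) = subst (identify u v) (edge_form (u, v)) * subst (identify u v) (f * ?P (E - {(u, v)}))"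
    by (simp only: subst_mult[OF poly_ring_polys[OF edge_form_poly_ring[OF uv]] poly_ring_polys[OF h']])
  also have "subst (identify u v) (edge_form (u, v)) = (0 :: 'a ratfun)"
    by (simp add: edge_form_def subst_diff var_polys identify_def)
  finally have "subst (identify u v) (f * ?P S) * subst (identify u v) (?P (E - S)) = 0"
    using h ps by (simp add: subst_mult poly_ring_polys del: mult_eq_0_iff)
  moreover have "subst (identify u v) (?P (E - S)) \<noteq> 0"
    using S e uv by (intro subst_identify_edge_forms[where l = l]) auto
  ultimately have "subst (identify u v) (f * ?P S) = 0" by simp
  then obtain g where g: "g \<in> poly_ring l" "f * ?P S = (var v - var u) * g"
    using subst_identify_eq_0[OF h, of u v] uv by (auto simp: pairs_def)
  have "?P S = (var v - var u) * ?P (S - {(u, v)})"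
    using prod.remove[OF fin(2) e, of edge_form] by (simp add: edge_form_def)
  with g(2) have "f * ?P (S - {(u, v)}) = g"
    using uv by (auto simp: pairs_def var_inj mult.left_commute)
  with g(1) show ?thesis by (simp add: poles_def)
qed

lemma poles_Diff:
  assumes "E \<subseteq> pairs l" "f \<in> poles l E" "finite A" "A \<subseteq> E" "\<And>e. e \<in> A \<Longrightarrow> f \<in> poles l (E - {e})"
  shows "f \<in> poles l (E - A)"
  using assms(3-)
proof (induction A rule: finite_induct)
  case (insert e A)
  obtain u v where e: "e = (u, v)" by (cases e)
  have "f \<in> poles l (E - A - {(u, v)})"
    by (rule poles_remove[of _ _ _ E]) (use insert e assms(1) in auto)
  moreover have "E - insert e A = E - A - {(u, v)}" using e by auto
  ultimately show ?case by simp
qed (use assms(2) in simp)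

definition edge :: "nat \<Rightarrow> nat \<Rightarrow> nat \<times> nat" where
  "edge u v = (min u v, max u v)"

lemma prod_neighbours_sign:
  assumes J: "finite J" "u \<notin> J"
  shows "(\<Prod>j\<in>J. var j - var u) = (\<Prod>e\<in>edge u ` J. edge_form e :: 'k::field ratfun) \<or>
        (\<Prod>j\<in>J. var j - var u) = - (\<Prod>e\<in>edge u ` J. edge_form e :: 'k ratfun)"
proof -
  have inj: "inj_on (edge u) J" by (auto simp: inj_on_def edge_def min_def max_def split: if_splits)
  show ?thesis
    unfolding prod.reindex[OF inj] comp_def using J
  proof (induction J rule: finite_induct)
    case (insert j J)
    have "var j - var u = edge_form (edge u j) \<or> var j - var u = - (edge_form (edge u j) :: 'k ratfun)"
      by (auto simp: edge_form_def edge_def min_def max_def)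
    moreover have "u \<notin> J" using insert by simp
    ultimately show ?case using insert by auto
  qed simp
qed

lemma poles_neighbours:
  assumes J: "finite J" "u \<notin> J"
  shows "f \<in> poles l (edge u ` J) \<longleftrightarrow> f * (\<Prod>j\<in>J. var j - var u) \<in> poly_ring l"
  using prod_neighbours_sign[OF J, where 'k = 'a]
    poly_ring_uminus[of "f * (\<Prod>e\<in>edge u ` J. edge_form e)" l] poly_ring_uminus[of "- (f * (\<Prod>e\<in>edge u ` J. edge_form e))" l]
  by (auto simp: poles_def)

section \<open>The conditions defining logarithmic forms, in terms of poles and residues\<close>

definition edge_pairs :: "nat set set \<Rightarrow> (nat \<times> nat) set" where
  "edge_pairs E = {(u, v). u < v \<and> {u, v} \<in> E}"

definition hyperplane :: "nat \<Rightarrow> nat \<times> nat \<Rightarrow> (nat \<Rightarrow> 'k::field) set" where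
  "hyperplane l e = {x \<in> space l. x (fst e) = x (snd e)}"

lemma edge_pairs_subset:
  assumes "simple_graph {1..l} E" shows "edge_pairs E \<subseteq> pairs l"
  using assms unfolding simple_graph_def edge_pairs_def pairs_def by fastforce

lemma graphic_arrangement_image:
  assumes "simple_graph {1..l} E"
  shows "graphic_arrangement l E = hyperplane l ` edge_pairs E"
proof
  show "graphic_arrangement l E \<subseteq> (hyperplane l ` edge_pairs E :: (nat \<Rightarrow> 'a) set set)"
  proof
    fix H :: "(nat \<Rightarrow> 'a) set" assume "H \<in> graphic_arrangement l E"
    then obtain u v where uv: "{u, v} \<in> E" "H = {x \<in> space l. x u = x v}"
      by (auto simp: graphic_arrangement_def)
    have "u \<noteq> v" using assms uv(1) by (force simp: simple_graph_def)
    then consider "u < v" | "v < u" by linarith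
    then show "H \<in> hyperplane l ` edge_pairs E"
    proof cases
      case 1
      then show ?thesis using uv by (intro image_eqI[of _ _ "(u, v)"]) (auto simp: hyperplane_def edge_pairs_def)
    next
      case 2
      then show ?thesis using uv by (intro image_eqI[of _ _ "(v, u)"]) (auto simp: hyperplane_def edge_pairs_def insert_commute)
    qed
  qed
  show "(hyperplane l ` edge_pairs E :: (nat \<Rightarrow> 'a) set set) \<subseteq> graphic_arrangement l E"
    unfolding graphic_arrangement_def hyperplane_def edge_pairs_def by auto blast
qed

text \<open>\<open>alpha\<close> is an arbitrary choice, so every defining form has to be pinned
  down. Unit vectors away from \<open>u\<close> and \<open>v\<close> make the other coefficients
  vanish, and the vector with entry 1 at both \<open>u\<close> and \<open>v\<close> makes the two
  remaining ones opposite.\<close>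

lemma defining_form_hyperplane:
  fixes c :: "nat \<Rightarrow> 'k::field"
  assumes uv: "(u, v) \<in> pairs l" and c: "is_defining_form l (hyperplane l (u, v)) c"
  shows "\<exists>k. k \<noteq> 0 \<and> c = (\<lambda>i. if i = v then k else if i = u then - k else 0)"
proof -
  have uv': "u \<in> {1..l}" "v \<in> {1..l}" "u < v" using uv by (auto simp: pairs_def)
  have H: "x u = x v \<longleftrightarrow> (\<Sum>i = 1..l. c i * x i) = 0" if "x \<in> space l" for x
    using c that unfolding is_defining_form_def hyperplane_def by auto
  have cw: "c w = 0" if "w \<noteq> u" "w \<noteq> v" for w
  proof (cases "w \<in> {1..l}")
    case True
    have "(\<lambda>i. if i = w then 1 else 0) \<in> space l" using True by (auto simp: space_def)
    from H[OF this] have "(\<Sum>i = 1..l. if i = w then c i else 0) = 0"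
      using that by (simp add: if_distrib cong: if_cong)
    then show ?thesis using True by simp
  next
    case False
    then show ?thesis using c by (simp add: is_defining_form_def space_def)
  qed
  have "(\<lambda>i. if i = u \<or> i = v then 1 else 0) \<in> space l" using uv' by (auto simp: space_def)
  from H[OF this] have "0 = (\<Sum>i = 1..l. c i * (if i = u \<or> i = v then 1 else 0))" by simp
  also have "\<dots> = (\<Sum>i\<in>{u, v}. c i)"
    using uv' by (intro sum.mono_neutral_cong_right) auto
  finally have "c u + c v = 0" using uv' by simp
  then have cu: "c u = - c v" by (simp add: add_eq_0_iff2)
  have "c v \<noteq> 0"
  proof
    assume "c v = 0"
    then have "c = 0" using cu cw by (auto simp: fun_eq_iff) metis
    then show False using c by (simp add: is_defining_form_def)
  qed
  moreover have "c = (\<lambda>i. if i = v then c v else if i = u then - c v else 0)"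
    using cu cw by auto
  ultimately show ?thesis by blast
qed

lemma alpha_hyperplane:
  assumes uv: "(u, v) \<in> pairs l"
  obtains k :: "'k::field" where "k \<noteq> 0" "alpha l (hyperplane l (u, v)) = (\<lambda>i. if i = v then k else if i = u then - k else 0)"
proof -
  let ?c = "\<lambda>i. if i = v then 1 else if i = u then - 1 else 0 :: 'k"
  have uv': "u \<in> {1..l}" "v \<in> {1..l}" "u \<noteq> v" using uv by (auto simp: pairs_def)
  have "(\<Sum>i = 1..l. ?c i * x i) = x v - x u" for x
  proof -
    have "(\<Sum>i = 1..l. ?c i * x i) = (\<Sum>i\<in>{u, v}. ?c i * x i)"
      using uv' by (intro sum.mono_neutral_right) auto
    then show ?thesis using uv' by simp
  qed
  then have "is_defining_form l (hyperplane l (u, v)) ?c"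
    using uv' unfolding is_defining_form_def hyperplane_def
    by (auto simp: space_def fun_eq_iff)
  then have "is_defining_form l (hyperplane l (u, v)) (alpha l (hyperplane l (u, v)) :: nat \<Rightarrow> 'k)"
    unfolding alpha_def by (rule someI[where P = "is_defining_form l (hyperplane l (u, v))"])
  from defining_form_hyperplane[OF uv this] show ?thesis using that by blast
qed

lemma form_poly_alpha:
  assumes uv: "(u, v) \<in> pairs l" and c: "c = (\<lambda>i. if i = v then k else if i = u then - k else 0)"
  shows "form_poly l c = const k * edge_form (u, v)"
proof -
  have uv': "u \<in> {1..l}" "v \<in> {1..l}" "u \<noteq> v" using uv by (auto simp: pairs_def)
  have "form_poly l c = (\<Sum>i\<in>{u, v}. const (c i) * var i)"
    using uv' unfolding form_poly_def c by (intro sum.mono_neutral_right) auto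
  then show ?thesis using uv' by (simp add: c edge_form_def algebra_simps)
qed

lemma inj_on_hyperplane: "inj_on (hyperplane l :: _ \<Rightarrow> (nat \<Rightarrow> 'k::field) set) (pairs l)"
proof (rule inj_onI)
  fix e e' assume e: "e \<in> pairs l" "e' \<in> pairs l" and eq: "hyperplane l e = (hyperplane l e' :: (nat \<Rightarrow> 'k) set)"
  obtain u v u' v' where uv: "e = (u, v)" "e' = (u', v')" by (cases e; cases e')
  \<comment> \<open>A unit vector fails the equation of the hyperplane exactly at the two indices
    occurring in it, so the hyperplane determines the edge.\<close>
  have *: "w \<in> {u, v} \<longleftrightarrow> w \<in> {u', v'}" if w: "w \<in> {1..l}" for w
  proof -
    let ?x = "(\<lambda>i. if i = w then 1 else 0) :: nat \<Rightarrow> 'k"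
    have "?x \<in> space l" using w by (auto simp: space_def)
    moreover have "?x \<in> hyperplane l e \<longleftrightarrow> ?x \<in> hyperplane l e'" using eq by simp
    ultimately show ?thesis using e unfolding uv hyperplane_def by (auto simp: pairs_def split: if_splits)
  qed
  from *[of u] *[of v] *[of u'] *[of v'] e show "e = e'" unfolding uv pairs_def by auto
qed

text \<open>Different edges give different hyperplanes, so the product over the arrangement becomes
  one over edges; the scalars left open by \<open>alpha\<close> collect in \<open>k\<close>.\<close>

lemma Q_graphic:
  assumes sg: "simple_graph {1..l} E"
  obtains k :: "'k::field" where "k \<noteq> 0" "Q l (graphic_arrangement l E) = const k * (\<Prod>e\<in>edge_pairs E. edge_form e)"
proof -
  have "\<forall>e\<in>pairs l. \<exists>k::'k. k \<noteq> 0 \<and> form_poly l (alpha l (hyperplane l e)) = const k * edge_form e"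
  proof
    fix e :: "nat \<times> nat" assume e: "e \<in> pairs l"
    obtain u v where uv: "e = (u, v)" by (cases e)
    obtain k :: 'k where k: "k \<noteq> 0" "alpha l (hyperplane l (u, v)) = (\<lambda>i. if i = v then k else if i = u then - k else 0)"
      by (rule alpha_hyperplane[OF e[unfolded uv]])
    then show "\<exists>k::'k. k \<noteq> 0 \<and> form_poly l (alpha l (hyperplane l e)) = const k * edge_form e"
      using form_poly_alpha[OF e[unfolded uv] k(2)] unfolding uv by blast
  qed
  then obtain k :: "nat \<times> nat \<Rightarrow> 'k" where k: "\<And>e. e \<in> pairs l \<Longrightarrow> k e \<noteq> 0 \<and> form_poly l (alpha l (hyperplane l e)) = const (k e) * edge_form e"
    by metis
  have sub: "edge_pairs E \<subseteq> pairs l" by (rule edge_pairs_subset[OF sg])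
  have fin: "finite (edge_pairs E)" using sub finite_pairs finite_subset by blast
  have prod_const: "(\<Prod>e\<in>A. const (k e)) = const (\<Prod>e\<in>A. k e)" for A
    by (induction A rule: infinite_finite_induct) auto
  have "Q l (graphic_arrangement l E) = (\<Prod>e\<in>edge_pairs E. form_poly l (alpha l (hyperplane l e)) :: 'k ratfun)"
    unfolding Q_def graphic_arrangement_image[OF sg]
    by (subst prod.reindex) (auto intro: inj_on_subset[OF inj_on_hyperplane sub])
  also have "\<dots> = (\<Prod>e\<in>edge_pairs E. const (k e) * edge_form e)"
    using k sub by (intro prod.cong) auto
  also have "\<dots> = const (\<Prod>e\<in>edge_pairs E. k e) * (\<Prod>e\<in>edge_pairs E. edge_form e)"
    by (simp add: prod.distrib prod_const)
  finally have eq: "Q l (graphic_arrangement l E) =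
      const (\<Prod>e\<in>edge_pairs E. k e) * (\<Prod>e\<in>edge_pairs E. edge_form e :: 'k ratfun)" .
  have "\<forall>e\<in>edge_pairs E. k e \<noteq> 0" using k sub by blast
  then have "(\<Prod>e\<in>edge_pairs E. k e) \<noteq> 0" using fin by simp
  with eq show ?thesis by (rule that[rotated])
qed

text \<open>With the form \<open>k * (dx_v - dx_u)\<close> the coefficients of the wedge are
  \<open>k * (W u + W v)\<close> at the pair \<open>(u, v)\<close>, \<open>k * W i\<close> up to
  sign at pairs consisting of one of \<open>u\<close>, \<open>v\<close> and another index
  \<open>i\<close>, and zero elsewhere.\<close>

lemma wedge_divisible_iff:
  fixes W :: "'k::field form1"
  assumes uv: "(u, v) \<in> pairs l" and W: "\<And>i. i \<notin> {1..l} \<Longrightarrow> W i = 0"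
    and k: "k \<noteq> 0" and c: "c = (\<lambda>i. if i = v then k else if i = u then - k else 0)"
  shows "wedge W (d_form c) \<in> fmult (const k * edge_form (u, v)) ` Omega2_V l \<longleftrightarrow>
    (\<forall>i. i \<noteq> u \<longrightarrow> i \<noteq> v \<longrightarrow> (\<exists>g\<in>poly_ring l. W i = edge_form (u, v) * g)) \<and>
    (\<exists>g\<in>poly_ring l. W u + W v = edge_form (u, v) * g)"
    (is "?L \<longleftrightarrow> ?R")
proof
  have uv': "u \<in> {1..l}" "v \<in> {1..l}" "u < v" using uv by (auto simp: pairs_def)
  have ck: "const k \<noteq> (0 :: 'k ratfun)" using k by simp
  let ?\<delta> = "edge_form (u, v) :: 'k ratfun"
  have \<delta>: "?\<delta> \<noteq> 0" by (rule edge_form_nonzero[OF uv])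
  {
    assume ?L
    then obtain \<eta> where \<eta>: "\<eta> \<in> Omega2_V l" "wedge W (d_form c) = fmult (const k * ?\<delta>) \<eta>" by blast
    have \<eta>P: "\<eta> p \<in> poly_ring l" for p using \<eta>(1) by (cases p) (auto simp: Omega2_V_def)
    have w: "W i * const (c j) - W j * const (c i) = const k * ?\<delta> * \<eta> (i, j)" if "i < j" for i j
      using fun_cong[OF \<eta>(2), of "(i, j)"] that by (simp add: wedge_def fmult_def d_form_def)
    have "\<exists>g\<in>poly_ring l. W i = ?\<delta> * g" if i: "i \<noteq> u" "i \<noteq> v" for i
    proof (cases "i < v")
      case True
      have "const k * W i = const k * (?\<delta> * \<eta> (i, v))" using w[OF True] i by (simp add: c mult_ac)
      then have "W i = ?\<delta> * \<eta> (i, v)" using ck by simp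
      then show ?thesis using \<eta>P by blast
    next
      case False
      then have "v < i" using i by simp
      have "const k * W i = const k * (?\<delta> * (- \<eta> (v, i)))" using w[OF \<open>v < i\<close>] i by (simp add: c mult_ac minus_equation_iff) (metis minus_minus)
      then have "W i = ?\<delta> * (- \<eta> (v, i))" using ck by (metis mult_left_cancel)
      then show ?thesis using \<eta>P poly_ring_uminus by blast
    qed
    moreover have "const k * (W u + W v) = const k * (?\<delta> * \<eta> (u, v))"
      using w[OF uv'(3)] uv'(3) by (simp add: c algebra_simps)
    then have "W u + W v = ?\<delta> * \<eta> (u, v)" using ck by simp
    ultimately show ?R using \<eta>P by blast
  }
  {
    assume R: ?R
    then obtain g where g: "\<And>i. i \<noteq> u \<Longrightarrow> i \<noteq> v \<Longrightarrow> g i \<in> poly_ring l \<and> W i = ?\<delta> * g i" by metis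
    obtain g0 where g0: "g0 \<in> poly_ring l" "W u + W v = ?\<delta> * g0" using R by blast
    define \<eta> where "\<eta> p = wedge W (d_form c) p / (const k * ?\<delta>)" for p
    have eq: "wedge W (d_form c) = fmult (const k * ?\<delta>) \<eta>"
      using ck \<delta> by (auto simp: \<eta>_def fmult_def)
    have P0: "0 \<in> poly_ring l" by (rule zero_poly_ring)
    have \<eta>P: "\<eta> (i, j) \<in> poly_ring l" for i j
    proof (cases "i < j")
      case ij: True
      have \<eta>: "\<eta> (i, j) = (W i * const (c j) - W j * const (c i)) / (const k * ?\<delta>)"
        using ij by (simp add: \<eta>_def wedge_def d_form_def)
      consider "i = u" "j = v" | "j = v" "i \<noteq> u" | "j = u" "i \<noteq> v" | "i = u" "j \<noteq> v" | "i = v" "j \<noteq> u"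
        | "i \<notin> {u, v}" "j \<notin> {u, v}" using ij uv'(3) by fastforce
      then show ?thesis
      proof cases
        case 1
        have "W i * const (c j) - W j * const (c i) = const k * (W u + W v)" using 1 uv'(3) by (simp add: c algebra_simps)
        then have "\<eta> (i, j) = g0" unfolding \<eta> g0 using ck \<delta> by simp
        then show ?thesis using g0 by simp
      next
        case 2
        then have "W i * const (c j) - W j * const (c i) = const k * (?\<delta> * g i)" using ij g[of i] by (simp add: c)
        then have "\<eta> (i, j) = g i" unfolding \<eta> using ck \<delta> by simp
        then show ?thesis using g[of i] 2 ij by simp
      next
        case 3
        then have "W i * const (c j) - W j * const (c i) = - (const k * (?\<delta> * g i))" using ij g[of i] uv'(3) by (simp add: c)
        then have "\<eta> (i, j) = - g i" unfolding \<eta> using ck \<delta> by simp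
        then show ?thesis using g[of i] 3 ij by (simp add: poly_ring_uminus)
      next
        case 4
        then have "W i * const (c j) - W j * const (c i) = const k * (?\<delta> * g j)" using ij g[of j] uv'(3) by (simp add: c)
        then have "\<eta> (i, j) = g j" unfolding \<eta> using ck \<delta> by simp
        then show ?thesis using g[of j] 4 ij by simp
      next
        case 5
        then have "W i * const (c j) - W j * const (c i) = - (const k * (?\<delta> * g j))" using ij g[of j] uv'(3) by (simp add: c)
        then have "\<eta> (i, j) = - g j" unfolding \<eta> using ck \<delta> by simp
        then show ?thesis using g[of j] 5 ij by (simp add: poly_ring_uminus)
      next
        case 6
        then have "\<eta> (i, j) = 0" unfolding \<eta> by (simp add: c)
        then show ?thesis using P0 by simp
      qed
    next
      case False
      then show ?thesis using P0 by (simp add: \<eta>_def wedge_def)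
    qed
    have "\<eta> (i, j) = 0" if "\<not> (1 \<le> i \<and> i < j \<and> j \<le> l)" for i j
    proof (cases "i < j")
      case True
      then have "i \<notin> {1..l} \<or> j \<notin> {1..l}" using that by auto
      then have "(W i = 0 \<and> c i = 0) \<or> (W j = 0 \<and> c j = 0)" using W uv' unfolding c by fastforce
      then show ?thesis by (auto simp: \<eta>_def wedge_def d_form_def)
    qed (simp add: \<eta>_def wedge_def)
    then have "\<eta> \<in> Omega2_V l" using \<eta>P by (simp add: Omega2_V_def)
    then show ?L unfolding eq by blast
  }
qed

text \<open>The membership criterion used from here on: along \<open>x_u = x_v\<close> only the
  components \<open>u\<close> and \<open>v\<close> may have a pole, at most a simple one, and in
  their sum it cancels.\<close>

theorem Omega1_graphic_iff:
  fixes \<omega> :: "'k::field form1"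
  assumes sg: "simple_graph {1..l} E"
  shows "\<omega> \<in> Omega1 l (graphic_arrangement l E) \<longleftrightarrow>
    (\<forall>i. i \<notin> {1..l} \<longrightarrow> \<omega> i = 0) \<and> (\<forall>i. \<omega> i \<in> poles l (edge_pairs E)) \<and>
    (\<forall>u v. (u, v) \<in> edge_pairs E \<longrightarrow>
      (\<forall>i. i \<noteq> u \<longrightarrow> i \<noteq> v \<longrightarrow> \<omega> i \<in> poles l (edge_pairs E - {(u, v)})) \<and>
      \<omega> u + \<omega> v \<in> poles l (edge_pairs E - {(u, v)}))"
proof -
  let ?S = "edge_pairs E"
  let ?A = "graphic_arrangement l E :: (nat \<Rightarrow> 'k) set set"
  let ?q = "\<Prod>e\<in>?S. edge_form e :: 'k ratfun"
  have sub: "?S \<subseteq> pairs l" by (rule edge_pairs_subset[OF sg])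
  have fin: "finite ?S" using sub finite_pairs finite_subset by blast
  obtain k :: 'k where k: "k \<noteq> 0" "Q l ?A = const k * ?q" by (rule Q_graphic[OF sg])
  have q0: "?q \<noteq> 0" by (rule edge_forms_nonzero[OF sub])
  have Q0: "Q l ?A \<noteq> 0" using k q0 by simp
  have unit: "const k * f \<in> poly_ring l \<longleftrightarrow> f \<in> poly_ring l" for f :: "'k ratfun"
  proof
    assume "const k * f \<in> poly_ring l"
    then have "const (inverse k) * (const k * f) \<in> poly_ring l" by (rule poly_ring_closed(2)[OF const_poly_ring])
    moreover have "const (inverse k) * const k = (1 :: 'k ratfun)"
      by (simp only: const_hom(2)[symmetric] left_inverse[OF k(1)] const_hom(4))
    ultimately show "f \<in> poly_ring l" by (metis mult.assoc mult_1)
  qed (rule poly_ring_closed(2)[OF const_poly_ring])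
  have QP: "Q l ?A * f \<in> poly_ring l \<longleftrightarrow> f \<in> poles l ?S" for f
    unfolding k poles_def mult.assoc unit by (simp add: mult.commute)
  have div: "(\<exists>g\<in>poly_ring l. Q l ?A * f = edge_form (u, v) * g) \<longleftrightarrow> f \<in> poles l (?S - {(u, v)})"
    if e: "(u, v) \<in> ?S" for f u v
  proof -
    have \<delta>: "edge_form (u, v) \<noteq> (0 :: 'k ratfun)" using e sub edge_form_nonzero by blast
    have "?q = edge_form (u, v) * (\<Prod>e\<in>?S - {(u, v)}. edge_form e)" by (rule prod.remove[OF fin e])
    then have "Q l ?A * f = edge_form (u, v) * (const k * (f * (\<Prod>e\<in>?S - {(u, v)}. edge_form e)))"
      unfolding k by (simp add: mult_ac)
    then have "(\<exists>g\<in>poly_ring l. Q l ?A * f = edge_form (u, v) * g) \<longleftrightarrow>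
        const k * (f * (\<Prod>e\<in>?S - {(u, v)}. edge_form e)) \<in> poly_ring l"
      using \<delta> by (auto simp: mult_ac)
    then show ?thesis unfolding unit by (simp add: poles_def)
  qed
  have 1: "\<omega> \<in> fmult (1 / Q l ?A) ` Omega1_V l \<longleftrightarrow> (\<forall>i. i \<notin> {1..l} \<longrightarrow> \<omega> i = 0) \<and> (\<forall>i. \<omega> i \<in> poles l ?S)"
  proof -
    have "\<omega> \<in> fmult (1 / Q l ?A) ` Omega1_V l \<longleftrightarrow> fmult (Q l ?A) \<omega> \<in> Omega1_V l"
    proof
      assume "\<omega> \<in> fmult (1 / Q l ?A) ` Omega1_V l"
      then obtain \<theta> where \<theta>: "\<theta> \<in> Omega1_V l" "\<omega> = fmult (1 / Q l ?A) \<theta>" by blast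
      moreover have "fmult (Q l ?A) \<omega> = \<theta>" unfolding \<theta>(2) using Q0 by (simp add: fmult_def)
      ultimately show "fmult (Q l ?A) \<omega> \<in> Omega1_V l" by simp
    next
      assume "fmult (Q l ?A) \<omega> \<in> Omega1_V l"
      moreover have "\<omega> = fmult (1 / Q l ?A) (fmult (Q l ?A) \<omega>)" using Q0 by (simp add: fmult_def)
      ultimately show "\<omega> \<in> fmult (1 / Q l ?A) ` Omega1_V l" by blast
    qed
    also have "\<dots> \<longleftrightarrow> (\<forall>i. i \<notin> {1..l} \<longrightarrow> \<omega> i = 0) \<and> (\<forall>i. \<omega> i \<in> poles l ?S)"
      using QP Q0 by (auto simp: Omega1_V_def fmult_def)
    finally show ?thesis .
  qed
  have 2: "wedge (fmult (Q l ?A) \<omega>) (d_form (alpha l (hyperplane l (u, v)))) \<in>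
      fmult (form_poly l (alpha l (hyperplane l (u, v)))) ` Omega2_V l \<longleftrightarrow>
      (\<forall>i. i \<noteq> u \<longrightarrow> i \<noteq> v \<longrightarrow> \<omega> i \<in> poles l (?S - {(u, v)})) \<and> \<omega> u + \<omega> v \<in> poles l (?S - {(u, v)})"
    if e: "(u, v) \<in> ?S" and z: "\<forall>i. i \<notin> {1..l} \<longrightarrow> \<omega> i = 0" for u v
  proof -
    have uv: "(u, v) \<in> pairs l" using e sub by blast
    obtain k' :: 'k where k': "k' \<noteq> 0" "alpha l (hyperplane l (u, v)) = (\<lambda>i. if i = v then k' else if i = u then - k' else 0)"
      by (rule alpha_hyperplane[OF uv])
    show ?thesis
      unfolding form_poly_alpha[OF uv k'(2)]
      by (subst wedge_divisible_iff[OF uv _ k']) (auto simp: z fmult_def div[OF e] simp flip: distrib_left)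
  qed
  show ?thesis
    unfolding Omega1_def mem_Collect_eq 1
    unfolding graphic_arrangement_image[OF sg] using 2[unfolded graphic_arrangement_image[OF sg]]
    by (auto simp: split_paired_all)
qed

section \<open>A monomial spanning set for the logarithmic forms\<close>

lemma edge_commute: "edge u v = edge v u"
  by (simp add: edge_def min.commute max.commute)

lemma edge_eq_iff: "edge u v = edge u' v' \<longleftrightarrow> {u, v} = {u', v'}"
  by (auto simp: edge_def min_def max_def doubleton_eq_iff split: if_splits)

lemma edge_pair: "u < v \<Longrightarrow> edge u v = (u, v)"
  by (simp add: edge_def)

lemma edge_in_edge_pairs: "edge u v \<in> edge_pairs E \<longleftrightarrow> u \<noteq> v \<and> {u, v} \<in> E"
  by (cases u v rule: linorder_cases) (auto simp: edge_def edge_pairs_def insert_commute)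

text \<open>The components at which a monomial is nonzero. Inverting \<open>y_j\<close> kills
  component \<open>j\<close>, since \<open>y_j\<close> vanishes there; therefore indices with
  \<open>l + j \<in> F\<close> are left out.\<close>

definition negs :: "nat \<Rightarrow> nat set \<Rightarrow> (nat \<Rightarrow> int) \<Rightarrow> nat set" where
  "negs l F m = {j \<in> {1..l}. l + j \<notin> F \<and> m (l + j) = -1}"

text \<open>With \<open>z\<close> acting on \<open>dx_i\<close> as \<open>x_i\<close> and \<open>y_j = x_j - z\<close>, the form \<open>log_monom l F m\<close> is the Laurent
  monomial in \<open>z\<close> (exponent \<open>m 0\<close>) and the \<open>y_j\<close> (exponent \<open>m (l + j)\<close>), where \<open>dx_i\<close> stands for \<open>1 / y_i\<close>
  modulo polynomials; the \<open>y_j\<close> with \<open>l + j \<in> F\<close> are inverted.\<close>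

definition allowed :: "nat \<Rightarrow> nat set set \<Rightarrow> nat set \<Rightarrow> (nat \<Rightarrow> int) \<Rightarrow> bool" where
  "allowed l E F m \<longleftrightarrow> (\<forall>u. u \<notin> yz l \<longrightarrow> m u = 0) \<and> (0 \<notin> F \<longrightarrow> 0 \<le> m 0) \<and>
     (\<forall>j\<in>{1..l}. l + j \<notin> F \<longrightarrow> -1 \<le> m (l + j)) \<and>
     negs l F m \<noteq> {} \<and> negs l F m \<in> clique_complex {1..l} E"

definition log_monom :: "nat \<Rightarrow> nat set \<Rightarrow> (nat \<Rightarrow> int) \<Rightarrow> 'k::field form1" where
  "log_monom l F m i = (if i \<in> negs l F m then laurent_monom l i m else 0)"

global_interpretation fm: vector_space "\<lambda>(a::'k::field) (\<omega>::'k form1). fmult (const a) \<omega>"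
  by unfold_locales (auto simp: fmult_def fun_eq_iff algebra_simps)

lemma subspace_Omega1:
  assumes sg: "simple_graph {1..l} E"
  shows "fm.subspace (Omega1 l (graphic_arrangement l E) :: 'k::field form1 set)"
proof (rule fm.subspaceI)
  show "0 \<in> Omega1 l (graphic_arrangement l E)"
    unfolding Omega1_graphic_iff[OF sg] by (simp add: poles_zero)
next
  fix x y :: "'k form1" assume "x \<in> Omega1 l (graphic_arrangement l E)" "y \<in> Omega1 l (graphic_arrangement l E)"
  note xy = this[unfolded Omega1_graphic_iff[OF sg]]
  have "x u + y u + (x v + y v) \<in> poles l S" if "x u + x v \<in> poles l S" "y u + y v \<in> poles l S" for u v S
    using poles_add[OF that] by (simp add: algebra_simps)
  then show "x + y \<in> Omega1 l (graphic_arrangement l E)"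
    unfolding Omega1_graphic_iff[OF sg] using xy by (simp add: poles_add)
next
  fix c and x :: "'k form1" assume "x \<in> Omega1 l (graphic_arrangement l E)"
  note x = this[unfolded Omega1_graphic_iff[OF sg]]
  have "const c * x u + const c * x v \<in> poles l S" if "x u + x v \<in> poles l S" for u v S
    using poles_mult[OF const_poly_ring that, of c] by (simp add: algebra_simps)
  then show "fmult (const c) x \<in> Omega1 l (graphic_arrangement l E)"
    unfolding Omega1_graphic_iff[OF sg] using x by (simp add: fmult_def poles_mult const_poly_ring)
qed

text \<open>Component \<open>i\<close> has poles only along the edges from \<open>i\<close> to the
  rest of the clique. For an edge inside the clique, the two components have numerators and
  remaining denominators that agree on \<open>x_u = x_v\<close>, while the factors
  \<open>x_v - x_u\<close> and \<open>x_u - x_v\<close> have opposite signs; hence the pole cancels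
  in the sum.\<close>

lemma log_monom_mem:
  assumes sg: "simple_graph {1..l} E" and m: "allowed l E {} m"
  shows "log_monom l {} m \<in> (Omega1 l (graphic_arrangement l E) :: 'k::field form1 set)"
proof -
  define \<sigma> where "\<sigma> = negs l {} m"
  let ?S = "edge_pairs E"
  have \<sigma>: "\<sigma> \<subseteq> {1..l}" "finite \<sigma>" "\<And>j. j \<in> \<sigma> \<Longrightarrow> m (l + j) = -1" by (auto simp: \<sigma>_def negs_def)
  have clique: "{u, v} \<in> E" if "u \<in> \<sigma>" "v \<in> \<sigma>" "u \<noteq> v" for u v
    using m that by (auto simp: allowed_def clique_complex_def \<sigma>_def)
  have m0: "0 \<le> m 0" using m by (simp add: allowed_def)
  have mj: "0 \<le> m (l + j)" if "j \<in> {1..l} - \<sigma>" for j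
  proof -
    have "-1 \<le> m (l + j)" using m that by (auto simp: allowed_def)
    moreover have "m (l + j) \<noteq> -1" using that by (auto simp: \<sigma>_def negs_def)
    ultimately show ?thesis by simp
  qed
  have sub: "?S \<subseteq> pairs l" by (rule edge_pairs_subset[OF sg])
  \<comment> \<open>What is left of component \<open>i\<close> once the denominators from the other
    members of the clique are cleared.\<close>
  define num :: "nat \<Rightarrow> 'k ratfun" where "num i = var i ^ nat (m 0) * (\<Prod>j\<in>{1..l} - \<sigma>. (var j - var i) ^ nat (m (l + j)))" for i
  have numP: "num i \<in> poly_ring l" if "i \<in> {1..l}" for i
    unfolding num_def using that
    by (intro poly_ring_closed(2) poly_ring_power poly_ring_prod poly_ring_closed(3) var_poly_ring) auto
  have den: "laurent_monom l i m * (\<Prod>j\<in>\<sigma> - {i}. var j - var i) = num i" if i: "i \<in> \<sigma>" for i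
  proof -
    have eq: "{1..l} - {i} = ({1..l} - \<sigma>) \<union> (\<sigma> - {i})" using \<sigma> i by auto
    have "(\<Prod>j\<in>{1..l} - {i}. (var j - var i :: 'k ratfun) powi m (l + j)) =
        (\<Prod>j\<in>{1..l} - \<sigma>. (var j - var i) powi m (l + j)) * (\<Prod>j\<in>\<sigma> - {i}. (var j - var i) powi m (l + j))"
      unfolding eq using \<sigma> by (intro prod.union_disjoint) auto
    also have "(\<Prod>j\<in>{1..l} - \<sigma>. (var j - var i :: 'k ratfun) powi m (l + j)) = (\<Prod>j\<in>{1..l} - \<sigma>. (var j - var i) ^ nat (m (l + j)))"
      using mj by (intro prod.cong) (auto simp: power_int_def)
    also have "(\<Prod>j\<in>\<sigma> - {i}. (var j - var i :: 'k ratfun) powi m (l + j)) = inverse (\<Prod>j\<in>\<sigma> - {i}. (var j - var i))"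
      unfolding prod_inversef[symmetric] comp_def using \<sigma> by (intro prod.cong) (auto simp: power_int_minus)
    finally have *: "(\<Prod>j\<in>{1..l} - {i}. (var j - var i :: 'k ratfun) powi m (l + j)) =
       (\<Prod>j\<in>{1..l} - \<sigma>. (var j - var i) ^ nat (m (l + j))) * inverse (\<Prod>j\<in>\<sigma> - {i}. (var j - var i))" .
    have "(\<Prod>j\<in>\<sigma> - {i}. (var j - var i :: 'k ratfun)) \<noteq> 0" using \<sigma> by (auto simp: var_inj)
    then show ?thesis unfolding laurent_monom_def * num_def using m0 by (simp add: power_int_def)
  qed
  have star: "laurent_monom l i m \<in> (poles l (edge i ` (\<sigma> - {i})) :: 'k ratfun set)" if "i \<in> \<sigma>" for i
    using that \<sigma> by (subst poles_neighbours) (auto simp: den numP)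
  have starE: "edge i ` (\<sigma> - {i}) \<subseteq> ?S" if "i \<in> \<sigma>" for i
    using clique[OF that] by (auto simp: edge_in_edge_pairs image_subset_iff)
  have comp: "log_monom l {} m i \<in> (poles l T :: 'k ratfun set)" if "T \<subseteq> ?S" "i \<in> \<sigma> \<Longrightarrow> edge i ` (\<sigma> - {i}) \<subseteq> T" for i T
  proof (cases "i \<in> \<sigma>")
    case True
    then show ?thesis using poles_mono[OF that(2)[OF True] _ star[OF True]] that(1) sub
      by (simp add: log_monom_def \<sigma>_def[symmetric])
  qed (simp add: log_monom_def \<sigma>_def[symmetric] poles_zero)
  show ?thesis
    unfolding Omega1_graphic_iff[OF sg]
  proof (intro conjI allI impI)
    show "log_monom l {} m i = (0 :: 'k ratfun)" if "i \<notin> {1..l}" for i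
      using that \<sigma> by (auto simp: log_monom_def \<sigma>_def[symmetric])
    show "log_monom l {} m i \<in> (poles l ?S :: 'k ratfun set)" for i by (rule comp) (use starE in auto)
  next
    fix u v i assume uv: "(u, v) \<in> ?S" and i: "i \<noteq> u" "i \<noteq> v"
    have "u < v" using uv by (simp add: edge_pairs_def)
    then have "(u, v) \<notin> edge i ` (\<sigma> - {i})"
      using i by (auto simp: edge_eq_iff doubleton_eq_iff edge_pair[symmetric])
    then show "log_monom l {} m i \<in> (poles l (?S - {(u, v)}) :: 'k ratfun set)"
      by (intro comp) (use starE in auto)
  next
    fix u v assume uv: "(u, v) \<in> ?S"
    have less: "u < v" using uv by (simp add: edge_pairs_def)
    show "log_monom l {} m u + log_monom l {} m v \<in> (poles l (?S - {(u, v)}) :: 'k ratfun set)"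
    proof (cases "u \<in> \<sigma> \<and> v \<in> \<sigma>")
      case False
      have "(u, v) \<notin> edge u ` (\<sigma> - {u})" if "u \<in> \<sigma>"
        using False that less by (auto simp: edge_eq_iff doubleton_eq_iff edge_pair[symmetric])
      moreover have "(u, v) \<notin> edge v ` (\<sigma> - {v})" if "v \<in> \<sigma>"
        using False that less by (auto simp: edge_eq_iff doubleton_eq_iff edge_pair[symmetric])
      ultimately show ?thesis by (intro poles_add comp; use starE in blast)
    next
      case True
      define \<tau> where "\<tau> = \<sigma> - {u, v}"
      define a where "a = (\<Prod>j\<in>\<tau>. var j - var u :: 'k ratfun)"
      define b where "b = (\<Prod>j\<in>\<tau>. var j - var v :: 'k ratfun)"
      have uvl: "u \<in> {1..l}" "v \<in> {1..l}" using True \<sigma> by auto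
      have \<tau>: "finite \<tau>" "\<tau> \<subseteq> {1..l}" "u \<notin> \<tau>" "v \<notin> \<tau>" using \<sigma> by (auto simp: \<tau>_def)
      have \<sigma>u: "\<sigma> - {u} = insert v \<tau>" "\<sigma> - {v} = insert u \<tau>" using True less by (auto simp: \<tau>_def)
      have Lu: "laurent_monom l u m * ((var v - var u) * a) = num u"
        using den[of u] True \<tau> unfolding \<sigma>u a_def by simp
      have Lv: "laurent_monom l v m * ((var u - var v) * b) = num v"
        using den[of v] True \<tau> unfolding \<sigma>u b_def by simp
      have aP: "a \<in> poly_ring l" and bP: "b \<in> poly_ring l"
        unfolding a_def b_def using uvl \<tau> by (auto intro!: poly_ring_prod poly_ring_closed(3) var_poly_ring)
      \<comment> \<open>Numerator of the sum of the components \<open>u\<close> and \<open>v\<close>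
        over \<open>(x_v - x_u) * a * b\<close>. On \<open>x_u = x_v\<close> its two terms
        coincide.\<close>
      define h where "h = num u * b - num v * a"
      have hP: "h \<in> poly_ring l" unfolding h_def using aP bP uvl by (intro poly_ring_closed numP)
      have id: "subst (identify u v) (var j - var i) = identify u v j - (identify u v i :: 'k ratfun)" for i j
        by (simp add: subst_diff var_polys)
      have iv: "identify u v v = (var u :: 'k ratfun)" and ij: "j \<noteq> v \<Longrightarrow> identify u v j = (var j :: 'k ratfun)" for j
        by (auto simp: identify_def)
      have iuv: "identify u v i = (var u :: 'k ratfun)" if "i = u \<or> i = v" for i
        using that by (auto simp: identify_def)
      have snum: "subst (identify u v) (num i) = num u" if "i = u \<or> i = v" for i
      proof -
        have "subst (identify u v) (num i) = var u ^ nat (m 0) * (\<Prod>j\<in>{1..l} - \<sigma>. (identify u v j - var u) ^ nat (m (l + j)))"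
          unfolding num_def
          by (subst subst_mult) (simp_all add: subst_power subst_prod polys_power polys_prod polys_ring var_polys id iuv[OF that])
        also have "(\<Prod>j\<in>{1..l} - \<sigma>. (identify u v j - var u) ^ nat (m (l + j))) =
            (\<Prod>j\<in>{1..l} - \<sigma>. (var j - var u :: 'k ratfun) ^ nat (m (l + j)))"
        proof (intro prod.cong refl)
          fix j assume "j \<in> {1..l} - \<sigma>"
          then have "j \<noteq> v" using True by blast
          then show "(identify u v j - var u) ^ nat (m (l + j)) = (var j - var u :: 'k ratfun) ^ nat (m (l + j))"
            by (simp add: ij)
        qed
        finally show ?thesis by (simp add: num_def)
      qed
      have sa: "subst (identify u v) a = a"
        unfolding a_def
      proof (subst subst_prod)
        show "(\<Prod>j\<in>\<tau>. subst (identify u v) (var j - var u)) = (\<Prod>j\<in>\<tau>. var j - var u :: 'k ratfun)"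
        proof (intro prod.cong refl)
          fix j assume "j \<in> \<tau>"
          then have "j \<noteq> v" using \<tau> by blast
          then show "subst (identify u v) (var j - var u) = (var j - var u :: 'k ratfun)" by (simp add: id ij iuv)
        qed
      qed (intro polys_ring var_polys)
      have sb: "subst (identify u v) b = a"
        unfolding a_def b_def
      proof (subst subst_prod)
        show "(\<Prod>j\<in>\<tau>. subst (identify u v) (var j - var v)) = (\<Prod>j\<in>\<tau>. var j - var u :: 'k ratfun)"
        proof (intro prod.cong refl)
          fix j assume "j \<in> \<tau>"
          then have "j \<noteq> v" using \<tau> by blast
          then show "subst (identify u v) (var j - var v) = (var j - var u :: 'k ratfun)" by (simp add: id ij iuv)
        qed
      qed (intro polys_ring var_polys)
      have "subst (identify u v) h = 0"
        unfolding h_def using aP bP numP[OF uvl(1)] numP[OF uvl(2)]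
        by (simp add: subst_diff subst_mult poly_ring_polys poly_ring_closed polys_ring snum sa sb)
      then obtain g where g: "g \<in> poly_ring l" "h = (var v - var u) * g"
        using subst_identify_eq_0[OF hP uvl] by blast
      let ?s = "laurent_monom l u m + laurent_monom l v m :: 'k ratfun"
      have "(var v - var u) * (?s * (a * b)) = h"
        unfolding h_def Lu[symmetric] Lv[symmetric] by (simp add: algebra_simps)
      then have sab: "?s * (a * b) = g" unfolding g(2) using less by (simp add: var_inj)
      let ?T = "edge u ` \<tau> \<union> edge v ` \<tau>"
      have dis: "edge u ` \<tau> \<inter> edge v ` \<tau> = {}"
        using \<tau> less by (auto simp: edge_eq_iff doubleton_eq_iff)
      have TS: "?T \<subseteq> ?S - {(u, v)}"
        using clique True \<tau> less by (auto simp: edge_in_edge_pairs \<tau>_def edge_eq_iff doubleton_eq_iff edge_pair[symmetric])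
      have "(\<Prod>e\<in>?T. edge_form e :: 'k ratfun) = (\<Prod>e\<in>edge u ` \<tau>. edge_form e) * (\<Prod>e\<in>edge v ` \<tau>. edge_form e)"
        using \<tau> dis by (intro prod.union_disjoint) auto
      then have "(\<Prod>e\<in>?T. edge_form e) = a * b \<or> (\<Prod>e\<in>?T. edge_form e) = - (a * b)"
        using prod_neighbours_sign[OF \<tau>(1,3), where 'k = 'k] prod_neighbours_sign[OF \<tau>(1,4), where 'k = 'k]
        unfolding a_def b_def by auto
      then have "?s * (\<Prod>e\<in>?T. edge_form e) = g \<or> ?s * (\<Prod>e\<in>?T. edge_form e) = - g"
        unfolding sab[symmetric] by auto
      then have "?s \<in> poles l ?T" unfolding poles_def using g(1) poly_ring_uminus[OF g(1)] by auto
      then have "?s \<in> poles l (?S - {(u, v)})" by (rule poles_mono[OF TS, rotated]) (use sub in auto)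
      then show ?thesis using True by (simp add: log_monom_def \<sigma>_def[symmetric])
    qed
  qed
qed

text \<open>If the component at the other end of an edge is zero, the sum of the two components is
  \<open>\<omega> i\<close> alone, so the cancellation condition already forbids a pole there. Only
  the neighbours in \<open>N\<close> remain as possible poles.\<close>

lemma Omega1_component_poles:
  fixes \<omega> :: "'k::field form1"
  assumes sg: "simple_graph {1..l} E" and \<omega>: "\<omega> \<in> Omega1 l (graphic_arrangement l E)"
    and N: "\<And>j. edge i j \<in> edge_pairs E \<Longrightarrow> j \<in> N \<or> \<omega> j = 0" "\<And>j. j \<in> N \<Longrightarrow> edge i j \<in> edge_pairs E"
    and fin: "finite N"
  shows "\<omega> i * (\<Prod>j\<in>N. var j - var i) \<in> poly_ring l"
proof -
  let ?S = "edge_pairs E"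
  note om = \<omega>[unfolded Omega1_graphic_iff[OF sg]]
  have sub: "?S \<subseteq> pairs l" by (rule edge_pairs_subset[OF sg])
  have iN: "i \<notin> N" using N(2)[of i] by (auto simp: edge_def edge_pairs_def)
  have "\<omega> i \<in> poles l (?S - (?S - edge i ` N))"
  proof (rule poles_Diff[OF sub])
    fix e assume e: "e \<in> ?S - edge i ` N"
    obtain u v where uv: "e = (u, v)" by (cases e)
    have less: "u < v" using e uv by (simp add: edge_pairs_def)
    have e': "e = edge u v" "e = edge v u" using less uv by (auto simp: edge_pair edge_commute[of v u])
    show "\<omega> i \<in> poles l (?S - {e})"
    proof (cases "i = u \<or> i = v")
      case False
      then show ?thesis using om e uv by blast
    next
      case True
      then obtain j where j: "e = edge i j" "\<omega> u + \<omega> v = \<omega> i + \<omega> j" using e' by (metis add.commute)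
      then have "j \<notin> N" using e by blast
      then have "\<omega> j = 0" using N(1)[of j] e j by blast
      moreover have "\<omega> u + \<omega> v \<in> poles l (?S - {e})" using om e uv by blast
      ultimately show ?thesis using j by simp
    qed
  qed (use om finite_subset[OF sub finite_pairs] in auto)
  moreover have "?S - (?S - edge i ` N) = edge i ` N" using N(2) by blast
  ultimately show ?thesis using poles_neighbours[OF fin iN, of "\<omega> i" l] by simp
qed

text \<open>Cancellation along \<open>x_j = x_n\<close> ties the numerator of component
  \<open>n\<close> to that of component \<open>j\<close>, up to the factors \<open>?A\<close> and
  \<open>?B\<close> of their other neighbours. On the locus \<open>x_j = x_k = x_n\<close> the
  factor \<open>?A\<close> vanishes, because \<open>k\<close> is a neighbour of \<open>n\<close>,
  and \<open>?B\<close> does not, because \<open>k\<close> is no neighbour of \<open>j\<close>; so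
  the numerator at \<open>n\<close> must vanish.\<close>

lemma Omega1_nonadjacent:
  fixes \<omega> :: "'k::field form1"
  assumes sg: "simple_graph {1..l} E" and \<omega>: "\<omega> \<in> Omega1 l (graphic_arrangement l E)"
    and top: "\<And>i. i > n \<Longrightarrow> \<omega> i = 0"
    and N: "N = {j. j < n \<and> edge n j \<in> edge_pairs E}"
    and jk: "j \<in> N" "k \<in> N" "j \<noteq> k" "edge j k \<notin> edge_pairs E"
  shows "subst (\<lambda>i. if i = j \<or> i = k then var n else var i) (\<omega> n * (\<Prod>j\<in>N. var j - var n)) = 0"
proof -
  let ?S = "edge_pairs E"
  define \<theta> :: "nat \<Rightarrow> 'k ratfun" where "\<theta> = (\<lambda>i. if i = j \<or> i = k then var n else var i)"
  note om = \<omega>[unfolded Omega1_graphic_iff[OF sg]]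
  have sub: "?S \<subseteq> pairs l" by (rule edge_pairs_subset[OF sg])
  define nb where "nb i = {j. edge i j \<in> ?S}" for i
  have nb: "nb i \<subseteq> {1..l}" "i \<notin> nb i" for i
  proof -
    have "j \<in> {1..l} \<and> j \<noteq> i" if "edge i j \<in> pairs l" for j
      using that by (auto simp: edge_def pairs_def min_def max_def split: if_splits)
    then show "nb i \<subseteq> {1..l}" "i \<notin> nb i" using sub unfolding nb_def by blast+
  qed
  have finnb: "finite (nb i)" for i using nb finite_subset by blast
  have comp: "\<omega> i * (\<Prod>j\<in>nb i. var j - var i) \<in> poly_ring l" for i
    by (rule Omega1_component_poles[OF sg \<omega>]) (auto simp: nb_def finnb[unfolded nb_def])
  have finN: "finite N" using N by simp
  have f: "\<omega> n * (\<Prod>j\<in>N. var j - var n) \<in> poly_ring l"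
  proof (rule Omega1_component_poles[OF sg \<omega> _ _ finN])
    fix j assume "edge n j \<in> ?S"
    moreover have "j \<noteq> n" using \<open>edge n j \<in> ?S\<close> by (auto simp: edge_in_edge_pairs)
    ultimately show "j \<in> N \<or> \<omega> j = 0" using N top by (cases "j < n") auto
  qed (use N in auto)
  have jn: "j < n" "k < n" "j \<in> nb n" "k \<in> nb n" "n \<in> nb j" "k \<notin> nb j"
    using jk N by (auto simp: nb_def edge_commute[of j n])
  have l: "j \<in> {1..l}" "n \<in> {1..l}" using nb jn by blast+
  let ?A = "\<Prod>i\<in>nb n - {j}. var i - var n :: 'k ratfun"
  let ?B = "\<Prod>i\<in>nb j - {n}. var i - var j :: 'k ratfun"
  let ?f = "\<omega> n * (\<Prod>i\<in>nb n. var i - var n)"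
  let ?fj = "\<omega> j * (\<Prod>i\<in>nb j. var i - var j)"
  have A: "(\<Prod>i\<in>nb n. var i - var n) = (var j - var n) * ?A" by (rule prod.remove[OF finnb jn(3)])
  have B: "(\<Prod>i\<in>nb j. var i - var j) = (var n - var j) * ?B" by (rule prod.remove[OF finnb jn(5)])
  have AP: "?A \<in> poly_ring l" and BP: "?B \<in> poly_ring l"
    by (intro poly_ring_prod poly_ring_closed(3) var_poly_ring; use nb(1)[of n] nb(1)[of j] l in blast)+
  define s where "s = ?B * ?f - ?A * ?fj"
  have sP: "s \<in> poly_ring l" unfolding s_def by (intro poly_ring_closed(2,3) AP BP comp)
  \<comment> \<open>The factors \<open>x_j - x_n\<close> and \<open>x_n - x_j\<close> have opposite
    signs, so this difference contains the sum of the two components, which has no pole along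
    \<open>x_j = x_n\<close>.\<close>
  have s: "s = ?A * ?B * (var j - var n) * (\<omega> j + \<omega> n)"
    unfolding s_def A B by (simp add: algebra_simps)
  let ?q = "\<Prod>e\<in>?S - {(j, n)}. edge_form e :: 'k ratfun"
  have jnS: "(j, n) \<in> ?S" using jn by (simp add: nb_def edge_commute[of n j] edge_pair)
  have qP: "?q \<in> poly_ring l" using sub by (intro edge_forms_poly_ring) auto
  have gP: "(\<omega> j + \<omega> n) * ?q \<in> poly_ring l" using om jnS by (simp add: poles_def)
  let ?g = "?A * ?B * ((\<omega> j + \<omega> n) * ?q)"
  have gP': "?g \<in> poly_ring l" by (intro poly_ring_closed(2) AP BP gP)
  have sq: "s * ?q = (var j - var n) * ?g" unfolding s by (simp add: mult_ac)
  have "subst (identify j n) (s * ?q) = 0"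
    unfolding sq using gP' by (simp add: subst_mult subst_diff var_polys polys_ring poly_ring_polys identify_def)
  then have "subst (identify j n) s * subst (identify j n) ?q = 0"
    using sP qP by (simp add: subst_mult poly_ring_polys)
  moreover have "subst (identify j n) ?q \<noteq> 0"
    using sub jnS by (intro subst_identify_edge_forms[where l = l]) auto
  ultimately have "subst (identify j n) s = 0" by simp
  then obtain s' where s': "s' \<in> poly_ring l" "s = (var n - var j) * s'"
    using subst_identify_eq_0[OF sP l] by blast
  have "subst \<theta> s = 0"
    unfolding s'(2) using s'(1) jn by (simp add: subst_mult subst_diff var_polys polys_ring poly_ring_polys \<theta>_def)
  moreover have "subst \<theta> ?A = 0"
  proof -
    have "subst \<theta> ?A = (\<Prod>i\<in>nb n - {j}. subst \<theta> (var i - var n))"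
      by (intro subst_prod polys_ring var_polys)
    also have "\<dots> = 0"
      using finnb jn jk by (intro prod_zero bexI[of _ k]) (auto simp: subst_diff var_polys \<theta>_def)
    finally show ?thesis .
  qed
  ultimately have "subst \<theta> ?B * subst \<theta> ?f = 0"
    using subst_diff[of "?B * ?f" "?A * ?fj" \<theta>] AP BP comp[of n] comp[of j]
    by (simp add: s_def subst_mult poly_ring_polys poly_ring_closed polys_ring del: mult_eq_0_iff)
  moreover have "subst \<theta> ?B \<noteq> 0"
  proof -
    have "subst \<theta> ?B = (\<Prod>i\<in>nb j - {n}. subst \<theta> (var i - var j))"
      by (intro subst_prod polys_ring var_polys)
    moreover have "subst \<theta> (var i - var j) \<noteq> 0" if "i \<in> nb j - {n}" for i
      using that jn nb(2)[of j] by (auto simp: subst_diff var_polys \<theta>_def var_inj)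
    ultimately show ?thesis using finnb by simp
  qed
  ultimately have f0: "subst \<theta> ?f = 0" by simp
  have Nnb: "N \<subseteq> nb n" using N by (auto simp: nb_def)
  \<comment> \<open>The neighbours of \<open>n\<close> outside \<open>N\<close> contribute factors
    that stay nonzero under the substitution, so clearing only the denominators in \<open>N\<close>
    is enough.\<close>
  let ?C = "\<Prod>i\<in>nb n - N. var i - var n :: 'k ratfun"
  have "?f = ?C * (\<omega> n * (\<Prod>j\<in>N. var j - var n))"
    unfolding prod.subset_diff[OF Nnb finnb] by (simp add: mult_ac)
  moreover have CP: "?C \<in> polys" by (intro polys_prod polys_ring var_polys)
  ultimately have "subst \<theta> ?C * subst \<theta> (\<omega> n * (\<Prod>j\<in>N. var j - var n)) = 0"
    using f0 subst_mult[OF CP poly_ring_polys[OF f], of \<theta>] by metis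
  moreover have "subst \<theta> ?C \<noteq> 0"
  proof -
    have "subst \<theta> ?C = (\<Prod>i\<in>nb n - N. subst \<theta> (var i - var n))"
      by (intro subst_prod polys_ring var_polys)
    moreover have "subst \<theta> (var i - var n) \<noteq> 0" if "i \<in> nb n - N" for i
      using that jn nb(2)[of n] jk by (auto simp: subst_diff var_polys \<theta>_def var_inj)
    ultimately show ?thesis using finnb by simp
  qed
  ultimately show ?thesis by (simp add: \<theta>_def)
qed

text \<open>The numerator at the top index is expanded in monomials in \<open>z\<close> and the
  \<open>y_j\<close>. Monomials in which two nonadjacent \<open>j\<close>, \<open>k \<in> N\<close>
  both have exponent 0 are excluded by \<open>Omega1_nonadjacent\<close>; each remaining one,
  divided by \<open>D\<close>, is the component at \<open>n\<close> of a clique monomial without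
  components beyond \<open>n\<close>.\<close>

lemma Omega1_top_component:
  fixes \<omega> :: "'k::field form1"
  assumes sg: "simple_graph {1..l} E" and \<omega>: "\<omega> \<in> Omega1 l (graphic_arrangement l E)"
    and top: "\<And>i. i > n \<Longrightarrow> \<omega> i = 0" and n: "n \<in> {1..l}"
  obtains \<eta> where "\<eta> \<in> fm.span (log_monom l {} ` {m. allowed l E {} m})" "\<eta> n = \<omega> n" "\<And>i. i > n \<Longrightarrow> \<eta> i = 0"
proof -
  let ?S = "edge_pairs E"
  define N where "N = {j. j < n \<and> edge n j \<in> ?S}"
  have sub: "?S \<subseteq> pairs l" by (rule edge_pairs_subset[OF sg])
  have "edge n j \<in> pairs l \<Longrightarrow> j \<in> {1..l}" for j
    by (auto simp: edge_def pairs_def min_def max_def split: if_splits)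
  then have N: "N \<subseteq> {1..l}" "n \<notin> N" "finite N" using sub by (auto simp: N_def)
  define D where "D = (\<Prod>j\<in>N. var j - var n :: 'k ratfun)"
  have D0: "D \<noteq> 0" unfolding D_def using N by (auto simp: var_inj)
  have f: "\<omega> n * D \<in> poly_ring l"
    unfolding D_def
  proof (rule Omega1_component_poles[OF sg \<omega> _ _ N(3)])
    fix j assume e: "edge n j \<in> ?S"
    then have "j \<noteq> n" by (auto simp: edge_in_edge_pairs)
    then show "j \<in> N \<or> \<omega> j = 0" using N_def top e by (cases "j < n") auto
  qed (auto simp: N_def)
  from rf.span_image_obtain[OF basis_monom_span[OF f n]]
  obtain T0 c where T0: "finite T0" "T0 \<subseteq> exponents l" "\<omega> n * D = (\<Sum>e\<in>T0. const (c e) * basis_monom l n e)" .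
  define T where "T = {e \<in> T0. c e \<noteq> 0}"
  have T: "finite T" "T \<subseteq> exponents l" "\<And>e. e \<in> T \<Longrightarrow> c e \<noteq> 0" using T0 by (auto simp: T_def)
  have fT: "\<omega> n * D = (\<Sum>e\<in>T. const (c e) * basis_monom l n e)"
    unfolding T0(3) T_def using T0(1) by (intro sum.mono_neutral_right) auto
  have clique: "edge j k \<in> ?S" if e: "e \<in> T" "j \<in> N" "k \<in> N" "j \<noteq> k" "e j = 0" "e k = 0" for e j k
  proof (rule ccontr)
    assume no: "edge j k \<notin> ?S"
    define \<theta> :: "nat \<Rightarrow> 'k ratfun" where "\<theta> = (\<lambda>i. if i = j \<or> i = k then var n else var i)"
    have "subst \<theta> (\<omega> n * D) = 0"
      unfolding \<theta>_def D_def by (rule Omega1_nonadjacent[OF sg \<omega> top N_def e(2-4) no])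
    have \<theta>n: "\<theta> n = var n" by (auto simp: \<theta>_def)
    have bP: "basis_monom l n e \<in> polys" for e :: "nat \<Rightarrow> nat"
      unfolding basis_monom_def by (intro polys_ring polys_power polys_prod var_polys)
    \<comment> \<open>At component \<open>n\<close> the substitution sets \<open>y_j\<close> and
      \<open>y_k\<close> to 0: it fixes the monomials free of both and kills all others.\<close>
    have sb: "subst \<theta> (basis_monom l n e) = (if e j = 0 \<and> e k = 0 then basis_monom l n e else 0)" for e
    proof -
      have "subst \<theta> (basis_monom l n e) = var n ^ e n * (\<Prod>i\<in>{1..l} - {n}. (\<theta> i - var n) ^ e i)"
        unfolding basis_monom_def
        by (subst subst_mult) (auto simp: subst_prod subst_power subst_diff polys_power polys_ring var_polys polys_prod \<theta>n)
      also have "\<dots> = (if e j = 0 \<and> e k = 0 then basis_monom l n e else 0)"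
      proof (cases "e j = 0 \<and> e k = 0")
        case True
        then have "(\<Prod>i\<in>{1..l} - {n}. (\<theta> i - var n) ^ e i) = (\<Prod>i\<in>{1..l} - {n}. (var i - var n) ^ e i)"
          by (intro prod.cong refl) (auto simp: \<theta>_def)
        with True show ?thesis unfolding basis_monom_def by simp
      next
        case False
        then obtain i where i: "i \<in> {j, k}" "e i \<noteq> 0" by auto
        have "i \<in> {1..l} - {n}" using i e N by auto
        moreover have "(\<theta> i - var n) ^ e i = 0" using i by (auto simp: \<theta>_def)
        ultimately have "(\<Prod>i\<in>{1..l} - {n}. (\<theta> i - var n) ^ e i) = 0"
          by (intro prod_zero) auto
        then show ?thesis using False by auto
      qed
      finally show ?thesis .
    qed
    have "0 = subst \<theta> (\<Sum>e\<in>T. const (c e) * basis_monom l n e)"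
      using \<open>subst \<theta> (\<omega> n * D) = 0\<close> fT by simp
    also have "\<dots> = (\<Sum>e\<in>T. const (c e) * (if e j = 0 \<and> e k = 0 then basis_monom l n e else 0))"
      by (subst subst_sum) (auto simp: subst_mult const_polys bP sb intro!: polys_ring)
    also have "\<dots> = (\<Sum>e\<in>{e\<in>T. e j = 0 \<and> e k = 0}. const (c e) * basis_monom l n e)"
      using T(1) by (intro sum.mono_neutral_cong_right) auto
    finally have "c e = 0"
      by (intro basis_monom_indep[OF n, of "{e\<in>T. e j = 0 \<and> e k = 0}" c e]) (use T e in auto)
    then show False using T(3)[OF e(1)] by simp
  qed
  \<comment> \<open>Division by \<open>D\<close> lowers the exponent of \<open>y_j\<close> by one
    for \<open>j \<in> N\<close>; the entry -1 at \<open>l + n\<close> stands for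
    \<open>dx_n\<close>.\<close>
  define ex :: "(nat \<Rightarrow> nat) \<Rightarrow> nat \<Rightarrow> int" where
    "ex e u = (if u = 0 then int (e n) else if u \<in> {l + 1..2 * l} then
       (if u = l + n then -1 else int (e (u - l)) - (if u - l \<in> N then 1 else 0)) else 0)" for e u
  have ex0: "ex e 0 = int (e n)" and exn: "ex e (l + n) = -1"
    and exj: "j \<in> {1..l} \<Longrightarrow> j \<noteq> n \<Longrightarrow> ex e (l + j) = int (e j) - (if j \<in> N then 1 else 0)" for e j
    using n by (auto simp: ex_def)
  have negs: "negs l {} (ex e) = insert n {j \<in> N. e j = 0}" for e
  proof -
    have "j \<in> negs l {} (ex e) \<longleftrightarrow> j = n \<or> (j \<in> N \<and> e j = 0)" for j
    proof (cases "j \<in> {1..l} \<and> j \<noteq> n")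
      case True
      then show ?thesis using exj[of j e] by (auto simp: negs_def)
    next
      case False
      then show ?thesis using exn[of e] n N by (auto simp: negs_def)
    qed
    then show ?thesis by blast
  qed
  have al: "allowed l E {} (ex e)" if e: "e \<in> T" for e
    unfolding allowed_def negs
  proof (intro conjI allI impI ballI)
    show "ex e u = 0" if "u \<notin> yz l" for u using that by (auto simp: ex_def yz_def)
    show "0 \<le> ex e 0" by (simp add: ex0)
    show "-1 \<le> ex e (l + j)" if "j \<in> {1..l}" for j using exj[of j e] exn[of e] that by (cases "j = n") auto
    show "insert n {j \<in> N. e j = 0} \<in> clique_complex {1..l} E"
    proof -
      have "{u, v} \<in> E" if "u \<in> insert n {j \<in> N. e j = 0}" "v \<in> insert n {j \<in> N. e j = 0}" "u \<noteq> v" for u v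
        using that clique[OF e, of u v] by (auto simp: N_def edge_in_edge_pairs insert_commute)
      then show ?thesis using N n unfolding clique_complex_def by auto
    qed
  qed simp
  have lm: "laurent_monom l n (ex e) * D = basis_monom l n e" for e
  proof -
    have "(\<Prod>j\<in>{1..l} - {n}. (var j - var n :: 'k ratfun) powi ex e (l + j)) * D =
        (\<Prod>j\<in>{1..l} - {n}. (var j - var n) powi ex e (l + j)) * (\<Prod>j\<in>{1..l} - {n}. if j \<in> N then var j - var n else 1)"
    proof -
      have "D = (\<Prod>j\<in>{1..l} - {n}. if j \<in> N then var j - var n else 1)"
        unfolding D_def using N by (intro prod.mono_neutral_cong_left) auto
      then show ?thesis by simp
    qed
    also have "\<dots> = (\<Prod>j\<in>{1..l} - {n}. (var j - var n) powi ex e (l + j) * (if j \<in> N then var j - var n else 1))"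
      by (simp add: prod.distrib)
    also have "\<dots> = (\<Prod>j\<in>{1..l} - {n}. (var j - var n) ^ e j)"
    proof (intro prod.cong refl)
      fix j assume j: "j \<in> {1..l} - {n}"
      then have v: "var j - var n \<noteq> (0 :: 'k ratfun)" by (auto simp: var_inj)
      show "(var j - var n :: 'k ratfun) powi ex e (l + j) * (if j \<in> N then var j - var n else 1) = (var j - var n) ^ e j"
        using exj[of j e] j v by (auto simp: power_int_diff)
    qed
    finally show ?thesis by (simp add: laurent_monom_def basis_monom_def ex0 mult.assoc)
  qed
  define \<eta> where "\<eta> = (\<Sum>e\<in>T. fmult (const (c e)) (log_monom l {} (ex e)))"
  have \<eta>i: "\<eta> i = (\<Sum>e\<in>T. const (c e) * log_monom l {} (ex e) i)" for i
    by (simp add: \<eta>_def sum_fun_apply fmult_def)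
  show ?thesis
  proof
    show "\<eta> \<in> fm.span (log_monom l {} ` {m. allowed l E {} m})"
      unfolding \<eta>_def using al by (intro fm.span_sum fm.span_scale fm.span_base) auto
    have "\<eta> n * D = \<omega> n * D"
      unfolding \<eta>i fT sum_distrib_right by (intro sum.cong) (auto simp: log_monom_def negs lm mult.assoc)
    then show "\<eta> n = \<omega> n" using D0 by simp
    show "\<eta> i = 0" if "i > n" for i
      unfolding \<eta>i using that by (intro sum.neutral) (auto simp: log_monom_def negs N_def)
  qed
qed

text \<open>For the hard inclusion, induction on a bound for the indices of nonzero components:
  \<open>Omega1_top_component\<close> matches the last one by clique monomials that reach no
  further.\<close>

theorem Omega1_span:
  assumes sg: "simple_graph {1..l} E"
  shows "Omega1 l (graphic_arrangement l E) =
    (fm.span (log_monom l {} ` {m. allowed l E {} m}) :: 'k::field form1 set)"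
proof
  let ?L = "fm.span (log_monom l {} ` {m. allowed l E {} m}) :: 'k form1 set"
  let ?O = "Omega1 l (graphic_arrangement l E) :: 'k form1 set"
  show LO: "?L \<subseteq> ?O"
    by (rule fm.span_minimal) (use log_monom_mem[OF sg] subspace_Omega1[OF sg] in auto)
  have "\<omega> \<in> ?L" if "\<omega> \<in> ?O" "\<And>i. i > n \<Longrightarrow> \<omega> i = 0" "n \<le> l" for n \<omega>
    using that
  proof (induction n arbitrary: \<omega>)
    case 0
    then have "\<omega> i = 0" for i using Omega1_graphic_iff[OF sg, of \<omega>] by (cases "i = 0") auto
    then have "\<omega> = 0" by auto
    show ?case unfolding \<open>\<omega> = 0\<close> by (rule fm.span_zero)
  next
    case (Suc n)
    obtain \<eta> where \<eta>: "\<eta> \<in> ?L" "\<eta> (Suc n) = \<omega> (Suc n)" "\<And>i. i > Suc n \<Longrightarrow> \<eta> i = 0"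
      using Omega1_top_component[OF sg Suc.prems(1), of "Suc n"] Suc.prems by auto
    have "\<omega> - \<eta> \<in> ?L"
    proof (rule Suc.IH)
      show "\<omega> - \<eta> \<in> ?O" using \<eta>(1) LO Suc.prems(1) fm.subspace_diff[OF subspace_Omega1[OF sg]] by blast
      show "(\<omega> - \<eta>) i = 0" if "i > n" for i
        using that \<eta> Suc.prems(2)[of i] by (cases "i = Suc n") auto
    qed (use Suc.prems in simp)
    from fm.span_add[OF this \<eta>(1)] show ?case by simp
  qed
  note ind = this
  show "?O \<subseteq> ?L"
  proof
    fix \<omega> assume \<omega>: "\<omega> \<in> ?O"
    then have "\<omega> i = 0" if "i > l" for i using Omega1_graphic_iff[OF sg, of \<omega>] that by simp
    then show "\<omega> \<in> ?L" by (rule ind[OF \<omega> _ order_refl])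
  qed
qed

section \<open>Independence of the generators\<close>

context graded_cech
begin

text \<open>Degree \<open>n\<close> of the ideal generated by the \<open>N\<close>-th powers, with
  coefficients homogeneous as well. Keeping the degree in the ideal lets gradings be tracked through
  sums and products.\<close>

definition power_ideal :: "nat set \<Rightarrow> nat \<Rightarrow> int \<Rightarrow> ('a \<Rightarrow> 'f) set" where
  "power_ideal I N n = {x. \<exists>a. (\<forall>u\<in>I. a u \<in> multipliers \<and> a u \<in> D (n - int N)) \<and> x = (\<Sum>u\<in>I. a u * g u ^ N)}"

lemma power_idealI:
  assumes "\<And>u. u \<in> I \<Longrightarrow> a u \<in> multipliers" "\<And>u. u \<in> I \<Longrightarrow> a u \<in> D (n - int N)" "x = (\<Sum>u\<in>I. a u * g u ^ N)"
  shows "x \<in> power_ideal I N n"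
  unfolding power_ideal_def by (intro CollectI exI[of _ a]) (use assms in auto)

lemma power_ideal_add:
  assumes "x \<in> power_ideal I N n" "y \<in> power_ideal I N n"
  shows "x + y \<in> power_ideal I N n"
proof -
  obtain a where a: "\<forall>u\<in>I. a u \<in> multipliers \<and> a u \<in> D (n - int N)" "x = (\<Sum>u\<in>I. a u * g u ^ N)"
    using assms(1) by (auto simp: power_ideal_def)
  obtain b where b: "\<forall>u\<in>I. b u \<in> multipliers \<and> b u \<in> D (n - int N)" "y = (\<Sum>u\<in>I. b u * g u ^ N)"
    using assms(2) by (auto simp: power_ideal_def)
  have "x + y = (\<Sum>u\<in>I. (a u + b u) * g u ^ N)" unfolding a b by (simp only: distrib_right sum.distrib)
  then show ?thesis by (rule power_idealI[rotated 2]) (use a b in \<open>auto intro: add_multipliers D_add\<close>)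
qed

lemma power_ideal_mult:
  assumes x: "x \<in> power_ideal I N n" and r: "r \<in> multipliers" "r \<in> D m"
  shows "r * x \<in> power_ideal I N (m + n)"
proof -
  obtain a where a: "\<forall>u\<in>I. a u \<in> multipliers \<and> a u \<in> D (n - int N)" "x = (\<Sum>u\<in>I. a u * g u ^ N)"
    using x by (auto simp: power_ideal_def)
  have "r * x = (\<Sum>u\<in>I. (r * a u) * g u ^ N)" unfolding a by (simp only: sum_distrib_left mult.assoc)
  moreover have "r * a u \<in> D (m + n - int N)" if "u \<in> I" for u
    using D_mult[OF r(2), of "a u" "n - int N"] a that by (simp add: algebra_simps)
  ultimately show ?thesis by (intro power_idealI) (use a r mult_multipliers in auto)
qed

lemma power_ideal_0: "0 \<in> power_ideal I N n"
  by (rule power_idealI[where a = "\<lambda>_. 0"]) (auto simp: zero_multipliers D_zero)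

lemma power_ideal_gen:
  assumes "finite I" "u \<in> I" shows "g u ^ N \<in> power_ideal I N (int N)"
proof -
  have "(\<Sum>w\<in>I. (if w = u then 1 else 0) * g w ^ N) = (\<Sum>w\<in>I. if w = u then g u ^ N else 0)"
    by (intro sum.cong) auto
  also have "\<dots> = g u ^ N" using assms by simp
  finally show ?thesis
    by (intro power_idealI[OF _ _ sym]) (auto simp: zero_multipliers one_multipliers D_zero D_one)
qed

lemma power_ideal_sum:
  "(\<And>t. t \<in> T \<Longrightarrow> x t \<in> power_ideal I N n) \<Longrightarrow> (\<Sum>t\<in>T. x t) \<in> power_ideal I N n"
proof (induction T rule: infinite_finite_induct)
  case (insert t T)
  show ?case unfolding sum.insert[OF insert(1,2)] by (rule power_ideal_add) (use insert in auto)
qed (simp_all only: sum.infinite sum.empty power_ideal_0 not_False_eq_True)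

text \<open>The condition of \<open>in_radical\<close> for an arbitrary operator instead of a
  generator, so that sums and negatives can be formed before specializing.\<close>

definition in_rad :: "nat set \<Rightarrow> ('a \<Rightarrow> 'f) \<Rightarrow> bool" where
  "in_rad I x \<longleftrightarrow> x \<in> multipliers \<and> x \<in> D 1 \<and> (\<forall>N. \<exists>k. x ^ k \<in> power_ideal I N (int k))"

lemma in_radicalI: "in_rad I (g v) \<Longrightarrow> in_radical I v"
  unfolding in_rad_def in_radical_def power_ideal_def mem_Collect_eq by (elim conjE)

lemma in_rad_gen: "finite I \<Longrightarrow> u \<in> I \<Longrightarrow> in_rad I (g u)"
  unfolding in_rad_def using power_ideal_gen gen_multipliers D_gen by blast

lemma in_rad_uminus:
  assumes x: "in_rad I x" shows "in_rad I (- x)"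
  unfolding in_rad_def
proof (intro conjI allI)
  fix N
  obtain k where k: "x ^ k \<in> power_ideal I N (int k)" using x by (auto simp: in_rad_def)
  have "(- x) ^ k = (-1) ^ k * x ^ k" by (rule power_minus)
  moreover have "(-1) ^ k * x ^ k \<in> power_ideal I N (int k)"
    using power_ideal_mult[OF k sign_multipliers D_sign, of k] by simp
  ultimately show "\<exists>k. (- x) ^ k \<in> power_ideal I N (int k)" by metis
qed (use x uminus_multipliers D_uminus in \<open>auto simp: in_rad_def\<close>)

lemma of_nat_mem: "of_nat n \<in> multipliers" "of_nat n \<in> D 0"
proof (induction n)
  case 0 case 1 show ?case unfolding of_nat_0 by (rule zero_multipliers)
next
  case 0 case 2 show ?case unfolding of_nat_0 by (rule D_zero)
next
  case (Suc n) case 1 show ?case unfolding of_nat_Suc by (rule add_multipliers[OF one_multipliers Suc(1)])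
next
  case (Suc n) case 2 show ?case unfolding of_nat_Suc by (rule D_add[OF D_one Suc(2)])
qed

text \<open>In the binomial expansion of exponent \<open>k + k'\<close> every term contains at least
  \<open>k\<close> factors \<open>x\<close> or at least \<open>k'\<close> factors
  \<open>y\<close>.\<close>

lemma in_rad_add:
  assumes x: "in_rad I x" and y: "in_rad I y" shows "in_rad I (x + y)"
  unfolding in_rad_def
proof (intro conjI allI)
  fix N
  obtain k where k: "x ^ k \<in> power_ideal I N (int k)" using x by (auto simp: in_rad_def)
  obtain k' where k': "y ^ k' \<in> power_ideal I N (int k')" using y by (auto simp: in_rad_def)
  have xm: "x ^ t \<in> multipliers" "x ^ t \<in> D (int t)" for t
    using x D_power[of x 1 t] power_multipliers by (auto simp: in_rad_def)
  have ym: "y ^ t \<in> multipliers" "y ^ t \<in> D (int t)" for t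
    using y D_power[of y 1 t] power_multipliers by (auto simp: in_rad_def)
  have mem: "x ^ t * y ^ (k + k' - t) \<in> power_ideal I N (int (k + k'))" if t: "t \<le> k + k'" for t
  proof (cases "k \<le> t")
    case True
    have "x ^ t * y ^ (k + k' - t) = (x ^ (t - k) * y ^ (k + k' - t)) * x ^ k"
      using True power_add[of x "t - k" k] by (simp add: mult_ac)
    moreover have "(x ^ (t - k) * y ^ (k + k' - t)) * x ^ k \<in> power_ideal I N (int (t - k) + int (k + k' - t) + int k)"
      by (rule power_ideal_mult[OF k mult_multipliers[OF xm(1) ym(1)] D_mult[OF xm(2) ym(2)]])
    moreover have "int (t - k) + int (k + k' - t) + int k = int (k + k')" using True t by simp
    ultimately show ?thesis by metis
  next
    case False
    have "y ^ (k + k' - t) = y ^ (k - t) * y ^ k'" using False by (simp flip: power_add)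
    then have "x ^ t * y ^ (k + k' - t) = (x ^ t * y ^ (k - t)) * y ^ k'" by (simp only: mult.assoc)
    moreover have "(x ^ t * y ^ (k - t)) * y ^ k' \<in> power_ideal I N (int t + int (k - t) + int k')"
      by (rule power_ideal_mult[OF k' mult_multipliers[OF xm(1) ym(1)] D_mult[OF xm(2) ym(2)]])
    moreover have "int t + int (k - t) + int k' = int (k + k')" using False by simp
    ultimately show ?thesis by metis
  qed
  have "(x + y) ^ (k + k') = (\<Sum>t\<le>k + k'. of_nat ((k + k') choose t) * (x ^ t * y ^ (k + k' - t)))"
    unfolding binomial_ring by (simp only: mult.assoc)
  also have "\<dots> \<in> power_ideal I N (int (k + k'))"
  proof (rule power_ideal_sum)
    fix t assume "t \<in> {..k + k'}"
    then show "of_nat ((k + k') choose t) * (x ^ t * y ^ (k + k' - t)) \<in> power_ideal I N (int (k + k'))"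
      using power_ideal_mult[OF mem of_nat_mem, of t "(k + k') choose t"] by simp
  qed
  finally show "\<exists>k. (x + y) ^ k \<in> power_ideal I N (int k)" by blast
qed (use x y add_multipliers D_add in \<open>auto simp: in_rad_def\<close>)

text \<open>The relation makes \<open>z\<close> integral over the generators. Since
  \<open>z - g u\<close> divides \<open>z ^ N - g u ^ N\<close>, the product of the latter vanishes
  for every \<open>N\<close> too, and its expansion expresses \<open>z ^ (N * card I)\<close>
  through the powers \<open>g u ^ N\<close>.\<close>

lemma in_rad_roots:
  assumes I: "finite I" and z: "z \<in> multipliers" "z \<in> D 1" and roots: "(\<Prod>u\<in>I. z - g u) = 0"
  shows "in_rad I z"
  unfolding in_rad_def
proof (intro conjI allI)
  fix N
  have zm: "z ^ t \<in> multipliers" "z ^ t \<in> D (int t)" for t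
    using z D_power[of z 1 t] power_multipliers by auto
  have gm: "g u ^ t \<in> multipliers" "g u ^ t \<in> D (int t)" for u t
    using D_power[OF D_gen, of u t] power_multipliers[OF gen_multipliers] by auto
  have dm: "z ^ N - g u ^ N \<in> multipliers" "z ^ N - g u ^ N \<in> D (int N)" for u
  proof -
    have "z ^ N + (- (g u ^ N)) \<in> multipliers" by (intro add_multipliers uminus_multipliers zm gm)
    then show "z ^ N - g u ^ N \<in> multipliers" by (simp only: diff_conv_add_uminus)
  qed (intro D_diff zm gm)
  have "(\<Prod>u\<in>A. z ^ N - g u ^ N) - z ^ (N * card A) \<in> power_ideal I N (int (N * card A))"
    if "finite A" "A \<subseteq> I" for A using that
  proof (induction A rule: finite_induct)
    case (insert u A)
    let ?P = "\<Prod>u\<in>A. z ^ N - g u ^ N"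
    have eq: "(\<Prod>u\<in>insert u A. z ^ N - g u ^ N) - z ^ (N * card (insert u A)) =
        (z ^ N - g u ^ N) * (?P - z ^ (N * card A)) + (- (z ^ (N * card A))) * g u ^ N"
      unfolding prod.insert[OF insert(1,2)] card_insert_disjoint[OF insert(1,2)]
      by (simp add: algebra_simps power_add)
    have deg: "int N + int (N * card A) = int (N * card (insert u A))"
      unfolding card_insert_disjoint[OF insert(1,2)] by (simp add: algebra_simps)
    have 1: "(z ^ N - g u ^ N) * (?P - z ^ (N * card A)) \<in> power_ideal I N (int N + int (N * card A))"
      by (rule power_ideal_mult[OF insert(3) dm]) (use insert in auto)
    have 2: "(- (z ^ (N * card A))) * g u ^ N \<in> power_ideal I N (int (N * card A) + int N)"
      by (rule power_ideal_mult[OF power_ideal_gen[OF I] uminus_multipliers[OF zm(1)] D_uminus[OF zm(2)]])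
        (use insert in auto)
    show ?case unfolding eq using power_ideal_add[OF 1, of "(- (z ^ (N * card A))) * g u ^ N"] 2
      unfolding deg by (simp only: add.commute deg)
  qed (simp add: power_ideal_0)
  from this[of I] I
  have mem: "(\<Prod>u\<in>I. z ^ N - g u ^ N) - z ^ (N * card I) \<in> power_ideal I N (int (N * card I))" by simp
  have "(\<Prod>u\<in>I. z - g u) dvd (\<Prod>u\<in>I. z ^ N - g u ^ N)"
    by (intro prod_dvd_prod) (simp only: power_diff_sumr2 dvd_triv_left)
  then have "(\<Prod>u\<in>I. z ^ N - g u ^ N) = 0" unfolding roots by (auto elim!: dvdE)
  with mem have "- (z ^ (N * card I)) \<in> power_ideal I N (int (N * card I))" by (simp only: diff_0)
  from power_ideal_mult[OF this uminus_multipliers[OF one_multipliers] D_uminus[OF D_one]]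
  have "z ^ (N * card I) \<in> power_ideal I N (int (N * card I))" by simp
  then show "\<exists>k. z ^ k \<in> power_ideal I N (int k)" by blast
qed (use z in auto)

end

section \<open>The Cech complex of logarithmic forms\<close>

definition zcoord :: "nat \<Rightarrow> 'k::field form1" where
  "zcoord l i = (if i \<in> {1..l} then var i else var 1)"

text \<open>The generators \<open>x_u\<close> at index \<open>u \<le> l\<close>, \<open>z\<close> at index \<open>0\<close> and \<open>y_j\<close> at index \<open>l + j\<close>, as diagonal operators.
  Components outside \<open>{1..l}\<close> are irrelevant; the choice of \<open>zcoord\<close> there makes the product of all \<open>y_j\<close> vanish.\<close>

definition gen :: "nat \<Rightarrow> nat \<Rightarrow> 'k::field form1" where
  "gen l u i = (if u = 0 then zcoord l i else if u \<le> l then var u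
     else if u \<le> 2 * l then var (u - l) - zcoord l i else 0)"

definition form_degree :: "nat \<Rightarrow> int \<Rightarrow> 'k::field form1 set" where
  "form_degree l d = {\<omega>. \<forall>i. \<omega> i \<in> rat_homogeneous l d}"

abbreviation (input) Omega1_graph :: "nat \<Rightarrow> nat set set \<Rightarrow> 'k::field form1 set" where
  "Omega1_graph l E \<equiv> Omega1 l (graphic_arrangement l E)"

section \<open>Action of the generators on monomials, and localization of monomials\<close>

lemma yz_image: "yz l = insert 0 ((+) l ` {1..l})"
  by (simp add: yz_def mult_2)

lemma prod_yz:
  fixes h :: "nat \<Rightarrow> 'b::comm_monoid_mult"
  assumes i: "i \<in> {1..l}"
  shows "(\<Prod>v\<in>yz l - {l + i}. h v) = h 0 * (\<Prod>j\<in>{1..l} - {i}. h (l + j))"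
proof -
  have "yz l - {l + i} = insert 0 ((+) l ` ({1..l} - {i}))"
  proof -
    have "(+) l ` ({1..l} - {i}) = (+) l ` {1..l} - {l + i}"
      by (subst image_set_diff) (simp_all add: inj_def)
    then show ?thesis using i by (simp add: yz_image insert_Diff_if)
  qed
  moreover have "(0::nat) \<notin> (+) l ` ({1..l} - {i})" using i by auto
  ultimately show ?thesis by (simp add: prod.reindex)
qed

lemma power_int_prod: "(\<Prod>a\<in>A. f a) powi n = (\<Prod>a\<in>A. (f a :: 'b::field) powi n)"
  by (induction A rule: infinite_finite_induct) (auto simp: power_int_mult_distrib)

lemma laurent_monom_gens:
  assumes i: "i \<in> {1..l}" and F: "F \<subseteq> yz l" "l + i \<notin> F"
  shows "laurent_monom l i (\<lambda>u. if u \<in> F then n else 0) = (\<Prod>v\<in>F. gen l v i :: 'k::field ratfun) powi n"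
proof -
  have "(\<Prod>v\<in>F. gen l v i :: 'k ratfun) = (\<Prod>v\<in>yz l - {l + i}. if v \<in> F then gen l v i else 1)"
    using F by (intro prod.mono_neutral_cong_left) (auto simp: yz_def)
  also have "\<dots> powi n = (\<Prod>v\<in>yz l - {l + i}. (if v \<in> F then gen l v i else 1) powi n)"
    by (rule power_int_prod)
  also have "\<dots> = (if 0 \<in> F then gen l 0 i else 1) powi n * (\<Prod>j\<in>{1..l} - {i}. (if l + j \<in> F then gen l (l + j) i else 1) powi n)"
    by (rule prod_yz[OF i])
  also have "(\<Prod>j\<in>{1..l} - {i}. (if l + j \<in> F then gen l (l + j) i else 1 :: 'k ratfun) powi n) =
      (\<Prod>j\<in>{1..l} - {i}. (var j - var i) powi (if l + j \<in> F then n else 0))"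
    using i by (intro prod.cong refl) (auto simp: gen_def zcoord_def)
  finally have eq: "(\<Prod>v\<in>F. gen l v i :: 'k ratfun) powi n = (if 0 \<in> F then gen l 0 i else 1) powi n *
      (\<Prod>j\<in>{1..l} - {i}. (var j - var i) powi (if l + j \<in> F then n else 0))" .
  show ?thesis
    unfolding eq laurent_monom_def using i by (simp add: gen_def zcoord_def)
qed

lemma laurent_monom_shift:
  assumes i: "i \<in> {1..l}" and F: "F \<subseteq> yz l" "l + i \<notin> F"
  shows "laurent_monom l i (\<lambda>u. m u + (if u \<in> F then n else 0)) =
    laurent_monom l i m * (\<Prod>v\<in>F. gen l v i :: 'k::field ratfun) powi n"
  using laurent_monom_add[of l i m "\<lambda>u. if u \<in> F then n else 0", where 'a = 'k] laurent_monom_gens[OF assms, of n, where 'k = 'k]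
  by (simp add: plus_fun_def)

lemma clique_complex_subset:
  assumes "\<sigma> \<in> clique_complex V E" "\<tau> \<subseteq> \<sigma>" shows "\<tau> \<in> clique_complex V E"
proof -
  have "finite \<tau>" using assms finite_subset by (auto simp: clique_complex_def)
  then show ?thesis using assms by (simp add: clique_complex_def subset_iff)
qed

text \<open>For \<open>u = l + i\<close> with \<open>i\<close> in the support, component
  \<open>i\<close> becomes zero on both sides: \<open>y_i\<close> vanishes there, and the exponent
  leaves -1. A monomial whose last entry -1 is raised thus becomes zero.\<close>

lemma gen_times_log_monom:
  assumes m: "allowed l E {} m" and u: "u \<in> yz l"
  shows "gen l u * log_monom l {} m = (log_monom l {} (m(u := m u + 1)) :: 'k::field form1)"
proof
  fix i
  have eq: "m(u := m u + 1) = (\<lambda>v. m v + (if v \<in> {u} then 1 else 0))" by auto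
  show "(gen l u * log_monom l {} m) i = (log_monom l {} (m(u := m u + 1)) i :: 'k ratfun)"
  proof (cases "i \<in> negs l {} m")
    case True
    then have i: "i \<in> {1..l}" "m (l + i) = -1" by (auto simp: negs_def)
    show ?thesis
    proof (cases "u = l + i")
      case True
      then have "i \<notin> negs l {} (m(u := m u + 1))" using i by (simp add: negs_def)
      then show ?thesis using True i by (simp add: log_monom_def gen_def zcoord_def)
    next
      case False
      then have "i \<in> negs l {} (m(u := m u + 1))" using i by (simp add: negs_def)
      moreover have "laurent_monom l i (m(u := m u + 1)) = (laurent_monom l i m * gen l u i :: 'k ratfun)"
        unfolding eq using laurent_monom_shift[OF i(1), of "{u}" m 1] u False by simp
      ultimately show ?thesis using True by (simp add: log_monom_def)
    qed
  next
    case False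
    have "i \<notin> negs l {} (m(u := m u + 1))"
    proof
      assume *: "i \<in> negs l {} (m(u := m u + 1))"
      then have "i \<in> {1..l}" by (simp add: negs_def)
      then have "-1 \<le> m (l + i)" using m by (simp add: allowed_def)
      then show False using * False by (auto simp: negs_def split: if_splits)
    qed
    then show ?thesis using False by (simp add: log_monom_def)
  qed
qed

lemma allowed_shift:
  assumes m: "allowed l E {} m" and u: "u \<in> yz l" and ne: "negs l {} (m(u := m u + 1)) \<noteq> {}"
  shows "allowed l E {} (m(u := m u + 1))"
proof -
  have sub: "negs l {} (m(u := m u + 1)) \<subseteq> negs l {} m"
  proof
    fix j assume j: "j \<in> negs l {} (m(u := m u + 1))"
    then have "-1 \<le> m (l + j)" using m by (simp add: allowed_def negs_def)
    then show "j \<in> negs l {} m" using j by (auto simp: negs_def split: if_splits)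
  qed
  have "negs l {} m \<in> clique_complex {1..l} E" using m by (simp only: allowed_def)
  from clique_complex_subset[OF this sub] have cl: "negs l {} (m(u := m u + 1)) \<in> clique_complex {1..l} E" .
  have mz: "m w = 0" if "w \<notin> yz l" for w using m that by (simp add: allowed_def)
  have m0: "0 \<le> m 0" using m by (simp add: allowed_def)
  have mj: "-1 \<le> m (l + j)" if "j \<in> {1..l}" for j using m that by (simp add: allowed_def)
  show ?thesis
    unfolding allowed_def
  proof (intro conjI allI impI ballI ne cl)
    show "(m(u := m u + 1)) w = 0" if "w \<notin> yz l" for w using mz[OF that] that u by auto
    show "0 \<le> (m(u := m u + 1)) 0" using m0 by simp
    show "-1 \<le> (m(u := m u + 1)) (l + j)" if "j \<in> {1..l}" for j using mj[OF that] by auto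
  qed
qed

lemma log_monom_eq_0: "negs l F m = {} \<Longrightarrow> log_monom l F m = 0"
  by (auto simp: log_monom_def)

definition shift :: "nat set \<Rightarrow> int \<Rightarrow> (nat \<Rightarrow> int) \<Rightarrow> nat \<Rightarrow> int" where
  "shift F n m = (\<lambda>u. m u + (if u \<in> F then n else 0))"

lemma shift_notin [simp]: "u \<notin> F \<Longrightarrow> shift F n m u = m u"
  by (simp add: shift_def)

lemma negs_shift: "negs l F (shift F n m) = negs l F m"
  by (auto simp: negs_def shift_def)

text \<open>At components \<open>i\<close> with \<open>l + i \<in> F\<close> the product of
  generators has the factor \<open>y_i = 0\<close>, so its pseudo-inverse kills them; this matches
  their removal from \<open>negs\<close>.\<close>

lemma log_monom_localize:
  assumes F: "F \<subseteq> yz l"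
  shows "log_monom l {} m * pinv (\<Prod>v\<in>F. gen l v) ^ Suc n = (log_monom l F (shift F (- int (Suc n)) m) :: 'k::field form1)"
proof
  fix i
  have fin: "finite F" using F finite_subset by (auto simp: yz_def)
  show "(log_monom l {} m * pinv (\<Prod>v\<in>F. gen l v) ^ Suc n) i = (log_monom l F (shift F (- int (Suc n)) m) i :: 'k ratfun)"
  proof (cases "i \<in> negs l {} m")
    case True
    then have i: "i \<in> {1..l}" by (simp add: negs_def)
    show ?thesis
    proof (cases "l + i \<in> F")
      case True
      then have "(\<Prod>v\<in>F. gen l v i) = (0 :: 'k ratfun)"
        using i fin by (intro prod_zero bexI[of _ "l + i"]) (auto simp: gen_def zcoord_def)
      then show ?thesis using True by (simp add: log_monom_def negs_shift negs_def pinv_def prod_fun_apply power_fun_apply)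
    next
      case False
      have "i \<in> negs l F (shift F (- int (Suc n)) m)" using True False by (simp add: negs_shift negs_def)
      moreover have "laurent_monom l i (shift F (- int (Suc n)) m) =
          laurent_monom l i m * (\<Prod>v\<in>F. gen l v i :: 'k ratfun) powi (- int (Suc n))"
        unfolding shift_def by (rule laurent_monom_shift[OF i F False])
      moreover have "(\<Prod>v\<in>F. gen l v i :: 'k ratfun) powi (- int (Suc n)) = inverse (\<Prod>v\<in>F. gen l v i) ^ Suc n"
        unfolding power_int_minus power_int_of_nat by (rule power_inverse[symmetric])
      ultimately show ?thesis using True
        by (simp add: log_monom_def pinv_def prod_fun_apply power_fun_apply del: power_Suc)
    qed
  next
    case False
    then have "i \<notin> negs l F (shift F (- int (Suc n)) m)" by (simp add: negs_shift) (simp add: negs_def)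
    then show ?thesis using False by (simp add: log_monom_def)
  qed
qed

lemma allowed_localize:
  assumes m: "allowed l E {} m" and F: "F \<subseteq> yz l" and ne: "negs l F (shift F n m) \<noteq> {}"
  shows "allowed l E F (shift F n m)"
proof -
  have sub: "negs l F (shift F n m) \<subseteq> negs l {} m" unfolding negs_shift by (auto simp: negs_def)
  have "negs l {} m \<in> clique_complex {1..l} E" using m by (simp only: allowed_def)
  from clique_complex_subset[OF this sub] have cl: "negs l F (shift F n m) \<in> clique_complex {1..l} E" .
  have mz: "m w = 0" if "w \<notin> yz l" for w using m that by (simp add: allowed_def)
  have m0: "0 \<le> m 0" using m by (simp add: allowed_def)
  have mj: "-1 \<le> m (l + j)" if "j \<in> {1..l}" for j using m that by (simp add: allowed_def)
  show ?thesis
    unfolding allowed_def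
  proof (intro conjI allI impI ballI ne cl)
    show "shift F n m w = 0" if "w \<notin> yz l" for w using mz[OF that] that F by (auto simp: shift_def)
    show "0 \<le> shift F n m 0" if "0 \<notin> F" using m0 that by simp
    show "-1 \<le> shift F n m (l + j)" if "j \<in> {1..l}" "l + j \<notin> F" for j using mj[OF that(1)] that(2) by simp
  qed
qed

text \<open>Raising the entries in \<open>F\<close> until they are nonnegative creates no new entry
  -1, so the clique stays the same and the monomial is seen to come from the module itself.\<close>

lemma allowed_unlocalize:
  assumes m: "allowed l E F m" and F: "F \<subseteq> yz l"
  shows "\<exists>n. allowed l E {} (shift F (int (Suc n)) m)"
proof -
  have fin: "finite F" using F finite_subset by (auto simp: yz_def)
  define n where "n = nat (\<Sum>u\<in>F. \<bar>m u\<bar>)"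
  have n: "0 \<le> m u + int (Suc n)" if "u \<in> F" for u
  proof -
    have "\<bar>m u\<bar> \<le> (\<Sum>u\<in>F. \<bar>m u\<bar>)" using that fin by (intro member_le_sum) auto
    then show ?thesis by (simp add: n_def)
  qed
  have negs: "negs l {} (shift F (int (Suc n)) m) = negs l F m"
  proof -
    have "shift F (int (Suc n)) m (l + j) = -1 \<longleftrightarrow> l + j \<notin> F \<and> m (l + j) = -1" for j
      using n[of "l + j"] by (auto simp: shift_def)
    then show ?thesis by (simp add: negs_def)
  qed
  have "0 \<le> shift F (int (Suc n)) m 0" using m n[of 0] by (auto simp: allowed_def shift_def)
  moreover have "-1 \<le> shift F (int (Suc n)) m (l + j)" if "j \<in> {1..l}" for j
    using m n[of "l + j"] that by (auto simp: allowed_def shift_def)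
  moreover have "shift F (int (Suc n)) m u = 0" if "u \<notin> yz l" for u
    using that m F by (auto simp: allowed_def shift_def)
  ultimately have "allowed l E {} (shift F (int (Suc n)) m)"
    using m unfolding allowed_def negs by (simp del: of_nat_Suc)
  then show ?thesis by blast
qed

lemma gen_x: "u \<in> {1..l} \<Longrightarrow> gen l u = gen l (l + u) + (gen l 0 :: 'k::field form1)"
  by (auto simp: gen_def fun_eq_iff)

lemma Omega1_gen_mem:
  fixes \<omega> :: "'k::field form1"
  assumes sg: "simple_graph {1..l} E" and \<omega>: "\<omega> \<in> Omega1_graph l E"
  shows "gen l u * \<omega> \<in> Omega1_graph l E"
proof -
  have yzcase: "gen l u * \<omega> \<in> Omega1_graph l E" if u: "u \<in> yz l" for u
    using \<omega> unfolding Omega1_span[OF sg]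
  proof (induction rule: fm.span_induct_alt)
    case base
    show ?case unfolding mult_zero_right by (rule fm.span_zero)
  next
    case (step c x y)
    then obtain m where m: "allowed l E {} m" "x = log_monom l {} m" by blast
    have "gen l u * x \<in> fm.span (log_monom l {} ` {m. allowed l E {} m})"
    proof (cases "negs l {} (m(u := m u + 1)) = {}")
      case True
      show ?thesis unfolding m(2) gen_times_log_monom[OF m(1) u] log_monom_eq_0[OF True] by (rule fm.span_zero)
    next
      case False
      show ?thesis unfolding m(2) gen_times_log_monom[OF m(1) u]
        by (intro fm.span_base imageI CollectI allowed_shift[OF m(1) u False])
    qed
    then have "fmult (const c) (gen l u * x) + gen l u * y \<in> fm.span (log_monom l {} ` {m. allowed l E {} m})"
      by (intro fm.span_add fm.span_scale step)
    also have "fmult (const c) (gen l u * x) + gen l u * y = gen l u * (fmult (const c) x + y)"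
      by (auto simp: fmult_def fun_eq_iff algebra_simps)
    finally show ?case .
  qed
  consider "u \<in> yz l" | "u \<in> {1..l}" | "u > 2 * l" by (auto simp: yz_def) linarith
  then show ?thesis
  proof cases
    case 2
    then have "gen l (l + u) * \<omega> + gen l 0 * \<omega> \<in> Omega1_graph l E"
      by (intro fm.subspace_add[OF subspace_Omega1[OF sg]] yzcase) (auto simp: yz_def)
    then show ?thesis unfolding gen_x[OF 2] distrib_right .
  next
    case 3
    then have "gen l u * \<omega> = 0" by (auto simp: gen_def fun_eq_iff)
    then show ?thesis using fm.subspace_0[OF subspace_Omega1[OF sg]] by simp
  qed (rule yzcase)
qed

section \<open>Comparison of the Cech complexes for the two sets of generators\<close>

lemma scaled_cech_gen:
  assumes sg: "simple_graph {1..l} E" and l: "1 \<le> l"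
  shows "scaled_cech (gen l) (Omega1_graph l E :: 'k::field form1 set) (form_degree l) const"
proof
  let ?M = "Omega1_graph l E :: 'k form1 set"
  note sub = subspace_Omega1[OF sg, where 'k = 'k]
  show "0 \<in> ?M" by (rule fm.subspace_0[OF sub])
  show "m - m' \<in> ?M" if "m \<in> ?M" "m' \<in> ?M" for m m' by (rule fm.subspace_diff[OF sub that])
  show "gen l u * m \<in> ?M" if "m \<in> ?M" for m u by (rule Omega1_gen_mem[OF sg that])
  \<comment> \<open>\<open>1 \<le> l\<close> makes the value \<open>var 1\<close> of
    \<open>zcoord\<close> outside \<open>{1..l}\<close> a variable of the ring, hence homogeneous
    there.\<close>
  have gen: "gen l u i \<in> rat_homogeneous l 1" for u i
    using l by (auto simp: gen_def zcoord_def intro!: rat_homogeneous_diff rat_homogeneous_var rat_homogeneous_zero)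
  show "gen l u \<in> (form_degree l 1 :: 'k form1 set)" for u by (simp add: form_degree_def gen)
  show "pinv (gen l u) \<in> (form_degree l (-1) :: 'k form1 set)" for u
    by (simp add: form_degree_def pinv_def rat_homogeneous_inverse[OF gen])
  show "(0 :: 'k form1) \<in> form_degree l n" for n by (simp add: form_degree_def rat_homogeneous_zero)
  show "x - y \<in> form_degree l n" if "x \<in> form_degree l n" "y \<in> form_degree l n" for x y :: "'k form1" and n
    using that by (simp add: form_degree_def rat_homogeneous_diff)
  show "x * y \<in> form_degree l (n + n')" if "x \<in> form_degree l n" "y \<in> form_degree l n'" for x y :: "'k form1" and n n'
    using that by (simp add: form_degree_def rat_homogeneous_mult)
  show "(1 :: 'k form1) \<in> form_degree l 0"
    using rat_homogeneous_const[of 1 l] by (simp add: form_degree_def)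
  show "(\<lambda>_. const a) \<in> (form_degree l 0 :: 'k form1 set)" for a
    by (simp add: form_degree_def rat_homogeneous_const)
  show "(\<lambda>_. const a) * m \<in> ?M" if "m \<in> ?M" for a m
    using fm.subspace_scale[OF sub that, of a] by (simp add: fmult_def times_fun_def)
qed simp_all

lemma cech_cochains_eq:
  assumes sg: "simple_graph {1..l} E" and l: "1 \<le> l"
  shows "cech_cochains l (Omega1_graph l E :: 'k::field form1 set) p = cochains (gen l) (Omega1_graph l E) {1..l} p"
proof -
  let ?M = "Omega1_graph l E :: 'k form1 set"
  interpret scaled_cech "gen l" ?M "form_degree l" const by (rule scaled_cech_gen[OF sg l])
  have "localize ?M (\<Prod>i\<in>F. var i) = loc ?M (\<Prod>v\<in>F. gen l v)" if F: "F \<subseteq> {1..l}" for F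
  proof -
    let ?f = "\<Prod>i\<in>F. var i :: 'k ratfun"
    have f0: "?f \<noteq> 0" using finite_subset[OF F] by simp
    have h: "(\<Prod>v\<in>F. gen l v) = (\<lambda>_. ?f)"
      using F by (auto simp: fun_eq_iff prod_fun_apply gen_def intro!: prod.cong)
    have pw: "pinv (\<lambda>_::nat. ?f) ^ n = (\<lambda>_. 1 / ?f ^ n)" for n
      by (auto simp: fun_eq_iff pinv_def power_fun_apply divide_inverse power_inverse)
    show ?thesis
    proof
      show "localize ?M ?f \<subseteq> loc ?M (\<Prod>v\<in>F. gen l v)"
      proof
        fix x assume "x \<in> localize ?M ?f"
        then obtain m n where m: "m \<in> ?M" "x = fmult (1 / ?f ^ n) m" by (auto simp: localize_def)
        \<comment> \<open>One extra factor above and below passes from the exponent \<open>n\<close>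
          of \<open>localize\<close> to the exponent \<open>Suc n\<close> of \<open>loc\<close>.
          Nothing is lost, as a product of variables has no zero component.\<close>
        have "(\<Prod>v\<in>F. gen l v) * m \<in> ?M" by (rule multipliersD[OF prod_multipliers m(1)])
        moreover have "x = ((\<Prod>v\<in>F. gen l v) * m) * pinv (\<Prod>v\<in>F. gen l v) ^ Suc n"
          unfolding h pw m(2) using f0 by (auto simp: fun_eq_iff fmult_def)
        ultimately show "x \<in> loc ?M (\<Prod>v\<in>F. gen l v)" by (rule locI)
      qed
      show "loc ?M (\<Prod>v\<in>F. gen l v) \<subseteq> localize ?M ?f"
      proof
        fix x assume "x \<in> loc ?M (\<Prod>v\<in>F. gen l v)"
        then obtain m n where m: "m \<in> ?M" "x = m * pinv (\<Prod>v\<in>F. gen l v) ^ Suc n" by (auto simp: loc_def)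
        have "x = fmult (1 / ?f ^ Suc n) m"
          unfolding m(2) h pw by (auto simp: fun_eq_iff fmult_def simp del: power_Suc)
        then show "x \<in> localize ?M ?f" using m(1) unfolding localize_def by blast
      qed
    qed
  qed
  then show ?thesis unfolding cech_cochains_def cochains_def by auto
qed

lemma cech_diff_eq: "cech_diff l c = cdiff (gen l) {1..l} (c :: 'k::field cochain)"
proof
  fix F
  show "cech_diff l c F = cdiff (gen l) {1..l} c F"
  proof (cases "F \<subseteq> {1..l}")
    case True
    have "fmult ((-1) ^ position v F) (c (F - {v})) = (-1) ^ position v F * (idem (gen l v) * c (F - {v}))"
      if "v \<in> F" for v
    proof
      fix i
      have "gen l v i = (var v :: 'k ratfun)" using True that by (auto simp: gen_def)
      then show "fmult ((-1) ^ position v F) (c (F - {v})) i = ((-1) ^ position v F * (idem (gen l v) * c (F - {v}))) i"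
        by (simp add: fmult_def idem_apply power_fun_apply)
    qed
    then show ?thesis using True by (simp add: cech_diff_def cdiff_def)
  next
    case False
    then show ?thesis by (simp add: cech_diff_def cdiff_def)
  qed
qed

lemma cochain_scale_eq: "cochain_scale = (cscale const :: 'k::field \<Rightarrow> 'k cochain \<Rightarrow> 'k cochain)"
  by (auto simp: cochain_scale_def cscale_def fmult_def fun_eq_iff)

text \<open>Neither set of generators contains the other, so both are compared with their union
  \<open>{0..2 * l}\<close>. One direction is \<open>x_u = y_u + z\<close>; the other uses
  \<open>in_rad_roots\<close> for \<open>z\<close> and then \<open>y_u = x_u - z\<close>.\<close>

theorem local_cohomology_yz:
  assumes sg: "simple_graph {1..l} E" and l: "1 \<le> l"
  shows "has_qdim cochain_scale (local_cocycles l (Omega1_graph l E) p d)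
      (local_coboundaries l (Omega1_graph l E :: 'k::field form1 set) p d) n \<longleftrightarrow>
    has_qdim (cscale const) (cocycles (gen l) (Omega1_graph l E :: 'k form1 set) (form_degree l) (yz l) p d)
      (coboundaries (gen l) (Omega1_graph l E) (form_degree l) (yz l) p d) n"
proof -
  let ?M = "Omega1_graph l E :: 'k form1 set"
  interpret scaled_cech "gen l" ?M "form_degree l" const by (rule scaled_cech_gen[OF sg l])
  have cocyc: "local_cocycles l ?M p d = cocycles (gen l) ?M (form_degree l) {1..l} p d"
    unfolding local_cocycles_def cocycles_def cech_cochains_eq[OF sg l] cech_diff_eq cochain_degree_def form_degree_def
    by auto
  have cobd: "local_coboundaries l ?M p d = coboundaries (gen l) ?M (form_degree l) {1..l} p d"
    unfolding local_coboundaries_def coboundaries_def cech_cochains_eq[OF sg l] cech_diff_eq[abs_def]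
      cochain_degree_def form_degree_def
    by auto
  have yz_rad: "in_rad (yz l) (gen l u)" if "u \<in> {1..l}" for u
    unfolding gen_x[OF that] by (intro in_rad_add in_rad_gen) (use that in \<open>auto simp: yz_def\<close>)
  have z_rad: "in_rad {1..l} (gen l 0)"
  proof (rule in_rad_roots)
    show "(\<Prod>u\<in>{1..l}. gen l 0 - gen l u) = (0 :: 'k form1)"
    proof
      fix i
      have "(\<Prod>u\<in>{1..l}. (gen l 0 - gen l u) i) = (0 :: 'k ratfun)"
        \<comment> \<open>At component \<open>i\<close> the factor with \<open>u = i\<close>
          vanishes; outside \<open>{1..l}\<close> it is the one with \<open>u = 1\<close>, by the
          choice of \<open>zcoord\<close>.\<close>
        by (rule prod_zero, simp, rule bexI[of _ "if i \<in> {1..l} then i else 1"]) (use l in \<open>auto simp: gen_def zcoord_def\<close>)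
      then show "(\<Prod>u\<in>{1..l}. gen l 0 - gen l u) i = (0 :: 'k form1) i"
        unfolding prod_fun_apply by simp
    qed
  qed (auto simp: gen_multipliers D_gen)
  have y_rad: "in_rad {1..l} (gen l (l + u))" if u: "u \<in> {1..l}" for u
  proof -
    have "in_rad {1..l} (gen l u + (- gen l 0))"
      by (intro in_rad_add in_rad_gen in_rad_uminus z_rad) (use u in auto)
    also have "gen l u + (- gen l 0) = (gen l (l + u) :: 'k form1)" unfolding gen_x[OF u] by simp
    finally show ?thesis .
  qed
  have "has_qdim (cscale const) (cocycles (gen l) ?M (form_degree l) {0..2 * l} p d)
      (coboundaries (gen l) ?M (form_degree l) {0..2 * l} p d) n \<longleftrightarrow>
    has_qdim (cscale const) (cocycles (gen l) ?M (form_degree l) {1..l} p d)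
      (coboundaries (gen l) ?M (form_degree l) {1..l} p d) n"
  proof (rule cocycles_cong_dims)
    fix v assume "v \<in> {0..2 * l} - {1..l}"
    then have "v = 0 \<or> (v = l + (v - l) \<and> v - l \<in> {1..l})" by auto
    then show "in_radical {1..l} v"
      using in_radicalI[OF z_rad] in_radicalI[OF y_rad] by metis
  qed auto
  moreover have "has_qdim (cscale const) (cocycles (gen l) ?M (form_degree l) {0..2 * l} p d)
      (coboundaries (gen l) ?M (form_degree l) {0..2 * l} p d) n \<longleftrightarrow>
    has_qdim (cscale const) (cocycles (gen l) ?M (form_degree l) (yz l) p d)
      (coboundaries (gen l) ?M (form_degree l) (yz l) p d) n"
  proof (rule cocycles_cong_dims)
    fix v assume "v \<in> {0..2 * l} - yz l"
    then have "v \<in> {1..l}" by (auto simp: yz_def)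
    then show "in_radical (yz l) v" by (intro in_radicalI yz_rad)
  qed (auto simp: yz_def)
  ultimately show ?thesis unfolding cocyc cobd cochain_scale_eq by simp
qed

section \<open>The multigraded description\<close>

text \<open>Both inclusions are checked on monomials: after localization a monomial is again an
  allowed one or zero, and each allowed monomial arises in this way by
  \<open>allowed_unlocalize\<close>.\<close>

lemma span_log_monom_localized:
  assumes sg: "simple_graph {1..l} E" and l: "1 \<le> l" and F: "F \<subseteq> yz l"
  shows "loc (Omega1_graph l E) (\<Prod>v\<in>F. gen l v) =
    (fm.span (log_monom l F ` {m. allowed l E F m}) :: 'k::field form1 set)"
proof
  let ?M = "Omega1_graph l E :: 'k form1 set"
  interpret scaled_cech "gen l" ?M "form_degree l" const by (rule scaled_cech_gen[OF sg l])
  let ?h = "\<Prod>v\<in>F. gen l v :: 'k form1"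
  let ?S = "fm.span (log_monom l F ` {m. allowed l E F m}) :: 'k form1 set"
  show "loc ?M ?h \<subseteq> ?S"
  proof
    fix x assume "x \<in> loc ?M ?h"
    then obtain \<omega> n where \<omega>: "\<omega> \<in> ?M" "x = \<omega> * pinv ?h ^ Suc n" by (auto simp: loc_def)
    from \<omega>(1) have "\<omega> * pinv ?h ^ Suc n \<in> ?S"
      unfolding Omega1_span[OF sg]
    proof (induction rule: fm.span_induct_alt)
      case base
      show ?case unfolding mult_zero_left by (rule fm.span_zero)
    next
      case (step c x y)
      then obtain m where m: "allowed l E {} m" "x = log_monom l {} m" by blast
      have "x * pinv ?h ^ Suc n \<in> ?S"
      proof (cases "negs l F (shift F (- int (Suc n)) m) = {}")
        case True
        show ?thesis unfolding m(2) log_monom_localize[OF F] log_monom_eq_0[OF True] by (rule fm.span_zero)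
      next
        case False
        show ?thesis unfolding m(2) log_monom_localize[OF F]
          by (intro fm.span_base imageI CollectI allowed_localize[OF m(1) F False])
      qed
      then have "fmult (const c) (x * pinv ?h ^ Suc n) + y * pinv ?h ^ Suc n \<in> ?S"
        by (intro fm.span_add fm.span_scale step)
      also have "fmult (const c) (x * pinv ?h ^ Suc n) + y * pinv ?h ^ Suc n = (fmult (const c) x + y) * pinv ?h ^ Suc n"
        by (auto simp: fmult_def fun_eq_iff algebra_simps)
      finally show ?case .
    qed
    then show "x \<in> ?S" by (simp only: \<omega>(2))
  qed
  have hm: "?h \<in> multipliers" by (rule prod_multipliers)
  show "?S \<subseteq> loc ?M ?h"
  proof (rule fm.span_minimal)
    show "fm.subspace (loc ?M ?h)"
    proof (rule fm.subspaceI)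
      show "fmult (const c) x \<in> loc ?M ?h" if "x \<in> loc ?M ?h" for c x
        using mult_loc[OF K_multipliers that, of c] by (simp add: fmult_def times_fun_def)
    qed (auto intro: zero_loc add_loc[OF hm])
    show "log_monom l F ` {m. allowed l E F m} \<subseteq> loc ?M ?h"
    proof clarify
      fix m assume m: "allowed l E F m"
      obtain n where n: "allowed l E {} (shift F (int (Suc n)) m)" using allowed_unlocalize[OF m F] by blast
      have "shift F (- int (Suc n)) (shift F (int (Suc n)) m) = m" by (auto simp: shift_def)
      then have "log_monom l F m = log_monom l {} (shift F (int (Suc n)) m) * pinv ?h ^ Suc n"
        using log_monom_localize[OF F, of "shift F (int (Suc n)) m" n, where 'k = 'k] by simp
      then show "log_monom l F m \<in> loc ?M ?h"
        by (rule locI[rotated]) (rule log_monom_mem[OF sg n])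
    qed
  qed
qed

text \<open>A single component \<open>i\<close> in the support of \<open>m0\<close> suffices: all
  monomials that are nonzero there have entry -1 at \<open>l + i\<close>, the one entry which that
  component does not show.\<close>

lemma log_monom_indep:
  assumes T: "finite T" "\<And>m. m \<in> T \<Longrightarrow> allowed l E F m" and m0: "m0 \<in> T"
    and 0: "\<And>i. (\<Sum>m\<in>T. const (c m) * log_monom l F m i) = (0 :: 'k::field ratfun)"
  shows "c m0 = 0"
proof -
  have "negs l F m0 \<noteq> {}" using T(2)[OF m0] by (simp add: allowed_def)
  then obtain i where i: "i \<in> negs l F m0" by blast
  then have il: "i \<in> {1..l}" by (simp add: negs_def)
  let ?T = "{m \<in> T. i \<in> negs l F m}"
  have "(\<Sum>m\<in>?T. const (c m) * laurent_monom l i m) = (\<Sum>m\<in>T. const (c m) * log_monom l F m i :: 'k ratfun)"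
    using T(1) by (intro sum.mono_neutral_cong_left) (auto simp: log_monom_def)
  then have z: "(\<Sum>m\<in>?T. const (c m) * laurent_monom l i m) = (0 :: 'k ratfun)" using 0 by simp
  show ?thesis
  proof (rule laurent_monom_indep[OF il _ _ _ z])
    show "m u = 0" if "m \<in> ?T" "u \<notin> yz l" for m u using T(2)[of m] that by (simp add: allowed_def)
    show "m (l + i) = -1" if "m \<in> ?T" for m using that by (simp add: negs_def)
  qed (use T m0 i in auto)
qed

section \<open>Cochains as finitely supported families of coefficients\<close>

definition total_degree :: "nat \<Rightarrow> (nat \<Rightarrow> int) \<Rightarrow> int" where
  "total_degree l m = (\<Sum>u\<in>yz l. m u)"

text \<open>The extra 1 arises because component \<open>i\<close> omits the factor
  \<open>y_i\<close> of exponent -1, in accordance with \<open>dx_i\<close> having degree 0.\<close>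

lemma log_monom_degree: "log_monom l F m i \<in> rat_homogeneous l (total_degree l m + 1)"
proof (cases "i \<in> negs l F m")
  case True
  then have i: "i \<in> {1..l}" "m (l + i) = -1" by (auto simp: negs_def)
  have "(\<Prod>j\<in>{1..l} - {i}. (var j - var i) powi m (l + j)) \<in> rat_homogeneous l (\<Sum>j\<in>{1..l} - {i}. m (l + j) * 1)"
    using i by (intro rat_homogeneous_prod rat_homogeneous_powi rat_homogeneous_diff rat_homogeneous_var) auto
  moreover have "var i powi m 0 \<in> rat_homogeneous l (m 0 * 1)"
    using i by (intro rat_homogeneous_powi rat_homogeneous_var)
  ultimately have "laurent_monom l i m \<in> rat_homogeneous l (m 0 * 1 + (\<Sum>j\<in>{1..l} - {i}. m (l + j) * 1))"
    unfolding laurent_monom_def by (intro rat_homogeneous_mult)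
  moreover have "m 0 * 1 + (\<Sum>j\<in>{1..l} - {i}. m (l + j) * 1) = total_degree l m + 1"
  proof -
    have "total_degree l m = m 0 + (\<Sum>j\<in>{1..l}. m (l + j))"
    proof -
      have "(\<Sum>u\<in>(+) l ` {1..l}. m u) = (\<Sum>j\<in>{1..l}. m (l + j))"
        using sum.reindex[of "(+) l" "{1..l}" m] by (simp only: inj_on_add comp_def)
      moreover have "(0::nat) \<notin> (+) l ` {1..l}" by auto
      ultimately show ?thesis unfolding total_degree_def yz_image by (subst sum.insert) simp_all
    qed
    also have "(\<Sum>j\<in>{1..l}. m (l + j)) = m (l + i) + (\<Sum>j\<in>{1..l} - {i}. m (l + j))"
      by (rule sum.remove) (use i in auto)
    finally show ?thesis using i by simp
  qed
  ultimately show ?thesis using True by (simp add: log_monom_def)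
qed (simp add: log_monom_def rat_homogeneous_zero)

type_synonym 'k coeffs = "nat set \<Rightarrow> (nat \<Rightarrow> int) \<Rightarrow> 'k"

definition coeff_space :: "nat \<Rightarrow> nat set set \<Rightarrow> nat set \<Rightarrow> ((nat \<Rightarrow> int) \<Rightarrow> 'k::field) set" where
  "coeff_space l E F = {c. finite {m. c m \<noteq> 0} \<and> (\<forall>m. c m \<noteq> 0 \<longrightarrow> allowed l E F m)}"

definition expand :: "nat \<Rightarrow> nat set \<Rightarrow> ((nat \<Rightarrow> int) \<Rightarrow> 'k::field) \<Rightarrow> 'k form1" where
  "expand l F c = (\<Sum>m | c m \<noteq> 0. fmult (const (c m)) (log_monom l F m))"

definition coeff_cochains :: "nat \<Rightarrow> nat set set \<Rightarrow> int \<Rightarrow> 'k::field coeffs set" where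
  "coeff_cochains l E p = {C. \<forall>F. if F \<subseteq> yz l \<and> int (card F) = p then C F \<in> coeff_space l E F else C F = 0}"

text \<open>All coefficients of the localization maps are 1 in this basis. The cutoff is needed
  because a monomial allowed for \<open>F - {v}\<close> can lose its whole support when
  \<open>v\<close> is inverted, and then becomes zero.\<close>

definition coeff_diff :: "nat \<Rightarrow> nat set set \<Rightarrow> 'k::field coeffs \<Rightarrow> 'k coeffs" where
  "coeff_diff l E C = (\<lambda>F m. if F \<subseteq> yz l \<and> allowed l E F m
     then \<Sum>v\<in>F. (-1) ^ position v F * C (F - {v}) m else 0)"

lemma expand_superset:
  "finite T \<Longrightarrow> {m. c m \<noteq> 0} \<subseteq> T \<Longrightarrow> expand l F c = (\<Sum>m\<in>T. fmult (const (c m)) (log_monom l F m))"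
  unfolding expand_def by (rule sum.mono_neutral_left) (auto simp: fmult_def)

lemma coeff_cochainsD:
  assumes "C \<in> coeff_cochains l E p"
  shows "finite {m. C F m \<noteq> 0}" "C F m \<noteq> 0 \<Longrightarrow> allowed l E F m" "C F m \<noteq> 0 \<Longrightarrow> F \<subseteq> yz l \<and> int (card F) = p"
proof -
  have C: "if F \<subseteq> yz l \<and> int (card F) = p then C F \<in> coeff_space l E F else C F = 0"
    using assms by (auto simp: coeff_cochains_def)
  show "finite {m. C F m \<noteq> 0}" using C by (auto simp: coeff_space_def split: if_splits)
  show "C F m \<noteq> 0 \<Longrightarrow> allowed l E F m" using C by (auto simp: coeff_space_def split: if_splits)
  show "C F m \<noteq> 0 \<Longrightarrow> F \<subseteq> yz l \<and> int (card F) = p" using C by (auto split: if_splits)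
qed

lemma coeff_cochainsI:
  assumes "\<And>F. finite {m. C F m \<noteq> 0}" "\<And>F m. C F m \<noteq> 0 \<Longrightarrow> allowed l E F m \<and> F \<subseteq> yz l \<and> int (card F) = p"
  shows "C \<in> coeff_cochains l E p"
  unfolding coeff_cochains_def
proof (intro CollectI allI)
  fix F
  show "if F \<subseteq> yz l \<and> int (card F) = p then C F \<in> coeff_space l E F else C F = 0"
  proof (cases "F \<subseteq> yz l \<and> int (card F) = p")
    case True
    then show ?thesis using assms by (simp add: coeff_space_def)
  next
    case False
    then have "C F m = 0" for m using assms(2)[of F m] by blast
    then have "C F = 0" by (simp add: fun_eq_iff)
    then show ?thesis unfolding if_not_P[OF False] .
  qed
qed

lemma expand_0 [simp]: "expand l F 0 = 0"
  by (simp add: expand_def)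

lemma expand_inj:
  assumes c: "c \<in> coeff_space l E F" and c': "c' \<in> coeff_space l E F" and eq: "expand l F c = expand l F c'"
  shows "c = c'"
proof
  fix m0
  let ?T = "{m. c m \<noteq> 0} \<union> {m. c' m \<noteq> 0}"
  have fin: "finite ?T" using c c' by (simp add: coeff_space_def)
  have "(\<Sum>m\<in>?T. const (c m - c' m) * log_monom l F m i) = 0" for i
  proof -
    have "(\<Sum>m\<in>?T. const (c m - c' m) * log_monom l F m i) = expand l F c i - expand l F c' i"
      by (subst (1 2) expand_superset[OF fin])
        (auto simp: fmult_def sum_fun_apply left_diff_distrib sum_subtractf)
    then show ?thesis using eq by simp
  qed
  note z = this
  show "c m0 = c' m0"
  proof (cases "m0 \<in> ?T")
    case True
    have "c m0 - c' m0 = 0"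
      by (rule log_monom_indep[OF fin _ True z]) (use c c' in \<open>auto simp: coeff_space_def\<close>)
    then show ?thesis by simp
  qed auto
qed

lemma expand_image:
  "(expand l F ` coeff_space l E F :: 'k::field form1 set) = fm.span (log_monom l F ` {m. allowed l E F m})"
proof
  show "(expand l F ` coeff_space l E F :: 'k form1 set) \<subseteq> fm.span (log_monom l F ` {m. allowed l E F m})"
  proof
    fix x :: "'k form1" assume "x \<in> expand l F ` coeff_space l E F"
    then obtain c where c: "c \<in> coeff_space l E F" "x = expand l F c" by blast
    show "x \<in> fm.span (log_monom l F ` {m. allowed l E F m})"
      unfolding c(2) expand_def
      by (intro fm.span_sum fm.span_scale, rule fm.span_base) (use c(1) in \<open>auto simp: coeff_space_def\<close>)
  qed
  show "fm.span (log_monom l F ` {m. allowed l E F m}) \<subseteq> (expand l F ` coeff_space l E F :: 'k form1 set)"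
  proof
    fix x :: "'k form1" assume "x \<in> fm.span (log_monom l F ` {m. allowed l E F m})"
    from fm.span_image_obtain[OF this] obtain T c where T: "finite T" "T \<subseteq> {m. allowed l E F m}"
      "x = (\<Sum>m\<in>T. fmult (const (c m)) (log_monom l F m))" .
    let ?c = "\<lambda>m. if m \<in> T then c m else 0"
    have "expand l F ?c = (\<Sum>m\<in>T. fmult (const (?c m)) (log_monom l F m))"
      by (rule expand_superset[OF T(1)]) auto
    also have "\<dots> = x" unfolding T(3) by (intro sum.cong) auto
    finally have "x = expand l F ?c" by simp
    moreover have "?c \<in> coeff_space l E F" using T by (auto simp: coeff_space_def intro: finite_subset[of _ T])
    ultimately show "x \<in> expand l F ` coeff_space l E F" by blast
  qed
qed

lemma expand_degree:
  assumes c: "c \<in> coeff_space l E F"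
  shows "expand l F c \<in> form_degree l d \<longleftrightarrow> (\<forall>m. c m \<noteq> 0 \<longrightarrow> total_degree l m + 1 = d)"
proof
  have fin: "finite {m. c m \<noteq> 0}" using c by (simp add: coeff_space_def)
  have comp: "expand l F c i = (\<Sum>m | c m \<noteq> 0. const (c m) * log_monom l F m i)" for i
    by (simp add: expand_def sum_fun_apply fmult_def)
  have homog: "const (c m) * log_monom l F m i \<in> rat_homogeneous l (total_degree l m + 1)" for m i
    using rat_homogeneous_mult[OF rat_homogeneous_const log_monom_degree, of "c m" l F m i] by simp
  {
    assume "\<forall>m. c m \<noteq> 0 \<longrightarrow> total_degree l m + 1 = d"
    then show "expand l F c \<in> form_degree l d"
      unfolding form_degree_def comp mem_Collect_eq using homog by (auto intro!: rat_homogeneous_sum)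
  }
  {
    assume x: "expand l F c \<in> form_degree l d"
    show "\<forall>m. c m \<noteq> 0 \<longrightarrow> total_degree l m + 1 = d"
    proof (intro allI impI, rule ccontr)
      fix m0 assume m0: "c m0 \<noteq> 0" and ne: "total_degree l m0 + 1 \<noteq> d"
      define deg where "deg m = total_degree l m + 1" for m
      let ?S = "{m. c m \<noteq> 0}"
      let ?T = "insert d (deg ` ?S)"
      have "(\<Sum>m\<in>{m \<in> ?S. deg m = deg m0}. const (c m) * log_monom l F m i) = 0" for i
      proof -
        \<comment> \<open>The homogeneous parts of the expansion, with the whole form subtracted in
          its own degree \<open>d\<close>. They add up to 0, so the part in any other degree
          vanishes.\<close>
        define f where "f n = (\<Sum>m\<in>{m \<in> ?S. deg m = n}. const (c m) * log_monom l F m i) - (if n = d then expand l F c i else 0)" for n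
        have "f (deg m0) = 0"
        proof (rule homogeneous_sum_eq_0)
          show "finite ?T" using fin by simp
          show "deg m0 \<in> ?T" using m0 by simp
          show "f n \<in> rat_homogeneous l n" for n
            unfolding f_def using x homog
            by (intro rat_homogeneous_diff rat_homogeneous_sum) (auto simp: form_degree_def deg_def rat_homogeneous_zero)
          have "(\<Sum>n\<in>?T. f n) = (\<Sum>n\<in>?T. \<Sum>m\<in>{m \<in> ?S. deg m = n}. const (c m) * log_monom l F m i) -
              (\<Sum>n\<in>?T. if n = d then expand l F c i else 0)"
            unfolding f_def by (rule sum_subtractf)
          also have "(\<Sum>n\<in>?T. \<Sum>m\<in>{m \<in> ?S. deg m = n}. const (c m) * log_monom l F m i) = expand l F c i"
            unfolding comp using fin by (intro sum.group) auto
          also have "(\<Sum>n\<in>?T. if n = d then expand l F c i else 0) = expand l F c i" using fin by simp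
          finally show "(\<Sum>n\<in>?T. f n) = 0" by simp
        qed
        then show ?thesis using ne by (simp add: f_def deg_def)
      qed
      from log_monom_indep[OF _ _ _ this, of E m0] have "c m0 = 0"
        using fin c m0 by (auto simp: coeff_space_def)
      then show False using m0 by simp
    qed
  }
qed

lemma idem_gen_log_monom:
  assumes "v \<in> yz l" "v \<notin> F"
  shows "idem (gen l v) * log_monom l F m = (log_monom l (insert v F) m :: 'k::field form1)"
proof
  fix i
  show "(idem (gen l v) * log_monom l F m) i = (log_monom l (insert v F) m i :: 'k ratfun)"
  proof (cases "i \<in> {1..l}")
    case True
    then have "gen l v i = (0 :: 'k ratfun) \<longleftrightarrow> v = l + i"
      using assms(1) by (auto simp: gen_def zcoord_def yz_def var_inj)
    then show ?thesis by (auto simp: log_monom_def negs_def idem_apply)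
  next
    case False
    then have "i \<notin> negs l F m" "i \<notin> negs l (insert v F) m" by (auto simp: negs_def)
    then show ?thesis by (simp add: log_monom_def)
  qed
qed

lemma allowed_insert: "allowed l E F m \<Longrightarrow> F \<subseteq> F' \<Longrightarrow> negs l F' m \<noteq> {} \<Longrightarrow> allowed l E F' m"
proof -
  assume m: "allowed l E F m" and F: "F \<subseteq> F'" and ne: "negs l F' m \<noteq> {}"
  have "negs l F m \<in> clique_complex {1..l} E" using m by (simp only: allowed_def)
  moreover have "negs l F' m \<subseteq> negs l F m" using F by (auto simp: negs_def)
  ultimately have "negs l F' m \<in> clique_complex {1..l} E" by (rule clique_complex_subset)
  then show ?thesis using m F ne unfolding allowed_def by blast
qed

lemma mult_fmult: "\<omega> * fmult c x = fmult c (\<omega> * x)"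
  by (simp add: fmult_def fun_eq_iff)

lemma expand_coeff_diff:
  assumes C: "C \<in> coeff_cochains l E p" and F: "F \<subseteq> yz l"
  shows "expand l F (coeff_diff l E C F) = cdiff (gen l) (yz l) (\<lambda>F. expand l F (C F :: _ \<Rightarrow> 'k::field)) F"
proof -
  have finF: "finite F" using F finite_subset by (auto simp: yz_def)
  let ?T = "\<Union>v\<in>F. {m. C (F - {v}) m \<noteq> 0}"
  have fin: "finite ?T" using finF coeff_cochainsD(1)[OF C] by auto
  have supp: "{m. coeff_diff l E C F m \<noteq> 0} \<subseteq> ?T"
    by (auto simp: coeff_diff_def split: if_splits intro!: sum.neutral)
  \<comment> \<open>Inverting more generators preserves all conditions of \<open>allowed\<close>
    except nonempty support, so the failure can only be that the monomial has become zero.\<close>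
  have zero: "log_monom l F m = 0" if na: "\<not> allowed l E F m" and mT: "m \<in> ?T" for m
  proof (rule log_monom_eq_0, rule ccontr)
    assume ne: "negs l F m \<noteq> {}"
    obtain v where v: "v \<in> F" "C (F - {v}) m \<noteq> 0" using mT by blast
    then have "allowed l E F m" by (intro allowed_insert[OF coeff_cochainsD(2)[OF C v(2)] _ ne]) auto
    with na show False by simp
  qed
  have "expand l F (coeff_diff l E C F) i = cdiff (gen l) (yz l) (\<lambda>F. expand l F (C F)) F i" for i
  proof -
    have "cdiff (gen l) (yz l) (\<lambda>F. expand l F (C F)) F i =
        (\<Sum>v\<in>F. (-1) ^ position v F * (\<Sum>m\<in>?T. const (C (F - {v}) m) * log_monom l F m i))"
    proof -
      have "idem (gen l v) * expand l (F - {v}) (C (F - {v})) = (\<Sum>m\<in>?T. fmult (const (C (F - {v}) m)) (log_monom l F m))"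
        if v: "v \<in> F" for v
      proof -
        have e: "expand l (F - {v}) (C (F - {v})) = (\<Sum>m\<in>?T. fmult (const (C (F - {v}) m)) (log_monom l (F - {v}) m))"
          by (rule expand_superset[OF fin]) (use v in auto)
        have "idem (gen l v) * expand l (F - {v}) (C (F - {v})) = (\<Sum>m\<in>?T. fmult (const (C (F - {v}) m)) (idem (gen l v) * log_monom l (F - {v}) m))"
          unfolding e by (simp only: sum_distrib_left mult_fmult)
        also have "\<dots> = (\<Sum>m\<in>?T. fmult (const (C (F - {v}) m)) (log_monom l F m))"
        proof -
          have "v \<in> yz l" using v F by blast
          from idem_gen_log_monom[OF this, of "F - {v}", where 'k = 'k]
          have "idem (gen l v) * log_monom l (F - {v}) m = (log_monom l F m :: 'k form1)" for m
            using v by (simp add: insert_absorb)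
          then show ?thesis by (simp only:)
        qed
        finally show ?thesis .
      qed
      then show ?thesis using F
        by (simp add: cdiff_def sum_fun_apply fmult_def power_fun_apply)
    qed
    also have "\<dots> = (\<Sum>m\<in>?T. const (\<Sum>v\<in>F. (-1) ^ position v F * C (F - {v}) m) * log_monom l F m i)"
    proof -
      have cs: "const (\<Sum>v\<in>F. (-1) ^ position v F * C (F - {v}) m) = (\<Sum>v\<in>F. (-1) ^ position v F * const (C (F - {v}) m))" for m
      proof -
        have sg: "const ((-1) ^ n * x) = (-1) ^ n * const x" for n and x :: 'k by (induction n) auto
        have "const (\<Sum>v\<in>A. f v) = (\<Sum>v\<in>A. const (f v))" for A and f :: "nat \<Rightarrow> 'k"
          by (induction A rule: infinite_finite_induct) auto
        then show ?thesis by (simp only: sg)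
      qed
      show ?thesis
        unfolding cs sum_distrib_left sum_distrib_right by (subst sum.swap) (simp only: mult.assoc)
    qed
    also have "\<dots> = (\<Sum>m\<in>?T. const (coeff_diff l E C F m) * log_monom l F m i)"
    proof (intro sum.cong refl)
      fix m assume m: "m \<in> ?T"
      show "const (\<Sum>v\<in>F. (-1) ^ position v F * C (F - {v}) m) * log_monom l F m i =
          const (coeff_diff l E C F m) * log_monom l F m i"
      proof (cases "allowed l E F m")
        case True
        then show ?thesis using F by (simp add: coeff_diff_def)
      next
        case False
        then show ?thesis by (simp add: zero[OF False m])
      qed
    qed
    also have "\<dots> = expand l F (coeff_diff l E C F) i"
      unfolding expand_superset[OF fin supp] by (simp add: sum_fun_apply fmult_def)
    finally show ?thesis by simp
  qed
  then show ?thesis by blast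
qed

section \<open>Comparison with simplicial chains\<close>

text \<open>In \<open>boundary\<close> the range of summation depends on the chain. A common finite
  vertex set makes it uniform, and this is what gives linearity.\<close>

lemma boundary_finite:
  assumes V: "finite V" and c: "\<And>\<sigma>. c \<sigma> \<noteq> 0 \<Longrightarrow> \<sigma> \<subseteq> V"
  shows "boundary c \<tau> = (if \<tau> = {} then 0 else \<Sum>v\<in>V - \<tau>. (-1) ^ position v \<tau> * c (insert v \<tau>))"
proof -
  have "(\<Sum>v | v \<notin> \<tau> \<and> c (insert v \<tau>) \<noteq> 0. (-1) ^ position v \<tau> * c (insert v \<tau>)) =
      (\<Sum>v\<in>V - \<tau>. (-1) ^ position v \<tau> * c (insert v \<tau>))"
    by (rule sum.mono_neutral_left) (use V c in auto)
  then show ?thesis by (simp add: boundary_def)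
qed

lemma chains_finite:
  assumes "finite V" "\<Delta> \<subseteq> Pow V"
  shows "chains \<Delta> k = {c. \<forall>\<sigma>. c \<sigma> \<noteq> 0 \<longrightarrow> \<sigma> \<in> \<Delta> \<and> \<sigma> \<noteq> {} \<and> int (card \<sigma>) = k + 1}"
proof -
  have "finite {\<sigma>. c \<sigma> \<noteq> 0}" if "\<forall>\<sigma>. c \<sigma> \<noteq> 0 \<longrightarrow> \<sigma> \<in> \<Delta> \<and> \<sigma> \<noteq> {} \<and> int (card \<sigma>) = k + 1" for c :: "_ \<Rightarrow> 'a"
    by (rule finite_subset[of _ "Pow V"]) (use that assms in auto)
  then show ?thesis unfolding chains_def by blast
qed

lemma boundary_linear:
  fixes c c' :: "nat set \<Rightarrow> 'k::field"
  assumes "finite V" "\<And>\<sigma>. c \<sigma> \<noteq> 0 \<Longrightarrow> \<sigma> \<subseteq> V" "\<And>\<sigma>. c' \<sigma> \<noteq> 0 \<Longrightarrow> \<sigma> \<subseteq> V"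
  shows "boundary (c + c') = boundary c + boundary c'" "boundary (\<lambda>\<sigma>. a * c \<sigma>) = (\<lambda>\<sigma>. a * boundary c \<sigma>)"
proof -
  have b: "boundary c \<tau> = (if \<tau> = {} then 0 else \<Sum>v\<in>V - \<tau>. (-1) ^ position v \<tau> * c (insert v \<tau>))"
    "boundary c' \<tau> = (if \<tau> = {} then 0 else \<Sum>v\<in>V - \<tau>. (-1) ^ position v \<tau> * c' (insert v \<tau>))" for \<tau>
    by (rule boundary_finite[OF assms(1)], rule assms, assumption)+
  have 1: "boundary (c + c') \<tau> = (if \<tau> = {} then 0 else \<Sum>v\<in>V - \<tau>. (-1) ^ position v \<tau> * (c + c') (insert v \<tau>))" for \<tau>
  proof (rule boundary_finite[OF assms(1)])
    fix \<sigma> assume "(c + c') \<sigma> \<noteq> 0"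
    then have "c \<sigma> \<noteq> 0 \<or> c' \<sigma> \<noteq> 0" by auto
    then show "\<sigma> \<subseteq> V" using assms(2,3) by blast
  qed
  have 2: "boundary (\<lambda>\<sigma>. a * c \<sigma>) \<tau> = (if \<tau> = {} then 0 else \<Sum>v\<in>V - \<tau>. (-1) ^ position v \<tau> * (a * c (insert v \<tau>)))" for \<tau>
    by (rule boundary_finite[OF assms(1)]) (use assms(2) in auto)
  show "boundary (c + c') = boundary c + boundary c'"
    unfolding fun_eq_iff 1 plus_fun_apply b by (simp add: distrib_left sum.distrib)
  show "boundary (\<lambda>\<sigma>. a * c \<sigma>) = (\<lambda>\<sigma>. a * boundary c \<sigma>)"
    unfolding fun_eq_iff 2 b by (simp add: sum_distrib_left mult_ac)
qed

text \<open>A definite description such as \<open>homology_dim\<close> says something only after a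
  finite basis is found. The unit chains on subsets of \<open>V\<close> span, so
  \<open>has_qdim_exists\<close> yields one.\<close>

lemma has_qdim_homology:
  assumes V: "finite V" "\<Delta> \<subseteq> Pow V"
  shows "has_qdim (\<lambda>(a::'k) c \<sigma>. a * c \<sigma>) {c \<in> chains \<Delta> k. boundary c = 0} (boundary ` chains \<Delta> (k + 1))
    (homology_dim TYPE('k::field) k \<Delta>)"
proof -
  let ?s = "\<lambda>(a::'k) (c :: nat set \<Rightarrow> 'k) \<sigma>. a * c \<sigma>"
  interpret vector_space ?s by (rule vector_space_fun)
  have supp: "\<sigma> \<subseteq> V" if "c \<in> chains \<Delta> k" "c \<sigma> \<noteq> 0" for c :: "nat set \<Rightarrow> 'k" and \<sigma> k
    using that V by (auto simp: chains_finite[OF V])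
  have sub: "subspace (chains \<Delta> k)" for k
    unfolding chains_finite[OF V]
    by (rule subspaceI) (auto, (metis add_0)+)
  have b0: "boundary (0 :: nat set \<Rightarrow> 'k) = 0" by (auto simp: boundary_def)
  have subB: "subspace (boundary ` chains \<Delta> (k + 1))"
  proof (rule subspaceI)
    show "(0 :: nat set \<Rightarrow> 'k) \<in> boundary ` chains \<Delta> (k + 1)" by (rule image_eqI[where x = 0]) (simp_all add: b0 subspace_0[OF sub])
  next
    fix x y :: "nat set \<Rightarrow> 'k" assume "x \<in> boundary ` chains \<Delta> (k + 1)" "y \<in> boundary ` chains \<Delta> (k + 1)"
    then obtain c c' where c: "x = boundary c" "y = boundary c'" "c \<in> chains \<Delta> (k + 1)" "c' \<in> chains \<Delta> (k + 1)" by blast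
    have "x + y = boundary (c + c')"
      unfolding c by (rule boundary_linear(1)[symmetric, OF V(1)]) (use c supp in blast)+
    then show "x + y \<in> boundary ` chains \<Delta> (k + 1)" using subspace_add[OF sub c(3,4)] by blast
  next
    fix a and x :: "nat set \<Rightarrow> 'k" assume "x \<in> boundary ` chains \<Delta> (k + 1)"
    then obtain c where c: "x = boundary c" "c \<in> chains \<Delta> (k + 1)" by blast
    have "?s a x = boundary (?s a c)"
      unfolding c by (rule boundary_linear(2)[symmetric, OF V(1), where c' = c]) (use c supp in blast)+
    then show "?s a x \<in> boundary ` chains \<Delta> (k + 1)" using subspace_scale[OF sub c(2)] by blast
  qed
  have subZ: "subspace {c \<in> chains \<Delta> k. boundary c = (0 :: nat set \<Rightarrow> 'k)}"
  proof (rule subspaceI)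
    show "0 \<in> {c \<in> chains \<Delta> k. boundary c = (0 :: nat set \<Rightarrow> 'k)}" using b0 subspace_0[OF sub] by blast
  next
    fix x y assume xy: "x \<in> {c \<in> chains \<Delta> k. boundary c = (0 :: nat set \<Rightarrow> 'k)}" "y \<in> {c \<in> chains \<Delta> k. boundary c = (0 :: nat set \<Rightarrow> 'k)}"
    have "boundary (x + y) = boundary x + boundary y"
      by (rule boundary_linear(1)[OF V(1)]) (use xy supp in blast)+
    then show "x + y \<in> {c \<in> chains \<Delta> k. boundary c = (0 :: nat set \<Rightarrow> 'k)}" using xy subspace_add[OF sub] by simp
  next
    fix a x assume x: "x \<in> {c \<in> chains \<Delta> k. boundary c = (0 :: nat set \<Rightarrow> 'k)}"
    have "boundary (?s a x) = ?s a (boundary x)"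
      by (rule boundary_linear(2)[OF V(1), where c' = x]) (use x supp in blast)+
    then show "?s a x \<in> {c \<in> chains \<Delta> k. boundary c = (0 :: nat set \<Rightarrow> 'k)}"
      using x subspace_scale[OF sub] by (auto simp: fun_eq_iff)
  qed
  have sp: "qspan ?s {c \<in> chains \<Delta> k. boundary c = 0} (boundary ` chains \<Delta> (k + 1)) (Pow V)
      (\<lambda>\<sigma> \<tau>. if \<tau> = \<sigma> then 1 else 0)"
    unfolding qspan_def
  proof
    fix z assume z: "z \<in> {c \<in> chains \<Delta> k. boundary c = (0 :: nat set \<Rightarrow> 'k)}"
    have "z = (\<Sum>a\<in>Pow V. (\<lambda>\<sigma>. z a * (if \<sigma> = a then 1 else 0)))"
    proof
      fix \<sigma>
      have "(\<Sum>a\<in>Pow V. (\<lambda>\<sigma>. z a * (if \<sigma> = a then 1 else 0))) \<sigma> = (\<Sum>a\<in>Pow V. if \<sigma> = a then z a else 0)"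
        unfolding sum_fun_apply by (intro sum.cong) auto
      also have "\<dots> = z \<sigma>" using V(1) supp[of z k \<sigma>] z by (auto simp: sum.delta)
      finally show "z \<sigma> = (\<Sum>a\<in>Pow V. (\<lambda>\<sigma>. z a * (if \<sigma> = a then 1 else 0))) \<sigma>" by simp
    qed
    from iffD2[OF right_minus_eq this]
    have z0: "z - (\<Sum>a\<in>Pow V. (\<lambda>\<sigma>. z a * (if \<sigma> = a then 1 else 0))) = 0" .
    then show "\<exists>c. z - (\<Sum>a\<in>Pow V. (\<lambda>\<sigma>. c a * (if \<sigma> = a then 1 else 0))) \<in> boundary ` chains \<Delta> (k + 1)"
      by (intro exI[of _ z]) (simp only: z0 subspace_0[OF subB])
  qed
  have fin: "finite (Pow V)" using V(1) by simp
  obtain n where n: "has_qdim ?s {c \<in> chains \<Delta> k. boundary c = 0} (boundary ` chains \<Delta> (k + 1)) n"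
    using has_qdim_exists[OF vector_space_fun subB subZ fin sp] by blast
  have "homology_dim TYPE('k) k \<Delta> = n"
    unfolding homology_dim_def by (rule dim_quotient_eq(1)[OF vector_space_fun subB n])
  with n show ?thesis by (simp only:)
qed

section \<open>Multidegrees with negative entries and chains of clique complexes\<close>

definition neg_degree :: "nat \<Rightarrow> (nat \<Rightarrow> int) \<Rightarrow> bool" where
  "neg_degree l m \<longleftrightarrow> (\<forall>u. u \<notin> yz l \<longrightarrow> m u = 0) \<and> (\<forall>u\<in>yz l. m u < 0)"

definition minus_ones :: "nat \<Rightarrow> (nat \<Rightarrow> int) \<Rightarrow> nat set" where
  "minus_ones l m = {j \<in> {1..l}. m (l + j) = -1}"

text \<open>In such a multidegree \<open>z\<close> is always inverted, and a Cech index set is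
  recorded by the \<open>j\<close> at which \<open>y_j\<close> is not inverted; these form the
  simplex. Its complement has \<open>l + 1 - card \<sigma>\<close> elements, so Cech degree
  \<open>p\<close> becomes dimension \<open>l - p\<close>.\<close>

definition complement :: "nat \<Rightarrow> nat set \<Rightarrow> nat set" where
  "complement l \<sigma> = insert 0 ((+) l ` ({1..l} - \<sigma>))"

definition uncomplement :: "nat \<Rightarrow> nat set \<Rightarrow> nat set" where
  "uncomplement l F = {j \<in> {1..l}. l + j \<notin> F}"

definition vertex_sign :: "nat set \<Rightarrow> 'k::comm_ring_1" where
  "vertex_sign \<sigma> = (\<Prod>v\<in>\<sigma>. (-1) ^ v)"

text \<open>The signs \<open>vertex_sign\<close> turn the Cech differential into the simplicial boundary.\<close>

definition to_chain :: "nat \<Rightarrow> 'k::field coeffs \<Rightarrow> (nat \<Rightarrow> int) \<Rightarrow> nat set \<Rightarrow> 'k" where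
  "to_chain l C m = (\<lambda>\<sigma>. if \<sigma> \<subseteq> {1..l} then vertex_sign \<sigma> * C (complement l \<sigma>) m else 0)"

definition of_chain :: "nat \<Rightarrow> ((nat \<Rightarrow> int) \<Rightarrow> nat set \<Rightarrow> 'k::field) \<Rightarrow> 'k coeffs" where
  "of_chain l b F m = (if F \<subseteq> yz l \<and> 0 \<in> F then vertex_sign (uncomplement l F) * b m (uncomplement l F) else 0)"

abbreviation minus_one_cliques :: "nat \<Rightarrow> nat set set \<Rightarrow> (nat \<Rightarrow> int) \<Rightarrow> nat set set" where
  "minus_one_cliques l E m \<equiv> clique_complex (minus_ones l m) (induced_edges E (minus_ones l m))"

lemma vertex_sign_sq: "vertex_sign \<sigma> * (vertex_sign \<sigma> * x) = (x :: 'k::comm_ring_1)"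
proof -
  have "vertex_sign \<sigma> * vertex_sign \<sigma> = (1 :: 'k)" unfolding vertex_sign_def prod.distrib[symmetric] by simp
  then show ?thesis by (simp flip: mult.assoc)
qed

lemma complement_subset: "complement l \<sigma> \<subseteq> yz l"
  by (auto simp: complement_def yz_image)

lemma uncomplement_complement: "\<sigma> \<subseteq> {1..l} \<Longrightarrow> uncomplement l (complement l \<sigma>) = \<sigma>"
  by (auto simp: uncomplement_def complement_def)

lemma complement_uncomplement:
  assumes F: "F \<subseteq> yz l" "0 \<in> F" shows "complement l (uncomplement l F) = F"
proof -
  have "{1..l} - uncomplement l F = {j \<in> {1..l}. l + j \<in> F}" by (auto simp: uncomplement_def)
  moreover have "(+) l ` {j \<in> {1..l}. l + j \<in> F} = (+) l ` {1..l} \<inter> F" by blast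
  moreover have "insert 0 ((+) l ` {1..l} \<inter> F) = F" using F unfolding yz_image by blast
  ultimately show ?thesis by (simp only: complement_def)
qed

lemma card_complement:
  assumes "\<sigma> \<subseteq> {1..l}" shows "int (card (complement l \<sigma>)) = int l + 1 - int (card \<sigma>)"
proof -
  have fin: "finite \<sigma>" using assms finite_subset by blast
  have "card ((+) l ` ({1..l} - \<sigma>)) = card ({1..l} - \<sigma>)" by (rule card_image) simp
  also have "\<dots> = l - card \<sigma>" using assms fin by (simp add: card_Diff_subset)
  finally have "card ((+) l ` ({1..l} - \<sigma>)) = l - card \<sigma>" .
  moreover have "(0::nat) \<notin> (+) l ` ({1..l} - \<sigma>)" by auto
  moreover have "card \<sigma> \<le> l" using card_mono[OF _ assms] by simp
  ultimately show ?thesis by (simp add: complement_def)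
qed

text \<open>A negative entry that is not inverted has to be exactly -1, which puts the simplex
  inside \<open>minus_ones l m\<close>. The demand for nonempty support in \<open>allowed\<close> is
  the absence of the empty face in unreduced chains.\<close>

lemma allowed_complement:
  assumes m: "neg_degree l m" and \<sigma>: "\<sigma> \<subseteq> {1..l}"
  shows "allowed l E (complement l \<sigma>) m \<longleftrightarrow> \<sigma> \<noteq> {} \<and> \<sigma> \<in> minus_one_cliques l E m"
proof -
  have mem: "l + j \<in> complement l \<sigma> \<longleftrightarrow> j \<notin> \<sigma>" if "j \<in> {1..l}" for j
    using that by (auto simp: complement_def)
  have neg: "m (l + j) < 0" if "j \<in> {1..l}" for j
    using m that by (simp add: neg_degree_def yz_image)
  have negs: "negs l (complement l \<sigma>) m = \<sigma> \<inter> minus_ones l m"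
    using mem \<sigma> by (auto simp: negs_def minus_ones_def)
  have bound: "(\<forall>j\<in>{1..l}. l + j \<notin> complement l \<sigma> \<longrightarrow> -1 \<le> m (l + j)) \<longleftrightarrow> \<sigma> \<subseteq> minus_ones l m"
  proof
    assume *: "\<forall>j\<in>{1..l}. l + j \<notin> complement l \<sigma> \<longrightarrow> -1 \<le> m (l + j)"
    show "\<sigma> \<subseteq> minus_ones l m"
    proof
      fix j assume j: "j \<in> \<sigma>"
      then have jl: "j \<in> {1..l}" using \<sigma> by blast
      then have "-1 \<le> m (l + j)" using * j mem by blast
      then show "j \<in> minus_ones l m" using neg[OF jl] jl by (simp add: minus_ones_def)
    qed
  next
    assume s: "\<sigma> \<subseteq> minus_ones l m"
    show "\<forall>j\<in>{1..l}. l + j \<notin> complement l \<sigma> \<longrightarrow> -1 \<le> m (l + j)"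
    proof (intro ballI impI)
      fix j assume j: "j \<in> {1..l}" "l + j \<notin> complement l \<sigma>"
      then have "j \<in> \<sigma>" using mem by blast
      then show "-1 \<le> m (l + j)" using s by (auto simp: minus_ones_def)
    qed
  qed
  have z: "\<forall>u. u \<notin> yz l \<longrightarrow> m u = 0" using m by (simp add: neg_degree_def)
  have 0: "0 \<in> complement l \<sigma>" by (simp add: complement_def)
  have cl: "\<sigma> \<in> minus_one_cliques l E m \<longleftrightarrow> \<sigma> \<subseteq> minus_ones l m \<and> \<sigma> \<in> clique_complex {1..l} E"
    using \<sigma> unfolding clique_complex_def induced_edges_def by blast
  show ?thesis
    unfolding allowed_def negs bound cl using z 0 by (auto simp: Int_absorb2)
qed

lemma allowed_neg_degree: "neg_degree l m \<Longrightarrow> allowed l E F m \<Longrightarrow> 0 \<in> F"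
  by (force simp: neg_degree_def allowed_def yz_def)

lemma minus_one_cliques_subset: "minus_one_cliques l E m \<subseteq> Pow {1..l}"
  by (auto simp: clique_complex_def minus_ones_def)

lemma chains_minus_one:
  "chains (minus_one_cliques l E m) k = {c. \<forall>\<sigma>. c \<sigma> \<noteq> 0 \<longrightarrow> \<sigma> \<in> minus_one_cliques l E m \<and> \<sigma> \<noteq> {} \<and> int (card \<sigma>) = k + 1}"
  by (rule chains_finite[OF _ minus_one_cliques_subset]) simp

lemma to_chain_chains:
  assumes C: "C \<in> coeff_cochains l E p" and m: "neg_degree l m"
  shows "to_chain l C m \<in> chains (minus_one_cliques l E m) (int l - p)"
  unfolding chains_minus_one
proof (intro CollectI allI impI)
  fix \<sigma> assume "to_chain l C m \<sigma> \<noteq> 0"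
  then have \<sigma>: "\<sigma> \<subseteq> {1..l}" "C (complement l \<sigma>) m \<noteq> 0" by (auto simp: to_chain_def split: if_splits)
  from coeff_cochainsD(2,3)[OF C \<sigma>(2)] card_complement[OF \<sigma>(1)]
  show "\<sigma> \<in> minus_one_cliques l E m \<and> \<sigma> \<noteq> {} \<and> int (card \<sigma>) = int l - p + 1"
    using allowed_complement[OF m \<sigma>(1), of E] by auto
qed

text \<open>Below \<open>l + j\<close> lie 0 and the \<open>l + i\<close> with
  \<open>1 \<le> i < j\<close> and \<open>i \<notin> \<tau>\<close>. Hence the Cech sign and the
  simplicial sign differ by \<open>(-1) ^ j\<close>, which is where \<open>vertex_sign\<close> comes
  from.\<close>

lemma position_complement:
  assumes "\<tau> \<subseteq> {1..l}" "j \<in> {1..l}"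
  shows "position (l + j) (complement l \<tau>) + position j \<tau> = j"
proof -
  have fin: "finite \<tau>" using assms finite_subset by blast
  have "{u \<in> complement l \<tau>. u < l + j} = insert 0 ((+) l ` ({1..<j} - \<tau>))"
  proof -
    have "{i \<in> {1..l} - \<tau>. i < j} = {1..<j} - \<tau>" using assms(2) by auto
    moreover have "{u \<in> (+) l ` ({1..l} - \<tau>). u < l + j} = (+) l ` {i \<in> {1..l} - \<tau>. i < j}" by auto
    moreover have "{u \<in> complement l \<tau>. u < l + j} = insert 0 {u \<in> (+) l ` ({1..l} - \<tau>). u < l + j}"
      using assms(2) by (auto simp only: complement_def) auto
    ultimately show ?thesis by (simp only:)
  qed
  then have "position (l + j) (complement l \<tau>) = Suc (card ({1..<j} - \<tau>))"
    unfolding position_def by (simp add: card_image card_insert_if image_iff)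
  moreover have "card ({1..<j} - \<tau>) + card {u \<in> \<tau>. u < j} = card {1..<j}"
  proof -
    have "card {1..<j} = card (({1..<j} - \<tau>) \<union> {u \<in> \<tau>. u < j})"
      using assms by (intro arg_cong[where f = card]) auto
    also have "\<dots> = card ({1..<j} - \<tau>) + card {u \<in> \<tau>. u < j}"
      using fin by (intro card_Un_disjoint) auto
    finally show ?thesis by simp
  qed
  ultimately show ?thesis using assms by (simp add: position_def)
qed

lemma vertex_sign_insert:
  assumes "finite \<tau>" "j \<notin> \<tau>" shows "vertex_sign (insert j \<tau>) = (-1) ^ j * vertex_sign \<tau>"
  using assms by (simp add: vertex_sign_def)

lemma to_chain_diff:
  fixes C :: "'k::field coeffs"
  assumes C: "C \<in> coeff_cochains l E p" and m: "neg_degree l m"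
  shows "to_chain l (coeff_diff l E C) m = boundary (to_chain l C m)"
proof
  fix \<tau>
  let ?c = "to_chain l C m"
  have supp: "\<sigma> \<subseteq> {1..l}" if "?c \<sigma> \<noteq> 0" for \<sigma> using that by (simp add: to_chain_def split: if_splits)
  have bd: "boundary ?c \<tau> = (if \<tau> = {} then 0 else \<Sum>v\<in>{1..l} - \<tau>. (-1) ^ position v \<tau> * ?c (insert v \<tau>))"
    by (rule boundary_finite[OF finite_atLeastAtMost supp])
  have clique: "\<sigma> \<in> minus_one_cliques l E m" if "?c \<sigma> \<noteq> 0" for \<sigma>
    using to_chain_chains[OF C m] that unfolding chains_minus_one by blast
  show "to_chain l (coeff_diff l E C) m \<tau> = boundary ?c \<tau>"
  proof (cases "\<tau> \<subseteq> {1..l} \<and> allowed l E (complement l \<tau>) m")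
    case True
    then have \<tau>: "\<tau> \<subseteq> {1..l}" "\<tau> \<noteq> {}" and al: "allowed l E (complement l \<tau>) m"
      using allowed_complement[OF m, of \<tau> E] by auto
    have fin\<tau>: "finite \<tau>" using \<tau> finite_subset by blast
    \<comment> \<open>The summand for \<open>z\<close> drops out, since a negative exponent at 0
      forces 0 into the index set.\<close>
    have "C (complement l \<tau> - {0}) m = 0"
      using allowed_neg_degree[OF m coeff_cochainsD(2)[OF C, of "complement l \<tau> - {0}" m]] by blast
    moreover have "complement l \<tau> - {l + j} = complement l (insert j \<tau>)" if "j \<in> {1..l} - \<tau>" for j
      using that by (auto simp: complement_def)
    moreover have "(0::nat) \<notin> (+) l ` ({1..l} - \<tau>)" by auto
    moreover have "(\<Sum>v\<in>(+) l ` ({1..l} - \<tau>). f v) = (\<Sum>j\<in>{1..l} - \<tau>. f (l + j))" for f :: "nat \<Rightarrow> 'k"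
      using sum.reindex[of "(+) l" "{1..l} - \<tau>" f] by (simp only: inj_on_add comp_def)
    ultimately have "(\<Sum>v\<in>complement l \<tau>. (-1) ^ position v (complement l \<tau>) * C (complement l \<tau> - {v}) m) =
        (\<Sum>j\<in>{1..l} - \<tau>. (-1) ^ position (l + j) (complement l \<tau>) * C (complement l (insert j \<tau>)) m)"
      (is "?L = ?R")
      by (subst (1) complement_def, subst sum.insert) (simp_all add: complement_def[symmetric])
    then have "to_chain l (coeff_diff l E C) m \<tau> = vertex_sign \<tau> * ?R"
      using \<tau> al complement_subset by (simp add: to_chain_def coeff_diff_def)
    also have "\<dots> = (\<Sum>j\<in>{1..l} - \<tau>. (-1) ^ position j \<tau> * ?c (insert j \<tau>))"
      unfolding sum_distrib_left
    proof (intro sum.cong refl)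
      fix j assume j: "j \<in> {1..l} - \<tau>"
      have "position (l + j) (complement l \<tau>) + position j \<tau> = j"
        by (rule position_complement[OF \<tau>(1)]) (use j in blast)
      then have "(-1) ^ j = (-1) ^ position (l + j) (complement l \<tau>) * (-1) ^ position j \<tau> * (1 :: 'k)"
        by (simp flip: power_add)
      moreover have "?c (insert j \<tau>) = (-1) ^ j * vertex_sign \<tau> * C (complement l (insert j \<tau>)) m"
        using j \<tau> fin\<tau> by (simp add: to_chain_def vertex_sign_insert)
      ultimately show "vertex_sign \<tau> * ((-1) ^ position (l + j) (complement l \<tau>) * C (complement l (insert j \<tau>)) m) =
          (-1) ^ position j \<tau> * ?c (insert j \<tau>)"
        by (simp add: mult_ac)
    qed
    finally show ?thesis using \<tau> bd by simp
  next
    case False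
    then have "to_chain l (coeff_diff l E C) m \<tau> = 0" by (auto simp: to_chain_def coeff_diff_def)
    moreover have "boundary ?c \<tau> = 0"
    proof (cases "\<tau> = {}")
      case ne: False
      \<comment> \<open>A nonzero coefficient at a larger simplex would put its nonempty face
        \<open>\<tau>\<close> into the complex and so make the index set of \<open>\<tau>\<close>
        allowed.\<close>
      have "?c (insert v \<tau>) = 0" for v
      proof (rule ccontr)
        assume "?c (insert v \<tau>) \<noteq> 0"
        from clique[OF this] supp[OF this] have "\<tau> \<in> minus_one_cliques l E m" "\<tau> \<subseteq> {1..l}"
          using clique_complex_subset by blast+
        then show False using False allowed_complement[OF m, of \<tau> E] ne by blast
      qed
      then show ?thesis by (simp add: bd)
    qed (simp add: boundary_def)
    ultimately show ?thesis by simp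
  qed
qed

text \<open>Index sets without 0 carry no coefficients in a negative multidegree, and the signs are
  invertible, so the chain determines all coefficients.\<close>

lemma to_chain_inj:
  assumes C: "C \<in> coeff_cochains l E p" "C' \<in> coeff_cochains l E p'" and m: "neg_degree l m"
    and eq: "to_chain l C m = to_chain l C' m"
  shows "C F m = C' F m"
proof (cases "F \<subseteq> yz l \<and> 0 \<in> F")
  case True
  have sub: "uncomplement l F \<subseteq> {1..l}" by (auto simp: uncomplement_def)
  from fun_cong[OF eq, of "uncomplement l F"]
  have "vertex_sign (uncomplement l F) * C F m = vertex_sign (uncomplement l F) * C' F m"
    using sub True by (simp add: to_chain_def complement_uncomplement)
  then show ?thesis using vertex_sign_sq[of "uncomplement l F"] by metis
next
  case False
  have "C F m = 0" using coeff_cochainsD(2)[OF C(1), of F m] coeff_cochainsD(3)[OF C(1), of F m] allowed_neg_degree[OF m] False by blast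
  moreover have "C' F m = 0" using coeff_cochainsD(2)[OF C(2), of F m] coeff_cochainsD(3)[OF C(2), of F m] allowed_neg_degree[OF m] False by blast
  ultimately show ?thesis by simp
qed

lemma to_chain_of_chain:
  assumes "b m \<in> chains (minus_one_cliques l E m) k"
  shows "to_chain l (of_chain l b) m = b m"
proof
  fix \<sigma>
  show "to_chain l (of_chain l b) m \<sigma> = b m \<sigma>"
  proof (cases "\<sigma> \<subseteq> {1..l}")
    case True
    then show ?thesis using complement_subset[of l \<sigma>]
      by (simp add: to_chain_def of_chain_def uncomplement_complement vertex_sign_sq) (simp add: complement_def)
  next
    case False
    then have "b m \<sigma> = 0" using assms minus_one_cliques_subset unfolding chains_minus_one by blast
    then show ?thesis using False by (simp add: to_chain_def)
  qed
qed

lemma of_chain_cochains: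
  assumes T: "finite T" "\<And>m. m \<in> T \<Longrightarrow> neg_degree l m"
    and b: "\<And>m. m \<in> T \<Longrightarrow> b m \<in> chains (minus_one_cliques l E m) (int l - p)" "\<And>m. m \<notin> T \<Longrightarrow> b m = 0"
  shows "of_chain l b \<in> coeff_cochains l E p"
proof (rule coeff_cochainsI)
  fix F
  have "{m. of_chain l b F m \<noteq> 0} \<subseteq> T"
  proof
    fix m assume "m \<in> {m. of_chain l b F m \<noteq> 0}"
    then have "b m \<noteq> 0" by (auto simp: of_chain_def split: if_splits)
    then show "m \<in> T" using b(2) by blast
  qed
  then show "finite {m. of_chain l b F m \<noteq> 0}" using T(1) finite_subset by blast
next
  fix F m assume "of_chain l b F m \<noteq> 0"
  then have F: "F \<subseteq> yz l" "0 \<in> F" and bm: "b m (uncomplement l F) \<noteq> 0" by (auto simp: of_chain_def split: if_splits)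
  have mT: "m \<in> T"
  proof (rule ccontr)
    assume "m \<notin> T"
    from b(2)[OF this] bm show False by simp
  qed
  have sub: "uncomplement l F \<subseteq> {1..l}" by (auto simp: uncomplement_def)
  have "uncomplement l F \<in> minus_one_cliques l E m \<and> uncomplement l F \<noteq> {} \<and> int (card (uncomplement l F)) = int l - p + 1"
    using b(1)[OF mT] bm unfolding chains_minus_one by blast
  then show "allowed l E F m \<and> F \<subseteq> yz l \<and> int (card F) = p"
    using allowed_complement[OF T(2)[OF mT] sub, of E] card_complement[OF sub] F
    by (simp add: complement_uncomplement)
qed

lemma coeff_diff_cochains:
  assumes C: "C \<in> coeff_cochains l E p"
  shows "coeff_diff l E C \<in> coeff_cochains l E (p + 1)"
proof (rule coeff_cochainsI)
  fix F
  have ex: "\<exists>v\<in>F. C (F - {v}) m \<noteq> 0" if "coeff_diff l E C F m \<noteq> 0" for F m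
  proof (rule ccontr)
    assume "\<not> (\<exists>v\<in>F. C (F - {v}) m \<noteq> 0)"
    then have "coeff_diff l E C F m = 0" by (simp add: coeff_diff_def)
    with that show False by simp
  qed
  show "finite {m. coeff_diff l E C F m \<noteq> 0}"
  proof (cases "F \<subseteq> yz l")
    case True
    then have "finite F" using finite_subset by (auto simp: yz_def)
    then have "finite (\<Union>v\<in>F. {m. C (F - {v}) m \<noteq> 0})" using coeff_cochainsD(1)[OF C] by auto
    moreover have "{m. coeff_diff l E C F m \<noteq> 0} \<subseteq> (\<Union>v\<in>F. {m. C (F - {v}) m \<noteq> 0})" using ex by blast
    ultimately show ?thesis using finite_subset by blast
  next
    case False
    then show ?thesis by (simp add: coeff_diff_def)
  qed
  fix m assume nz: "coeff_diff l E C F m \<noteq> 0"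
  then have F: "F \<subseteq> yz l" "allowed l E F m" by (auto simp: coeff_diff_def split: if_splits)
  obtain v where v: "v \<in> F" "C (F - {v}) m \<noteq> 0" using ex[OF nz] by blast
  have finF: "finite F" using F finite_subset by (auto simp: yz_def)
  have "card F = Suc (card (F - {v}))" by (rule card.remove[OF finF v(1)])
  then show "allowed l E F m \<and> F \<subseteq> yz l \<and> int (card F) = p + 1"
    using coeff_cochainsD(3)[OF C v(2)] F by auto
qed

text \<open>In a degree with a nonnegative entry at \<open>u\<close>, inverting the generator \<open>u\<close> changes nothing, so contracting
  along \<open>u\<close> kills the cohomology.\<close>

lemma coeff_diff_contract:
  fixes C :: "'k::field coeffs"
  assumes C: "C \<in> coeff_cochains l E p" "coeff_diff l E C = 0" and u: "u \<in> yz l" "0 \<le> m u"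
    and B: "\<And>F. B F m = (if F \<subseteq> yz l \<and> u \<notin> F then (-1) ^ position u F * C (insert u F) m else 0)"
  shows "coeff_diff l E B F m = C F m"
proof (cases "F \<subseteq> yz l \<and> allowed l E F m")
  case True
  have fin: "finite (yz l)" by (simp add: yz_def)
  \<comment> \<open>The general homotopy identity is reused with all generators equal to 1, on
    functions of the multidegree: the idempotents disappear and only the signs remain.\<close>
  let ?g = "\<lambda>_. (1 :: (nat \<Rightarrow> int) \<Rightarrow> 'k)"
  have id1: "idem (1 :: (nat \<Rightarrow> int) \<Rightarrow> 'k) = 1" by (simp add: fun_eq_iff idem_apply)
  have con: "contract (yz l) u C F m = B F m" for F
    by (auto simp: contract_def B power_fun_apply)
  have d: "cdiff ?g (yz l) C' F m = (\<Sum>v\<in>F. (-1) ^ position v F * C' (F - {v}) m)" if "F \<subseteq> yz l" for F C'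
    using that by (simp add: cdiff_def sum_fun_apply power_fun_apply id1)
  have "cdiff ?g (yz l) (contract (yz l) u C) F + contract (yz l) u (cdiff ?g (yz l) C) F = idem 1 * C F"
    by (rule cdiff_contract[OF fin u(1)]) (use True in simp)
  from fun_cong[OF this, of m]
  have "cdiff ?g (yz l) (contract (yz l) u C) F m + contract (yz l) u (cdiff ?g (yz l) C) F m = C F m"
    by (simp add: id1)
  moreover have "contract (yz l) u (cdiff ?g (yz l) C) F m = 0"
  proof (cases "u \<in> F")
    case False
    have sub: "insert u F \<subseteq> yz l" using True u by simp
    have "allowed l E (insert u F) m"
    proof -
      have "negs l (insert u F) m = negs l F m" using u(2) by (auto simp: negs_def)
      moreover have al: "allowed l E F m" using True by simp
      then have "negs l F m \<noteq> {}" unfolding allowed_def by (elim conjE)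
      ultimately have "negs l (insert u F) m \<noteq> {}" by simp
      from allowed_insert[OF al subset_insertI this] show ?thesis .
    qed
    then have "cdiff ?g (yz l) C (insert u F) m = coeff_diff l E C (insert u F) m"
      using sub d[OF sub, of C] by (simp add: coeff_diff_def)
    then show ?thesis using C(2) by (simp add: contract_def power_fun_apply)
  qed (simp add: contract_def)
  moreover have "coeff_diff l E B F m = cdiff ?g (yz l) (contract (yz l) u C) F m"
    using True d[of F "contract (yz l) u C"] by (simp add: coeff_diff_def con)
  ultimately show ?thesis by simp
next
  case False
  then have "C F m = 0" using coeff_cochainsD(2)[OF C(1), of F m] coeff_cochainsD(3)[OF C(1), of F m] by blast
  then show ?thesis using False by (auto simp: coeff_diff_def)
qed

text \<open>A nonnegative entry meets its bound without being inverted and is never -1, so the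
  support is unchanged. Hence contraction along \<open>u\<close> stays among allowed
  multidegrees.\<close>

lemma allowed_remove:
  assumes a: "allowed l E (insert u F) m" and u: "0 \<le> m u"
  shows "allowed l E F m"
proof -
  have "negs l F m = negs l (insert u F) m" using u by (auto simp: negs_def)
  moreover have "0 \<le> m 0" if "0 \<notin> F" using a u that by (cases "u = 0") (auto simp: allowed_def)
  moreover have "-1 \<le> m (l + j)" if "j \<in> {1..l}" "l + j \<notin> F" for j
    using a u that by (cases "u = l + j") (auto simp: allowed_def)
  ultimately show ?thesis using a by (simp add: allowed_def)
qed

definition neg_degrees :: "nat \<Rightarrow> int \<Rightarrow> (nat \<Rightarrow> int) set" where
  "neg_degrees l d = {m. neg_degree l m \<and> total_degree l m + 1 = d}"

text \<open>With all entries negative, each one is bounded below by their fixed sum. This is the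
  source of the finite dimension of every graded piece.\<close>

lemma finite_neg_degrees: "finite (neg_degrees l d)"
proof -
  have fin: "finite (yz l)" by (simp add: yz_def)
  have "neg_degrees l d \<subseteq> {m. \<forall>u. if u \<in> yz l then m u \<in> {d - 1..0} else m u = 0}"
  proof
    fix m assume m: "m \<in> neg_degrees l d"
    then have neg: "m u < 0" if "u \<in> yz l" for u using that by (simp add: neg_degrees_def neg_degree_def)
    have "d - 1 \<le> m u" if u: "u \<in> yz l" for u
    proof -
      have "(\<Sum>v\<in>yz l - {u}. m v) \<le> 0" by (rule sum_nonpos) (use neg in force)
      moreover have "d - 1 = m u + (\<Sum>v\<in>yz l - {u}. m v)"
        using m sum.remove[OF fin u, of m] by (simp add: neg_degrees_def total_degree_def)
      ultimately show ?thesis by simp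
    qed
    then show "m \<in> {m. \<forall>u. if u \<in> yz l then m u \<in> {d - 1..0} else m u = 0}"
      using m neg by (force simp: neg_degrees_def neg_degree_def)
  qed
  also have "finite {m. \<forall>u. if u \<in> yz l then m u \<in> {d - 1..0} else m u = 0}"
  proof (rule finite_subset)
    show "{m. \<forall>u. if u \<in> yz l then m u \<in> {d - 1..0} else m u = 0} \<subseteq>
        {m. \<forall>u. (u \<in> yz l \<longrightarrow> m u \<in> {d - 1..0}) \<and> (u \<notin> yz l \<longrightarrow> m u = 0)}"
      by (auto split: if_splits)
    show "finite {m. \<forall>u. (u \<in> yz l \<longrightarrow> m u \<in> {d - 1..0}) \<and> (u \<notin> yz l \<longrightarrow> m u = 0)}"
      by (rule finite_set_of_finite_funs[OF fin]) simp
  qed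
  finally (finite_subset) show ?thesis .
qed

lemma expand_diff:
  assumes "finite {m. c m \<noteq> 0}" "finite {m. c' m \<noteq> 0}"
  shows "expand l F (c - c') = expand l F c - expand l F (c' :: _ \<Rightarrow> 'k::field)"
proof -
  let ?T = "{m. c m \<noteq> 0} \<union> {m. c' m \<noteq> 0}"
  have fin: "finite ?T" using assms by simp
  have "{m. (c - c') m \<noteq> 0} \<subseteq> ?T" by auto
  note e = expand_superset[OF fin this, of l F]
  have e1: "expand l F c = (\<Sum>m\<in>?T. fmult (const (c m)) (log_monom l F m))"
    and e2: "expand l F c' = (\<Sum>m\<in>?T. fmult (const (c' m)) (log_monom l F m))"
    by (rule expand_superset[OF fin], auto)+
  show ?thesis
    unfolding e e1 e2 sum_subtractf[symmetric]
    by (intro sum.cong refl) (simp add: fmult_def fun_eq_iff left_diff_distrib)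
qed

lemma expand_scale:
  assumes "finite {m. c m \<noteq> 0}"
  shows "expand l F (\<lambda>m. a * c m) = fmult (const a) (expand l F c)"
proof -
  have "expand l F (\<lambda>m. a * c m) = (\<Sum>m | c m \<noteq> 0. fmult (const (a * c m)) (log_monom l F m))"
    by (rule expand_superset[OF assms]) auto
  then show ?thesis unfolding expand_def fm.scale_sum_right fm.scale_scale .
qed

lemma coeff_cochains_diff:
  assumes "C \<in> coeff_cochains l E p" "C' \<in> coeff_cochains l E p"
  shows "C - C' \<in> coeff_cochains l E p"
proof (rule coeff_cochainsI)
  fix F
  have "{m. (C - C') F m \<noteq> 0} \<subseteq> {m. C F m \<noteq> 0} \<union> {m. C' F m \<noteq> 0}" by auto
  then show "finite {m. (C - C') F m \<noteq> 0}"
    by (rule finite_subset) (simp add: coeff_cochainsD(1)[OF assms(1)] coeff_cochainsD(1)[OF assms(2)])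
  fix m assume "(C - C') F m \<noteq> 0"
  then have "C F m \<noteq> 0 \<or> C' F m \<noteq> 0" by auto
  then show "allowed l E F m \<and> F \<subseteq> yz l \<and> int (card F) = p"
    using coeff_cochainsD(2,3)[OF assms(1)] coeff_cochainsD(2,3)[OF assms(2)] by metis
qed

lemma coeff_cochains_scale:
  assumes "C \<in> coeff_cochains l E p"
  shows "(\<lambda>F m. a * C F m) \<in> coeff_cochains l E p"
proof (rule coeff_cochainsI)
  fix F
  have "{m. a * C F m \<noteq> 0} \<subseteq> {m. C F m \<noteq> 0}" by auto
  then show "finite {m. a * C F m \<noteq> 0}" using coeff_cochainsD(1)[OF assms] finite_subset by blast
  fix m assume "a * C F m \<noteq> 0"
  then have "C F m \<noteq> 0" by auto
  then show "allowed l E F m \<and> F \<subseteq> yz l \<and> int (card F) = p"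
    using coeff_cochainsD(2,3)[OF assms] by metis
qed

lemma coeff_diff_linear:
  "coeff_diff l E (C - C') = coeff_diff l E C - coeff_diff l E C'"
  "coeff_diff l E (\<lambda>F m. a * C F m) = (\<lambda>F m. a * coeff_diff l E C F m)"
  by (auto simp: coeff_diff_def fun_eq_iff right_diff_distrib sum_subtractf sum_distrib_left mult_ac)

lemma to_chain_linear:
  "to_chain l (C - C') m = to_chain l C m - to_chain l C' m"
  "to_chain l (\<lambda>F m. a * C F m) m = (\<lambda>\<sigma>. a * to_chain l C m \<sigma>)"
  by (auto simp: to_chain_def fun_eq_iff right_diff_distrib mult_ac)

definition realize :: "nat \<Rightarrow> 'k::field coeffs \<Rightarrow> 'k cochain" where
  "realize l C = (\<lambda>F. expand l F (C F))"

lemma coeff_cochains_space: "C \<in> coeff_cochains l E p \<Longrightarrow> C F \<in> coeff_space l E F"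
  using coeff_cochainsD[of C l E p] by (simp add: coeff_space_def)

context
  fixes l :: nat and E :: "nat set set"
  assumes sg: "simple_graph {1..l} E" and l: "1 \<le> l"
begin

lemma realize_image:
  "realize l ` coeff_cochains l E p = cochains (gen l) (Omega1_graph l E :: 'k::field form1 set) (yz l) p"
proof -
  let ?M = "Omega1_graph l E :: 'k form1 set"
  have im: "expand l F ` coeff_space l E F = loc ?M (\<Prod>v\<in>F. gen l v)" if "F \<subseteq> yz l" for F
    unfolding expand_image span_log_monom_localized[OF sg l that] ..
  show ?thesis
  proof
    show "realize l ` coeff_cochains l E p \<subseteq> cochains (gen l) ?M (yz l) p"
    proof
      fix c :: "'k cochain" assume "c \<in> realize l ` coeff_cochains l E p"
      then obtain C where C: "C \<in> coeff_cochains l E p" "c = realize l C" by blast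
      show "c \<in> cochains (gen l) ?M (yz l) p"
      proof (rule cochainsI)
        fix F assume "F \<subseteq> yz l" "int (card F) = p"
        from im[OF this(1)] show "c F \<in> loc ?M (prod (gen l) F)"
          using coeff_cochains_space[OF C(1)] by (auto simp: C(2) realize_def)
      next
        fix F assume "\<not> (F \<subseteq> yz l \<and> int (card F) = p)"
        then have "C F m = 0" for m using coeff_cochainsD(3)[OF C(1), of F m] by blast
        then have "C F = 0" by (simp add: fun_eq_iff)
        then show "c F = 0" by (simp add: C(2) realize_def)
      qed
    qed
    show "cochains (gen l) ?M (yz l) p \<subseteq> realize l ` coeff_cochains l E p"
    proof
      fix c assume c: "c \<in> cochains (gen l) ?M (yz l) p"
      have "\<exists>x. (if F \<subseteq> yz l \<and> int (card F) = p then x \<in> coeff_space l E F else x = 0) \<and> expand l F x = c F" for F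
      proof (cases "F \<subseteq> yz l \<and> int (card F) = p")
        case True
        then have "c F \<in> expand l F ` coeff_space l E F" using cochainsD[OF c] im by blast
        then show ?thesis unfolding if_P[OF True] by auto
      next
        case False
        then show ?thesis using cochains_eq_0[OF c False] by auto
      qed
      then obtain C where C: "\<And>F. (if F \<subseteq> yz l \<and> int (card F) = p then C F \<in> coeff_space l E F else C F = 0) \<and> expand l F (C F) = c F"
        by metis
      have "C \<in> coeff_cochains l E p" unfolding coeff_cochains_def using C by blast
      moreover have "c = realize l C" unfolding realize_def using C by (intro ext) simp
      ultimately show "c \<in> realize l ` coeff_cochains l E p" by blast
    qed
  qed
qed

lemma realize_inj:
  assumes "C \<in> coeff_cochains l E p" "C' \<in> coeff_cochains l E p'" "realize l C = realize l C'"
  shows "C = (C' :: 'k::field coeffs)"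
proof
  fix F show "C F = C' F"
    by (rule expand_inj[OF coeff_cochains_space[OF assms(1)] coeff_cochains_space[OF assms(2)]])
      (use fun_cong[OF assms(3), of F] in \<open>simp add: realize_def\<close>)
qed

lemma realize_diff:
  assumes C: "C \<in> coeff_cochains l E p"
  shows "realize l (coeff_diff l E C) = cdiff (gen l) (yz l) (realize l (C :: 'k::field coeffs))"
proof
  fix F show "realize l (coeff_diff l E C) F = cdiff (gen l) (yz l) (realize l C) F"
  proof (cases "F \<subseteq> yz l")
    case True
    then show ?thesis using expand_coeff_diff[OF C True] by (simp add: realize_def)
  next
    case False
    then have "coeff_diff l E C F = 0" by (simp add: coeff_diff_def fun_eq_iff)
    then show ?thesis using False by (simp add: realize_def cdiff_def)
  qed
qed

text \<open>A bounding family can be assembled separately in each multidegree, because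
  \<open>coeff_diff\<close> does not mix them: simplicial chains are transported back where all
  entries are negative, and a contraction is used elsewhere.\<close>

lemma coeff_coboundaryI:
  fixes C :: "'k::field coeffs"
  assumes C: "C \<in> coeff_cochains l E p" "coeff_diff l E C = 0"
    and T: "finite T" "\<And>m. m \<in> T \<Longrightarrow> neg_degree l m"
    and CT: "\<And>F m. neg_degree l m \<Longrightarrow> m \<notin> T \<Longrightarrow> C F m = 0"
    and b: "\<And>m. m \<in> T \<Longrightarrow> b m \<in> chains (minus_one_cliques l E m) (int l - p + 1) \<and> to_chain l C m = boundary (b m)"
  shows "\<exists>B\<in>coeff_cochains l E (p - 1). coeff_diff l E B = C"
proof -
  define b' where "b' m = (if m \<in> T then b m else 0)" for m
  have b': "of_chain l b' \<in> coeff_cochains l E (p - 1)"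
    by (rule of_chain_cochains[OF T]) (use b in \<open>auto simp: b'_def algebra_simps\<close>)
  define u where "u m = (SOME u. u \<in> yz l \<and> 0 \<le> m u)" for m :: "nat \<Rightarrow> int"
  \<comment> \<open>The direction \<open>u m\<close> of contraction varies with the multidegree.
    Finite support survives because \<open>u m\<close> takes values in the finite set
    \<open>yz l\<close>.\<close>
  define B where "B F m = (if neg_degree l m then of_chain l b' F m
    else if (\<forall>v. v \<notin> yz l \<longrightarrow> m v = 0) \<and> F \<subseteq> yz l \<and> u m \<notin> F then (-1) ^ position (u m) F * C (insert (u m) F) m else 0)" for F m
  have u: "u m \<in> yz l \<and> 0 \<le> m (u m)" if "\<not> neg_degree l m" "\<forall>v. v \<notin> yz l \<longrightarrow> m v = 0" for m
  proof -
    have "\<exists>u. u \<in> yz l \<and> 0 \<le> m u" using that by (force simp: neg_degree_def not_less)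
    then show ?thesis unfolding u_def by (rule someI_ex)
  qed
  have finyz: "finite (yz l)" by (simp add: yz_def)
  have B: "B \<in> coeff_cochains l E (p - 1)"
  proof (rule coeff_cochainsI)
    fix F
    have "{m. B F m \<noteq> 0} \<subseteq> {m. of_chain l b' F m \<noteq> 0} \<union> (\<Union>v\<in>yz l. {m. C (insert v F) m \<noteq> 0})"
    proof
      fix m assume "m \<in> {m. B F m \<noteq> 0}"
      then show "m \<in> {m. of_chain l b' F m \<noteq> 0} \<union> (\<Union>v\<in>yz l. {m. C (insert v F) m \<noteq> 0})"
        using u[of m] by (auto simp: B_def split: if_splits)
    qed
    then show "finite {m. B F m \<noteq> 0}"
      by (rule finite_subset) (use coeff_cochainsD(1)[OF b'] coeff_cochainsD(1)[OF C(1)] finyz in simp)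
  next
    fix F m assume nz: "B F m \<noteq> 0"
    show "allowed l E F m \<and> F \<subseteq> yz l \<and> int (card F) = p - 1"
    proof (cases "neg_degree l m")
      case True
      then have "of_chain l b' F m \<noteq> 0" using nz by (simp add: B_def)
      then show ?thesis using coeff_cochainsD(2)[OF b', of F m] coeff_cochainsD(3)[OF b', of F m] by blast
    next
      case False
      then have *: "\<forall>v. v \<notin> yz l \<longrightarrow> m v = 0" "F \<subseteq> yz l" "u m \<notin> F" "C (insert (u m) F) m \<noteq> 0"
        using nz by (auto simp: B_def split: if_splits)
      have um: "0 \<le> m (u m)" using u[OF False *(1)] by blast
      have "allowed l E F m" by (rule allowed_remove[OF coeff_cochainsD(2)[OF C(1) *(4)] um])
      moreover have "finite F" using *(2) finyz finite_subset by blast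
      ultimately show ?thesis using coeff_cochainsD(3)[OF C(1) *(4)] *(2,3) by simp
    qed
  qed
  have "coeff_diff l E B F m = C F m" for F m
  proof (cases "neg_degree l m")
    case True
    have "to_chain l B m = to_chain l (of_chain l b') m" using True by (intro ext) (simp add: to_chain_def B_def)
    also have "\<dots> = b' m"
      by (rule to_chain_of_chain[where k = "int l - p + 1" and E = E]) (use b in \<open>auto simp: b'_def chains_minus_one\<close>)
    finally have "to_chain l (coeff_diff l E B) m = boundary (b' m)" using to_chain_diff[OF B True] by simp
    also have "\<dots> = to_chain l C m"
    proof (cases "m \<in> T")
      case True
      then show ?thesis using b by (simp add: b'_def)
    next
      case False
      then have "b' m = 0" "to_chain l C m = 0" using CT[OF True] by (auto simp: b'_def to_chain_def fun_eq_iff)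
      then show ?thesis by (auto simp: boundary_def fun_eq_iff)
    qed
    finally show ?thesis by (rule to_chain_inj[OF coeff_diff_cochains[OF B] C(1) True])
  next
    case nonneg: False
    show ?thesis
    proof (cases "\<forall>v. v \<notin> yz l \<longrightarrow> m v = 0")
      case True
      show ?thesis
        by (rule coeff_diff_contract[OF C, of "u m"]) (use u[OF nonneg True] nonneg True in \<open>auto simp: B_def\<close>)
    next
      case False
      then have "\<not> allowed l E F m" for F by (simp add: allowed_def)
      then have "coeff_diff l E B F m = 0" "C F m = 0"
        using coeff_cochainsD(2)[OF C(1), of F m] by (auto simp: coeff_diff_def)
      then show ?thesis by simp
    qed
  qed
  then have "coeff_diff l E B = C" by (simp add: fun_eq_iff)
  then show ?thesis using B by blast
qed

text \<open>The relation \<open>R\<close> links a cocycle to its chains in the finitely many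
  negative multidegrees of total degree \<open>d - 1\<close>. Parts in other multidegrees are
  forgotten, which is harmless as \<open>coeff_coboundaryI\<close> bounds them.\<close>

theorem has_qdim_yz:
  "has_qdim (cscale const) (cocycles (gen l) (Omega1_graph l E :: 'k::field form1 set) (form_degree l) (yz l) p d)
    (coboundaries (gen l) (Omega1_graph l E) (form_degree l) (yz l) p d)
    (\<Sum>m\<in>neg_degrees l d. homology_dim TYPE('k) (int l - p) (minus_one_cliques l E m))"
proof -
  let ?M = "Omega1_graph l E :: 'k form1 set"
  interpret scaled_cech "gen l" ?M "form_degree l" const by (rule scaled_cech_gen[OF sg l])
  let ?X = "neg_degrees l d"
  let ?Z = "\<lambda>m. {c \<in> chains (minus_one_cliques l E m) (int l - p). boundary c = (0 :: nat set \<Rightarrow> 'k)}"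
  let ?B = "\<lambda>m. boundary ` chains (minus_one_cliques l E m) (int l - p + 1) :: (nat set \<Rightarrow> 'k) set"
  let ?ZS = "{h. \<forall>m. if m \<in> ?X then h m \<in> ?Z m else h m = 0}"
  let ?BS = "{h. \<forall>m. if m \<in> ?X then h m \<in> ?B m else h m = 0}"
  let ?s = "\<lambda>(a::'k) h (m :: nat \<Rightarrow> int). (\<lambda>\<sigma>. a * h m \<sigma>)"
  have neg: "neg_degree l m" if "m \<in> ?X" for m using that by (simp add: neg_degrees_def)
  have b0: "boundary (0 :: nat set \<Rightarrow> 'k) = 0" by (auto simp: boundary_def fun_eq_iff)
  have ch0: "(0 :: nat set \<Rightarrow> 'k) \<in> chains (minus_one_cliques l E m) k" for m k by (simp add: chains_minus_one)
  have vs1: "vector_space ?s" by unfold_locales (auto simp: fun_eq_iff algebra_simps)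
  have dims: "has_qdim ?s ?ZS ?BS (\<Sum>m\<in>?X. homology_dim TYPE('k) (int l - p) (minus_one_cliques l E m))"
  proof (rule has_qdim_sum[OF vector_space_fun finite_neg_degrees])
    show "has_qdim (\<lambda>a c \<sigma>. a * c \<sigma>) (?Z m) (?B m) (homology_dim TYPE('k) (int l - p) (minus_one_cliques l E m))" for m
      by (rule has_qdim_homology[OF _ minus_one_cliques_subset]) simp
    show "0 \<in> ?B m" for m by (rule image_eqI[where x = 0]) (simp_all add: b0 ch0)
    show "0 \<in> ?Z m" for m by (simp add: b0 ch0)
  qed
  define hC where "hC C = (\<lambda>m. if m \<in> ?X then to_chain l C m else (0 :: nat set \<Rightarrow> 'k))" for C
  define good where "good C \<longleftrightarrow> C \<in> coeff_cochains l E p \<and> coeff_diff l E C = (0 :: 'k coeffs) \<and>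
      (\<forall>F m. C F m \<noteq> 0 \<longrightarrow> total_degree l m + 1 = d)" for C
  define R where "R h c \<longleftrightarrow> (\<exists>C. good C \<and> h = hC C \<and> c = realize l C)" for h c
  have deg: "realize l C F \<in> form_degree l d \<longleftrightarrow> (\<forall>m. C F m \<noteq> 0 \<longrightarrow> total_degree l m + 1 = d)"
    if "C \<in> coeff_cochains l E q" for C :: "'k coeffs" and F q
    unfolding realize_def by (rule expand_degree[OF coeff_cochains_space[OF that]])
  have realize0: "realize l (0 :: 'k coeffs) = 0" by (simp add: realize_def fun_eq_iff)
  have good_cocycle: "realize l C \<in> cocycles (gen l) ?M (form_degree l) (yz l) p d" if "good C" for C
  proof -
    have C: "C \<in> coeff_cochains l E p" "coeff_diff l E C = 0" "\<forall>F m. C F m \<noteq> 0 \<longrightarrow> total_degree l m + 1 = d"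
      using that by (auto simp: good_def)
    have "realize l C \<in> cochains (gen l) ?M (yz l) p" using C(1) realize_image by blast
    moreover have "cdiff (gen l) (yz l) (realize l C) = 0"
      unfolding realize_diff[OF C(1), symmetric] C(2) by (rule realize0)
    ultimately show ?thesis using deg[OF C(1)] C(3) by (simp add: cocycles_def)
  qed
  have cocycle_good: "\<exists>C. good C \<and> c = realize l C" if c: "c \<in> cocycles (gen l) ?M (form_degree l) (yz l) p d" for c
  proof -
    obtain C where C: "C \<in> coeff_cochains l E p" "c = realize l C"
      using c realize_image[of p, where 'k = 'k] unfolding cocycles_def by blast
    have "realize l (coeff_diff l E C) = realize l 0"
      unfolding realize_diff[OF C(1)] realize0 using c C(2) by (simp add: cocycles_def)
    moreover have "(0 :: 'k coeffs) \<in> coeff_cochains l E p" by (rule coeff_cochainsI) auto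
    ultimately have "coeff_diff l E C = 0" by (intro realize_inj[OF coeff_diff_cochains[OF C(1)]])
    then show ?thesis using C c deg[OF C(1)] by (intro exI[of _ C]) (simp add: good_def cocycles_def)
  qed
  have good_hC: "hC C \<in> ?ZS" if "good C" for C
  proof -
    have C: "C \<in> coeff_cochains l E p" "coeff_diff l E C = 0" using that by (auto simp: good_def)
    have "to_chain l C m \<in> ?Z m" if "m \<in> ?X" for m
    proof -
      have "boundary (to_chain l C m) = to_chain l (coeff_diff l E C) m" by (rule to_chain_diff[OF C(1) neg[OF that], symmetric])
      also have "\<dots> = 0" unfolding C(2) by (auto simp: to_chain_def fun_eq_iff)
      finally show ?thesis using to_chain_chains[OF C(1) neg[OF that]] by simp
    qed
    then show ?thesis by (simp add: hC_def)
  qed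
  have hC_surj: "\<exists>C. good C \<and> h = hC C" if h: "h \<in> ?ZS" for h
  proof -
    have h1: "h m \<in> chains (minus_one_cliques l E m) (int l - p)" "boundary (h m) = 0" if "m \<in> ?X" for m
      using h that by (auto dest: spec[of _ m])
    have h2: "h m = 0" if "m \<notin> ?X" for m using h that by (auto dest: spec[of _ m])
    let ?C = "of_chain l h"
    have C: "?C \<in> coeff_cochains l E p" by (rule of_chain_cochains[OF finite_neg_degrees neg h1(1) h2])
    have nz: "m \<in> ?X" if "?C F m \<noteq> 0" for F m
    proof (rule ccontr)
      assume "m \<notin> ?X"
      from h2[OF this] that show False by (auto simp: of_chain_def split: if_splits)
    qed
    have tc: "to_chain l ?C m = h m" if "m \<in> ?X" for m by (rule to_chain_of_chain[where b = h, OF h1(1)[OF that]])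
    have "coeff_diff l E ?C F m = 0 F m" for F m
    proof (cases "m \<in> ?X")
      case True
      have "to_chain l (coeff_diff l E ?C) m = to_chain l 0 m"
        unfolding to_chain_diff[OF C neg[OF True]] tc[OF True] h1(2)[OF True] by (auto simp: to_chain_def fun_eq_iff)
      moreover have "(0 :: 'k coeffs) \<in> coeff_cochains l E p" by (rule coeff_cochainsI) auto
      ultimately show ?thesis by (intro to_chain_inj[OF coeff_diff_cochains[OF C] _ neg[OF True]])
    next
      case False
      then have "?C F' m = 0" for F' using nz by blast
      then show ?thesis by (simp add: coeff_diff_def)
    qed
    then have "coeff_diff l E ?C = 0" by (simp add: fun_eq_iff)
    moreover have "total_degree l m + 1 = d" if "?C F m \<noteq> 0" for F m
      using nz[OF that] by (simp add: neg_degrees_def)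
    ultimately have "good ?C" using C by (simp add: good_def)
    moreover have "h = hC ?C"
    proof
      fix m show "h m = hC ?C m" using tc h2 by (simp add: hC_def)
    qed
    ultimately show ?thesis by blast
  qed
  have RB: "hC C \<in> ?BS \<longleftrightarrow> realize l C \<in> coboundaries (gen l) ?M (form_degree l) (yz l) p d" if g: "good C" for C
  proof
    have C: "C \<in> coeff_cochains l E p" "coeff_diff l E C = 0" "\<And>F m. C F m \<noteq> 0 \<Longrightarrow> total_degree l m + 1 = d"
      using g by (auto simp: good_def)
    {
      assume h: "hC C \<in> ?BS"
      have "\<exists>b. b \<in> chains (minus_one_cliques l E m) (int l - p + 1) \<and> to_chain l C m = boundary b" if "m \<in> ?X" for m
      proof -
        have "hC C m \<in> ?B m" using h that by (auto dest: spec[of _ m])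
        then show ?thesis using that by (auto simp: hC_def)
      qed
      then obtain b where b: "\<And>m. m \<in> ?X \<Longrightarrow> b m \<in> chains (minus_one_cliques l E m) (int l - p + 1) \<and> to_chain l C m = boundary (b m)"
        by metis
      obtain B where B: "B \<in> coeff_cochains l E (p - 1)" "coeff_diff l E B = C"
      proof -
        have "C F m = 0" if "neg_degree l m" "m \<notin> ?X" for F m
          using C(3)[of F m] that by (auto simp: neg_degrees_def)
        then have "\<exists>B\<in>coeff_cochains l E (p - 1). coeff_diff l E B = C"
          using coeff_coboundaryI[of C p ?X b] C(1,2) finite_neg_degrees neg b by blast
        then show ?thesis using that by blast
      qed
      have "realize l C = cdiff (gen l) (yz l) (realize l B)" unfolding B(2)[symmetric] by (rule realize_diff[OF B(1)])
      moreover have "realize l B \<in> cochains (gen l) ?M (yz l) (p - 1)" using B(1) realize_image by blast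
      moreover have "\<forall>F. realize l C F \<in> form_degree l d" using deg[OF C(1)] C(3) by blast
      ultimately show "realize l C \<in> coboundaries (gen l) ?M (form_degree l) (yz l) p d"
        unfolding coboundaries_def by blast
    }
    {
      assume "realize l C \<in> coboundaries (gen l) ?M (form_degree l) (yz l) p d"
      then obtain x where x: "x \<in> cochains (gen l) ?M (yz l) (p - 1)" "realize l C = cdiff (gen l) (yz l) x"
        unfolding coboundaries_def by blast
      obtain B where B: "B \<in> coeff_cochains l E (p - 1)" "x = realize l B"
        using x(1) realize_image[of "p - 1", where 'k = 'k] by blast
      have "C = coeff_diff l E B"
        by (rule realize_inj[OF C(1) coeff_diff_cochains[OF B(1)]]) (simp add: realize_diff[OF B(1)] x(2) B(2))
      then have "to_chain l C m = boundary (to_chain l B m)" if "m \<in> ?X" for m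
        using to_chain_diff[OF B(1) neg[OF that]] by simp
      moreover have "to_chain l B m \<in> chains (minus_one_cliques l E m) (int l - p + 1)" if "m \<in> ?X" for m
        using to_chain_chains[OF B(1) neg[OF that]] by (simp add: algebra_simps)
      ultimately show "hC C \<in> ?BS" by (auto simp: hC_def)
    }
  qed
  have good_diff: "good (C - C')" if C: "good C" and C': "good C'" for C C'
  proof -
    have "total_degree l m + 1 = d" if nz: "(C - C') F m \<noteq> 0" for F m
    proof -
      have "C F m \<noteq> 0 \<or> C' F m \<noteq> 0" using nz by auto
      then show ?thesis using C C' unfolding good_def by blast
    qed
    then show ?thesis using C C' coeff_cochains_diff[of C l E p C'] by (simp add: good_def coeff_diff_linear)
  qed
  have good_scale: "good (\<lambda>F m. a * C F m)" if "good C" for a C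
    using that coeff_cochains_scale[of C l E p a] by (auto simp: good_def coeff_diff_linear fun_eq_iff)
  have fin: "finite {m. C F m \<noteq> 0}" if "good C" for C F
    using that coeff_cochainsD(1)[of C l E p F] by (simp add: good_def)
  have R_diff: "R (z - w) (z' - w')" if R: "R z z'" "R w w'" for z z' w w'
  proof -
    obtain C where C: "good C" "z = hC C" "z' = realize l C" using R(1) by (auto simp: R_def)
    obtain C' where C': "good C'" "w = hC C'" "w' = realize l C'" using R(2) by (auto simp: R_def)
    have "z - w = hC (C - C')" unfolding C(2) C'(2) hC_def by (simp add: fun_eq_iff to_chain_linear)
    moreover have "z' - w' = realize l (C - C')"
      unfolding C(3) C'(3) realize_def using expand_diff[OF fin[OF C(1)] fin[OF C'(1)]]
      by (simp add: fun_eq_iff fun_diff_def)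
    ultimately show ?thesis using good_diff[OF C(1) C'(1)] by (auto simp: R_def)
  qed
  have R_scale: "R (?s a z) (cscale const a z')" if R: "R z z'" for a z z'
  proof -
    obtain C where C: "good C" "z = hC C" "z' = realize l C" using R by (auto simp: R_def)
    have "?s a z = hC (\<lambda>F m. a * C F m)" unfolding C(2) hC_def by (simp add: fun_eq_iff to_chain_linear)
    moreover have "cscale const a z' = realize l (\<lambda>F m. a * C F m)"
      unfolding C(3) realize_def cscale_def using expand_scale[OF fin[OF C(1)], where a = a]
      by (simp add: fun_eq_iff fmult_def)
    ultimately show ?thesis using good_scale[OF C(1)] by (auto simp: R_def)
  qed
  have good0: "good 0"
  proof -
    have "(0 :: 'k coeffs) \<in> coeff_cochains l E p" by (rule coeff_cochainsI) auto
    then show ?thesis by (auto simp: good_def coeff_diff_def fun_eq_iff)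
  qed
  have hC0: "hC 0 = 0" by (auto simp: hC_def to_chain_def fun_eq_iff)
  show ?thesis
  proof (rule has_qdim_rel[where R = R, OF vs1 vector_space_cscale _ _ _ _ R_diff R_scale _ _ dims])
    show "z \<in> ?ZS \<and> z' \<in> cocycles (gen l) ?M (form_degree l) (yz l) p d" if "R z z'" for z z'
      using that good_hC good_cocycle unfolding R_def by blast
    show "\<exists>z'. R z z'" if "z \<in> ?ZS" for z using hC_surj[OF that] unfolding R_def by blast
    show "\<exists>z. R z z'" if "z' \<in> cocycles (gen l) ?M (form_degree l) (yz l) p d" for z'
      using cocycle_good[OF that] unfolding R_def by blast
    show "R 0 0" unfolding R_def using good0 hC0 realize0 by metis
    show "z \<in> ?BS \<longleftrightarrow> z' \<in> coboundaries (gen l) ?M (form_degree l) (yz l) p d" if "R z z'" for z z'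
      using that RB unfolding R_def by blast
    interpret vector_space "cscale const :: 'k \<Rightarrow> 'k cochain \<Rightarrow> 'k cochain" by (rule vector_space_cscale)
    show "0 \<in> coboundaries (gen l) ?M (form_degree l) (yz l) p d" by (rule subspace_0[OF subspace_coboundaries])
  qed
qed

end

section \<open>Counting multidegrees\<close>

text \<open>Exponent vectors of the monomials of degree \<open>n\<close> in variables indexed by
  \<open>A\<close>.\<close>

definition count_sums :: "'a set \<Rightarrow> nat \<Rightarrow> ('a \<Rightarrow> nat) set" where
  "count_sums A n = {f. (\<forall>u. u \<notin> A \<longrightarrow> f u = 0) \<and> (\<Sum>u\<in>A. f u) = n}"

lemma count_sums_insert:
  assumes A: "finite A" "a \<notin> A"
  shows "bij_betw (\<lambda>(i, f). f(a := i)) (SIGMA i:{..n}. count_sums A (n - i)) (count_sums (insert a A) n)"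
proof (rule bij_betwI)
  have sum: "(\<Sum>u\<in>A. if u = a then i else f u) = (\<Sum>u\<in>A. f u)" for f :: "'a \<Rightarrow> nat" and i
    using A by (intro sum.cong) auto
  show "(\<lambda>(i, f). f(a := i)) \<in> (SIGMA i:{..n}. count_sums A (n - i)) \<rightarrow> count_sums (insert a A) n"
    using A by (auto simp: count_sums_def sum)
  show "(\<lambda>f. (f a, f(a := 0))) \<in> count_sums (insert a A) n \<rightarrow> (SIGMA i:{..n}. count_sums A (n - i))"
    using A by (auto simp: count_sums_def sum)
  show "(\<lambda>f. (f a, f(a := 0))) ((\<lambda>(i, f). f(a := i)) p) = p" if "p \<in> (SIGMA i:{..n}. count_sums A (n - i))" for p
    using that A by (auto simp: count_sums_def fun_eq_iff)
  show "(\<lambda>(i, f). f(a := i)) ((\<lambda>f. (f a, f(a := 0))) f) = f" if "f \<in> count_sums (insert a A) n" for f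
    by (auto simp: fun_eq_iff)
qed

lemma finite_count_sums: "finite A \<Longrightarrow> finite (count_sums A n)"
proof (induction A arbitrary: n rule: finite_induct)
  case empty
  have "count_sums {} n \<subseteq> {\<lambda>_. 0}" by (auto simp: count_sums_def)
  then show ?case using finite_subset by blast
next
  case (insert a A)
  then have "finite (SIGMA i:{..n}. count_sums A (n - i))" by auto
  then show ?case using bij_betw_finite[OF count_sums_insert[OF insert(1,2)]] by blast
qed

lemma card_count_sums_insert:
  assumes A: "finite A" "a \<notin> A"
  shows "card (count_sums (insert a A) n) = (\<Sum>i\<le>n. card (count_sums A i))"
proof -
  have "card (count_sums (insert a A) n) = card (SIGMA i:{..n}. count_sums A (n - i))"
    by (rule bij_betw_same_card[OF count_sums_insert[OF A], symmetric])
  also have "\<dots> = (\<Sum>i\<le>n. card (count_sums A (n - i)))"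
    using finite_count_sums[OF A(1)] by (intro card_SigmaI) auto
  also have "\<dots> = (\<Sum>i\<le>n. card (count_sums A i))"
    by (rule sum.reindex_bij_witness[of _ "\<lambda>i. n - i" "\<lambda>i. n - i"]) auto
  finally show ?thesis .
qed

text \<open>Adding a variable forms partial sums of the counts
  (\<open>card_count_sums_insert\<close>), and multiplication by \<open>1 - fps_X\<close> takes
  differences again.\<close>

lemma count_sums_gf:
  assumes "finite A"
  shows "Abs_fps (\<lambda>n. of_nat (card (count_sums A n))) * (1 - fps_X) ^ card A = (1 :: rat fps)"
  using assms
proof (induction A rule: finite_induct)
  case empty
  have "count_sums ({} :: 'a set) n = (if n = 0 then {\<lambda>_. 0} else {})" for n
    by (auto simp: count_sums_def)
  then show ?case by (auto simp: fps_eq_iff)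
next
  case (insert a A)
  let ?F = "\<lambda>A. Abs_fps (\<lambda>n. of_nat (card (count_sums A n))) :: rat fps"
  have "?F (insert a A) * (1 - fps_X) = ?F A"
  proof (rule fps_ext)
    fix n
    show "(?F (insert a A) * (1 - fps_X)) $ n = ?F A $ n"
      by (cases n) (simp_all add: algebra_simps card_count_sums_insert[OF insert(1,2)])
  qed
  moreover have "?F (insert a A) * (1 - fps_X) ^ card (insert a A) = (?F (insert a A) * (1 - fps_X)) * (1 - fps_X) ^ card A"
    using insert by (simp add: mult_ac)
  ultimately show ?case using insert by simp
qed

lemma count_sums_fls:
  assumes "finite A"
  shows "fls_nth (fls_X ^ k / (1 - fls_X) ^ card A) n =
    (of_nat (if n < int k then 0 else card (count_sums A (nat (n - int k)))) :: rat)"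
proof -
  let ?F = "Abs_fps (\<lambda>n. of_nat (card (count_sums A n))) :: rat fps"
  have "fps_to_fls (?F * (1 - fps_X) ^ card A) = 1" unfolding count_sums_gf[OF assms] by simp
  then have gf: "fps_to_fls ?F * (1 - fls_X) ^ card A = 1"
    by (simp add: fls_times_fps_to_fls fps_to_fls_power)
  then have ne: "(1 - fls_X :: rat fls) ^ card A \<noteq> 0" by (metis mult_zero_right zero_neq_one)
  have "fls_X ^ k / (1 - fls_X) ^ card A = fls_X ^ k * fps_to_fls ?F"
    using gf ne by (simp add: divide_eq_eq mult.assoc)
  then show ?thesis by (simp add: fls_X_power_times_conv_shift)
qed

lemma card_neg_degrees:
  assumes W: "W \<subseteq> {1..l}"
  shows "card {m \<in> neg_degrees l d. minus_ones l m = W} =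
    (if - d < int (2 * l - card W) then 0
     else card (count_sums (yz l - (+) l ` W) (nat (- d - int (2 * l - card W)))))"
proof -
  define A where "A = yz l - (+) l ` W"
  \<comment> \<open>Smallest absolute values of the free entries: 1 for \<open>z\<close>, but 2 for
    \<open>y_j\<close> with \<open>j \<notin> W\<close>, where -1 is excluded. With the entries -1
    on \<open>W\<close> they add up to \<open>2 * l + 1 - card W\<close>; the degree shift of
    \<open>log_monom_degree\<close> removes the 1 and leaves the exponent
    \<open>2 * l - card W\<close>.\<close>
  define off :: "nat \<Rightarrow> int" where "off u = (if u = 0 then 1 else 2)" for u
  have finW: "finite W" using W finite_subset by blast
  have cW: "card W \<le> l" using card_mono[OF _ W] by simp
  have sub: "(+) l ` W \<subseteq> yz l" using W by (auto simp: yz_image)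
  have finA: "finite A" "finite (yz l)" by (auto simp: A_def yz_def)
  have A: "A = insert 0 ((+) l ` ({1..l} - W))"
  proof -
    have "(+) l ` ({1..l} - W) = (+) l ` {1..l} - (+) l ` W" by (rule image_set_diff) simp
    moreover have "(0::nat) \<notin> (+) l ` W" using W by auto
    ultimately show ?thesis by (simp only: A_def yz_image insert_Diff_if if_False)
  qed
  have offA: "(\<Sum>u\<in>A. off u) = 1 + 2 * (int l - int (card W))"
  proof -
    have 0: "(0::nat) \<notin> (+) l ` ({1..l} - W)" by auto
    have "(\<Sum>u\<in>(+) l ` ({1..l} - W). off u) = (\<Sum>u\<in>(+) l ` ({1..l} - W). 2)"
      using 0 by (intro sum.cong) (auto simp: off_def)
    also have "\<dots> = 2 * int (card ({1..l} - W))" by (simp add: card_image)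
    also have "card ({1..l} - W) = l - card W" using W finW by (simp add: card_Diff_subset)
    finally show ?thesis unfolding A using 0 cW by (simp add: off_def)
  qed
  have tot: "total_degree l m = (\<Sum>u\<in>A. m u) - int (card W)" if "\<And>j. j \<in> W \<Longrightarrow> m (l + j) = -1" for m
  proof -
    have "total_degree l m = (\<Sum>u\<in>A. m u) + (\<Sum>u\<in>(+) l ` W. m u)"
      unfolding total_degree_def A_def by (rule sum.subset_diff[OF sub finA(2)])
    also have "(\<Sum>u\<in>(+) l ` W. m u) = (\<Sum>u\<in>(+) l ` W. -1)" by (intro sum.cong) (auto simp: that)
    also have "\<dots> = - int (card W)" by (simp add: card_image)
    finally show ?thesis by simp
  qed
  \<comment> \<open>Stated over \<open>int\<close>, the equation has no solution when its right side
    is negative, which covers both branches of the claim.\<close>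
  define S where "S = {f :: nat \<Rightarrow> nat. (\<forall>u. u \<notin> A \<longrightarrow> f u = 0) \<and> int (\<Sum>u\<in>A. f u) = - d - int (2 * l - card W)}"
  define \<Phi> where "\<Phi> f = (\<lambda>u. if u \<in> (+) l ` W then -1 else if u \<in> A then - off u - int (f u) else 0)" for f :: "nat \<Rightarrow> nat"
  define \<Psi> where "\<Psi> m = (\<lambda>u. if u \<in> A then nat (- m u - off u) else 0)" for m :: "nat \<Rightarrow> int"
  have AW: "u \<notin> A" if "u \<in> (+) l ` W" for u using that by (simp add: A_def)
  have yzA: "u \<in> yz l \<longleftrightarrow> u \<in> A \<or> u \<in> (+) l ` W" for u using sub by (auto simp: A_def)
  have off1: "1 \<le> off u" for u by (simp add: off_def)
  have "bij_betw \<Phi> S {m \<in> neg_degrees l d. minus_ones l m = W}"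
  proof (rule bij_betwI)
    show "\<Phi> \<in> S \<rightarrow> {m \<in> neg_degrees l d. minus_ones l m = W}"
    proof
      fix f assume f: "f \<in> S"
      have W1: "\<Phi> f (l + j) = -1" if "j \<in> W" for j using that by (simp add: \<Phi>_def)
      have "\<Phi> f u < 0" if "u \<in> yz l" for u using that off1[of u] yzA[of u] by (auto simp: \<Phi>_def)
      moreover have "\<Phi> f u = 0" if "u \<notin> yz l" for u using that yzA[of u] by (simp add: \<Phi>_def)
      ultimately have "neg_degree l (\<Phi> f)" by (simp add: neg_degree_def)
      moreover have "total_degree l (\<Phi> f) + 1 = d"
      proof -
        have "\<Phi> f u = - off u - int (f u)" if "u \<in> A" for u
        proof -
          have "u \<notin> (+) l ` W" using AW that by blast
          then show ?thesis using that by (simp add: \<Phi>_def)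
        qed
        then have "(\<Sum>u\<in>A. \<Phi> f u) = (\<Sum>u\<in>A. - off u - int (f u))" by simp
        also have "\<dots> = - (\<Sum>u\<in>A. off u) - int (\<Sum>u\<in>A. f u)" by (simp add: sum_subtractf sum_negf)
        finally show ?thesis using f cW tot[of "\<Phi> f", OF W1] by (simp add: S_def offA of_nat_diff)
      qed
      moreover have "minus_ones l (\<Phi> f) = W"
      proof -
        have "\<Phi> f (l + j) = -1 \<longleftrightarrow> j \<in> W" if "j \<in> {1..l}" for j
        proof (cases "j \<in> W")
          case False
          then have "l + j \<notin> (+) l ` W" by auto
          moreover have "l + j \<in> A" using that False by (simp add: A)
          ultimately show ?thesis using that False by (simp add: \<Phi>_def off_def)
        qed (simp add: W1)
        then show ?thesis using W by (auto simp: minus_ones_def)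
      qed
      ultimately show "\<Phi> f \<in> {m \<in> neg_degrees l d. minus_ones l m = W}" by (simp add: neg_degrees_def)
    qed
    have mA: "int (\<Psi> m u) = - m u - off u"
      if m: "m \<in> {m \<in> neg_degrees l d. minus_ones l m = W}" and u: "u \<in> A" for m u
    proof -
      have neg: "m u < 0" using m u yzA by (simp add: neg_degrees_def neg_degree_def)
      have "m u \<le> - off u"
      proof (cases "u = 0")
        case False
        then obtain j where j: "u = l + j" "j \<in> {1..l} - W" using u unfolding A by blast
        then have "m u \<noteq> -1" using m by (auto simp: minus_ones_def)
        then show ?thesis using neg False by (simp add: off_def)
      qed (use neg in \<open>simp add: off_def\<close>)
      then show ?thesis using u by (simp add: \<Psi>_def)
    qed
    have mW: "m (l + j) = -1" if "m \<in> {m \<in> neg_degrees l d. minus_ones l m = W}" "j \<in> W" for m j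
      using that by (auto simp: minus_ones_def)
    show "\<Psi> \<in> {m \<in> neg_degrees l d. minus_ones l m = W} \<rightarrow> S"
    proof
      fix m assume m: "m \<in> {m \<in> neg_degrees l d. minus_ones l m = W}"
      have "int (\<Sum>u\<in>A. \<Psi> m u) = (\<Sum>u\<in>A. - m u - off u)" using mA[OF m] by simp
      also have "\<dots> = - (\<Sum>u\<in>A. m u) - (\<Sum>u\<in>A. off u)" by (simp add: sum_subtractf sum_negf)
      also have "(\<Sum>u\<in>A. m u) = d - 1 + int (card W)" using tot[of m, OF mW[OF m]] m by (simp add: neg_degrees_def)
      finally show "\<Psi> m \<in> S" using cW by (simp add: S_def offA \<Psi>_def of_nat_diff)
    qed
    show "\<Psi> (\<Phi> f) = f" if "f \<in> S" for f
      using that AW by (auto simp: S_def \<Psi>_def \<Phi>_def fun_eq_iff)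
    show "\<Phi> (\<Psi> m) = m" if m: "m \<in> {m \<in> neg_degrees l d. minus_ones l m = W}" for m
    proof
      fix u
      consider "u \<in> (+) l ` W" | "u \<in> A" | "u \<notin> yz l" using yzA by blast
      then show "\<Phi> (\<Psi> m) u = m u"
      proof cases
        case 1 then show ?thesis using mW[OF m] by (auto simp: \<Phi>_def)
      next
        case 2 then show ?thesis using mA[OF m 2] AW by (auto simp: \<Phi>_def)
      next
        case 3 then show ?thesis using m yzA[of u] by (simp add: \<Phi>_def neg_degrees_def neg_degree_def)
      qed
    qed
  qed
  then have "card {m \<in> neg_degrees l d. minus_ones l m = W} = card S" by (rule bij_betw_same_card[symmetric])
  also have "S = (if - d < int (2 * l - card W) then {} else count_sums A (nat (- d - int (2 * l - card W))))"
  proof -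
    have "int s = - d - int k \<longleftrightarrow> \<not> - d < int k \<and> s = nat (- d - int k)" for s k by linarith
    then show ?thesis unfolding S_def count_sums_def by (simp only:) auto
  qed
  finally show ?thesis by (simp add: A_def)
qed

text \<open>Without the empty face there are no chains on an empty vertex set. So multidegrees
  without an entry -1 contribute nothing, and the sum runs over nonempty \<open>W\<close>
  only.\<close>

lemma homology_dim_empty: "homology_dim TYPE('k::field) k (clique_complex {} (induced_edges E {})) = 0"
proof -
  let ?\<Delta> = "clique_complex {} (induced_edges E {})"
  let ?s = "\<lambda>(a::'k) (c :: nat set \<Rightarrow> 'k) \<sigma>. a * c \<sigma>"
  have ch: "chains ?\<Delta> k = {0 :: nat set \<Rightarrow> 'k}" for k
    by (auto simp: chains_def clique_complex_def fun_eq_iff)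
  have b0: "boundary (0 :: nat set \<Rightarrow> 'k) = 0" by (auto simp: boundary_def fun_eq_iff)
  interpret vector_space ?s by (rule vector_space_fun)
  have "has_qdim ?s {0} {0} 0"
    by (rule has_qdimI[OF vector_space_fun, where A = "{}" and f = id]) (auto simp: qindep_def qspan_def)
  moreover have "{c \<in> chains ?\<Delta> k. boundary c = (0 :: nat set \<Rightarrow> 'k)} = {0}" unfolding ch using b0 by auto
  moreover have "boundary ` chains ?\<Delta> (k + 1) = {0 :: nat set \<Rightarrow> 'k}" unfolding ch using b0 by auto
  ultimately show ?thesis
    unfolding homology_dim_def
    using dim_quotient_eq(1)[OF vector_space_fun subspace_single_0] by simp
qed

section \<open>Assembling the Hilbert series\<close>

lemma vector_space_cochain_scale: "vector_space (cochain_scale :: 'k::field \<Rightarrow> 'k cochain \<Rightarrow> 'k cochain)"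
proof
  fix a b :: 'k and x y :: "'k cochain"
  show "cochain_scale a (x + y) = cochain_scale a x + cochain_scale a y"
    by (intro ext) (simp only: cochain_scale_def fmult_def plus_fun_apply distrib_left)
  show "cochain_scale (a + b) x = cochain_scale a x + cochain_scale b x"
    by (intro ext) (simp only: cochain_scale_def fmult_def plus_fun_apply const_hom distrib_right)
  show "cochain_scale a (cochain_scale b x) = cochain_scale (a * b) x"
    by (intro ext) (simp only: cochain_scale_def fmult_def const_hom mult.assoc)
  show "cochain_scale 1 x = x"
    by (intro ext) (simp only: cochain_scale_def fmult_def const_hom mult_1)
qed

lemma local_cohomology_has_HilbI:
  assumes "\<And>d. module.subspace cochain_scale (local_coboundaries l M p d)"
    and "\<And>d. has_qdim cochain_scale (local_cocycles l M p d) (local_coboundaries l M p d) (n d)"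
    and "\<And>d. of_nat (n d) = fls_nth f (- d)"
  shows "local_cohomology_has_Hilb l M p f"
  unfolding local_cohomology_has_Hilb_def
  using dim_quotient_eq[OF vector_space_cochain_scale assms(1,2)] assms(3) by simp

lemma local_cohomology_0:
  assumes sg: "simple_graph {1..0} E"
  shows "local_cocycles 0 (Omega1_graph 0 E :: 'k::field form1 set) i d = {0}"
    and "local_coboundaries 0 (Omega1_graph 0 E :: 'k form1 set) i d = {0}"
proof -
  let ?M = "Omega1_graph 0 E :: 'k form1 set"
  have M: "?M = {0}"
  proof -
    have "\<omega> = 0" if "\<omega> \<in> ?M" for \<omega>
      using that unfolding Omega1_graphic_iff[OF sg] by (auto simp: fun_eq_iff)
    then show ?thesis using fm.subspace_0[OF subspace_Omega1[OF sg], where 'k = 'k] by blast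
  qed
  have loc: "localize ?M f = {0}" for f
    unfolding M localize_def by (auto simp: fmult_def fun_eq_iff)
  have coch: "cech_cochains 0 ?M p = {0}" for p
    unfolding cech_cochains_def loc singleton_iff if_cancel by (auto intro: ext)
  have d0: "cech_diff 0 (0 :: 'k cochain) = 0" by (auto simp: cech_diff_def fmult_def fun_eq_iff sum_fun_apply)
  have deg: "(0 :: 'k cochain) \<in> cochain_degree 0 d" by (simp add: cochain_degree_def rat_homogeneous_zero)
  show "local_cocycles 0 ?M i d = {0}" unfolding local_cocycles_def coch using d0 deg by auto
  show "local_coboundaries 0 ?M i d = {0}" unfolding local_coboundaries_def coch using d0 deg by auto
qed

lemma subspace_local_coboundaries:
  assumes sg: "simple_graph {1..l} E" and l: "1 \<le> l"
  shows "module.subspace cochain_scale (local_coboundaries l (Omega1_graph l E :: 'k::field form1 set) i d)"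
proof -
  let ?M = "Omega1_graph l E :: 'k form1 set"
  interpret scaled_cech "gen l" ?M "form_degree l" const by (rule scaled_cech_gen[OF sg l])
  have "local_coboundaries l ?M i d = coboundaries (gen l) ?M (form_degree l) {1..l} i d"
    unfolding local_coboundaries_def coboundaries_def cech_cochains_eq[OF sg l] cech_diff_eq[abs_def]
      cochain_degree_def form_degree_def by auto
  then show ?thesis using subspace_coboundaries[of "{1..l}" i d] unfolding cochain_scale_eq by simp
qed

lemma has_qdim_local_cohomology:
  assumes sg: "simple_graph {1..l} E" and l: "1 \<le> l"
  shows "has_qdim cochain_scale (local_cocycles l (Omega1_graph l E) i d)
    (local_coboundaries l (Omega1_graph l E :: 'k::field form1 set) i d)
    (\<Sum>m\<in>neg_degrees l d. homology_dim TYPE('k) (int l - i)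
      (clique_complex (minus_ones l m) (induced_edges E (minus_ones l m))))"
  unfolding local_cohomology_yz[OF sg l] by (rule has_qdim_yz[OF sg l])

text \<open>The homology depends on a multidegree only through its set \<open>W\<close> of entries
  -1, so the sum is grouped by \<open>W\<close> and each group is counted by
  \<open>card_neg_degrees\<close>. The series is in the inverse variable, hence the coefficient at
  \<open>- d\<close>.\<close>

lemma sum_neg_degrees:
  fixes h :: "nat set \<Rightarrow> nat"
  assumes h: "h {} = 0"
  shows "(of_nat (\<Sum>m\<in>neg_degrees l d. h (minus_ones l m)) :: rat) =
    fls_nth (\<Sum>W | W \<noteq> {} \<and> W \<subseteq> {1..l}. of_nat (h W) * (fls_X ^ (2 * l - card W) / (1 - fls_X) ^ (l - card W + 1))) (- d)"
proof -
  have "(\<Sum>m\<in>neg_degrees l d. h (minus_ones l m)) =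
      (\<Sum>W\<in>Pow {1..l}. \<Sum>m\<in>{m \<in> neg_degrees l d. minus_ones l m = W}. h (minus_ones l m))"
    by (rule sum.group[symmetric]) (auto simp: finite_neg_degrees minus_ones_def)
  also have "\<dots> = (\<Sum>W\<in>Pow {1..l}. h W * card {m \<in> neg_degrees l d. minus_ones l m = W})"
    by (intro sum.cong refl) simp
  also have "\<dots> = (\<Sum>W | W \<noteq> {} \<and> W \<subseteq> {1..l}. h W * card {m \<in> neg_degrees l d. minus_ones l m = W})"
    by (rule sum.mono_neutral_right) (auto simp: h)
  finally have "(of_nat (\<Sum>m\<in>neg_degrees l d. h (minus_ones l m)) :: rat) =
      (\<Sum>W | W \<noteq> {} \<and> W \<subseteq> {1..l}. of_nat (h W) * of_nat (card {m \<in> neg_degrees l d. minus_ones l m = W}))"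
    by (simp only: of_nat_sum of_nat_mult)
  also have "\<dots> = (\<Sum>W | W \<noteq> {} \<and> W \<subseteq> {1..l}.
      fls_nth (of_nat (h W) * (fls_X ^ (2 * l - card W) / (1 - fls_X) ^ (l - card W + 1))) (- d))"
  proof (intro sum.cong refl)
    fix W assume "W \<in> {W. W \<noteq> {} \<and> W \<subseteq> {1..l}}"
    then have W: "W \<subseteq> {1..l}" by simp
    have finA: "finite (yz l - (+) l ` W)" by (simp add: yz_def)
    have cA: "card (yz l - (+) l ` W) = l - card W + 1"
    proof -
      have "card (yz l) = Suc l" unfolding yz_def by simp
      moreover have "(+) l ` W \<subseteq> yz l" using W by (auto simp: yz_image)
      moreover have "finite W" using W finite_subset by blast
      moreover have "card W \<le> l" using card_mono[OF _ W] by simp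
      ultimately show ?thesis by (simp add: card_Diff_subset card_image)
    qed
    have "(of_nat (card {m \<in> neg_degrees l d. minus_ones l m = W}) :: rat) =
        fls_nth (fls_X ^ (2 * l - card W) / (1 - fls_X) ^ (l - card W + 1)) (- d)"
      using count_sums_fls[OF finA, of "2 * l - card W" "- d"] unfolding cA card_neg_degrees[OF W] by simp
    moreover have "fls_nth (of_nat n * f) k = of_nat n * fls_nth f k" for n :: nat and f :: "rat fls" and k
      by (induction n) (simp_all add: distrib_right)
    ultimately show "(of_nat (h W) :: rat) * of_nat (card {m \<in> neg_degrees l d. minus_ones l m = W}) =
        fls_nth (of_nat (h W) * (fls_X ^ (2 * l - card W) / (1 - fls_X) ^ (l - card W + 1))) (- d)"
      by (simp only:)
  qed
  also have "\<dots> = fls_nth (\<Sum>W | W \<noteq> {} \<and> W \<subseteq> {1..l}.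
      of_nat (h W) * (fls_X ^ (2 * l - card W) / (1 - fls_X) ^ (l - card W + 1))) (- d)"
    by (simp only: fls_nth_sum)
  finally show ?thesis .
qed

theorem corollary7p13:
  fixes l :: nat and E :: "nat set set" and i :: int
  assumes "simple_graph {1..l} E"
  shows "local_cohomology_has_Hilb l
           (Omega1 l (graphic_arrangement l E :: (nat \<Rightarrow> 'k::field) set set)) i
           (\<Sum>W | W \<noteq> {} \<and> W \<subseteq> {1..l}.
              of_nat (homology_dim TYPE('k) (int l - i) (clique_complex W (induced_edges E W)))
              * (fls_X ^ (2 * l - card W) / (1 - fls_X) ^ (l - card W + 1)))"
proof (cases "l = 0")
  case True
  have sg: "simple_graph {1..0} E" using assms unfolding True .
  have 0: "(\<Sum>W | W \<noteq> {} \<and> W \<subseteq> {1..0}. F W) = 0" for F :: "nat set \<Rightarrow> rat fls"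
    by (intro sum.neutral) auto
  show ?thesis
    unfolding True 0
  proof (rule local_cohomology_has_HilbI[where n = "\<lambda>_. 0"])
    show "has_qdim cochain_scale (local_cocycles 0 (Omega1_graph 0 E) i d)
        (local_coboundaries 0 (Omega1_graph 0 E :: 'k form1 set) i d) 0" for d
      unfolding local_cohomology_0[OF sg]
      by (rule has_qdimI[OF vector_space_cochain_scale, where A = "{}" and f = id]) (auto simp: qindep_def qspan_def)
    show "module.subspace cochain_scale (local_coboundaries 0 (Omega1_graph 0 E :: 'k form1 set) i d)" for d
    proof -
      interpret vector_space "cochain_scale :: 'k \<Rightarrow> 'k cochain \<Rightarrow> 'k cochain" by (rule vector_space_cochain_scale)
      show ?thesis unfolding local_cohomology_0[OF sg] by (rule subspace_single_0)
    qed
  qed simp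
next
  case False
  then have l: "1 \<le> l" by simp
  show ?thesis
    by (rule local_cohomology_has_HilbI[OF subspace_local_coboundaries[OF assms l]
          has_qdim_local_cohomology[OF assms l] sum_neg_degrees[of "\<lambda>W. homology_dim TYPE('k) (int l - i) (clique_complex W (induced_edges E W))", OF homology_dim_empty]])
qed

end
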